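(* Let $1<\alpha<2$, $-1<\beta\le1$, and let $X$ be a random variable with $\mathbf{E}X=0$ and $X\in\mathcal{D}(\alpha,\beta)$. If $n=n(a)$ is a positive-integer-valued function with $n(a)\to\infty$ as $a\to0$ and $na/c_n\to\infty$ as $a\to0$, then $$\mathbf{P}(\tau^{(a)}>n)\sim\mathbf{E}\tau^{(a)}\,\mathbf{P}(X\ge na)\qquad\text{as }a\to0.$$
   Context: Let $X,X_1,X_2,\dots$ be i.i.d. with $\mathbf{E}X=0$, and fix $a_0>0$. For $a\in[0,a_0]$ let $S^{(a)}$ be the random walk $S^{(a)}_0=0$, $S^{(a)}_n=\sum_{i=1}^n (X_i-a)$, and let $\tau^{(a)}:=\min\{k\ge1: S^{(a)}_k<0\}$. Limits $a\to0$ are taken along $a>0$, and $f(a)\sim g(a)$ means $f(a)/g(a)\to1$ as $a\to0$. $X\in\mathcal{D}(\alpha,\beta)$ means that there are constants $b_n>0$ such that $(X_1+\dots+X_n)/b_n$ converges in distribution to the stable law with characteristic function $$G_{\alpha,\beta}(t)=\exp\Bigl\{-|t|^{\alpha}\Bigl(1-i\beta\frac{t}{|t|}\tan\frac{\pi\alpha}{2}\Bigr)\Bigr\}.$$ Let $V(u):=\mathbf{E}[X^2;|X|\le u]$ for $u>0$, and let $c_n:=\sup\{u>0: u^{-2}V(u)>n^{-1}\}$, which is finite and positive for all sufficiently large $n$. *)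

theory Defs
  imports "HOL-Probability.Probability"
begin

text \<open>The generic variable \<open>X\<close> and its independent copies \<open>\<xi> 1, \<xi> 2, \<dots>\<close>; the value \<open>\<xi> 0\<close> is never used.\<close>

definition iid_copies :: "'a measure \<Rightarrow> ('a \<Rightarrow> real) \<Rightarrow> (nat \<Rightarrow> 'a \<Rightarrow> real) \<Rightarrow> bool" where
  "iid_copies M X \<xi> \<longleftrightarrow>
     X \<in> borel_measurable M \<and>
     prob_space.indep_vars M (\<lambda>_. borel) \<xi> {1..} \<and>
     (\<forall>i\<ge>1. distr M borel (\<xi> i) = distr M borel X)"

text \<open>At \<open>t = 0\<close> the formula below gives 1, because \<open>0 / 0 = 0\<close> and \<open>0 powr \<alpha> = 0\<close>.\<close>

definition stable_char :: "real \<Rightarrow> real \<Rightarrow> real \<Rightarrow> complex" where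
  "stable_char \<alpha> \<beta> t =
     exp (- (complex_of_real (\<bar>t\<bar> powr \<alpha>) *
             (1 - \<i> * complex_of_real (\<beta> * (t / \<bar>t\<bar>) * tan (pi * \<alpha> / 2)))))"

text \<open>Domain of attraction with norming constants \<open>b\<close> and no centring, expressed through
  the copies \<open>\<xi>\<close> of the variable.\<close>

definition attracted_to_stable ::
  "'a measure \<Rightarrow> (nat \<Rightarrow> 'a \<Rightarrow> real) \<Rightarrow> real \<Rightarrow> real \<Rightarrow> bool" where
  "attracted_to_stable M \<xi> \<alpha> \<beta> \<longleftrightarrow>
     (\<exists>b \<mu>. (\<forall>n. b n > 0) \<and> real_distribution \<mu> \<and>
        (\<forall>t. char \<mu> t = stable_char \<alpha> \<beta> t) \<and>
        weak_conv_m (\<lambda>n. distr M borel (\<lambda>\<omega>. (\<Sum>i=1..n. \<xi> i \<omega>) / b n)) \<mu>)"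

definition trunc_moment :: "'a measure \<Rightarrow> ('a \<Rightarrow> real) \<Rightarrow> real \<Rightarrow> real" where
  "trunc_moment M X u = (LINT \<omega>:{\<omega> \<in> space M. \<bar>X \<omega>\<bar> \<le> u}|M. (X \<omega>)\<^sup>2)"

text \<open>The set below is nonempty and bounded above for all large \<open>n\<close> if \<open>X\<close> is not almost surely 0;
  for other \<open>n\<close> the value is unspecified and irrelevant to limits.\<close>

definition norming :: "'a measure \<Rightarrow> ('a \<Rightarrow> real) \<Rightarrow> nat \<Rightarrow> real" where
  "norming M X n = Sup {u. u > 0 \<and> trunc_moment M X u / u\<^sup>2 > 1 / real n}"

definition walk :: "(nat \<Rightarrow> 'a \<Rightarrow> real) \<Rightarrow> real \<Rightarrow> nat \<Rightarrow> 'a \<Rightarrow> real" where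
  "walk \<xi> a k \<omega> = (\<Sum>i=1..k. (\<xi> i \<omega> - a))"

text \<open>The infimum of the empty set is \<open>\<infinity>\<close> in \<^typ>\<open>enat\<close>.\<close>

definition exit_time :: "(nat \<Rightarrow> 'a \<Rightarrow> real) \<Rightarrow> real \<Rightarrow> 'a \<Rightarrow> enat" where
  "exit_time \<xi> a \<omega> = Inf (enat ` {k. k \<ge> 1 \<and> walk \<xi> a k \<omega> < 0})"

text \<open>An infinite expectation is sent to 0 by \<^const>\<open>enn2real\<close>.  A quotient with this quantity as a
  factor of the denominator can therefore tend to 1 only if the expectation is eventually finite.\<close>

definition mean_exit_time :: "'a measure \<Rightarrow> (nat \<Rightarrow> 'a \<Rightarrow> real) \<Rightarrow> real \<Rightarrow> real" where
  "mean_exit_time M \<xi> a = enn2real (\<integral>\<^sup>+ \<omega>. ennreal_of_enat (exit_time \<xi> a \<omega>) \<partial>M)"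

end

theory Submission
  imports Defs "HOL-Real_Asymp.Real_Asymp"
begin

text \<open>
  Write \<open>F x = P(X \<ge> x)\<close>, \<open>x = n a\<close>, \<open>h = n F(x)\<close> and \<open>\<mu>\<^sub>n = E min(\<tau>, n)\<close>.  The hypotheses give
  \<open>h \<longrightarrow> 0\<close>, and survival up to time \<open>n\<close> is caused by one big jump: the step that first exceeds
  about \<open>x\<close> occurs at a time \<open>k \<le> n\<close> before which the walk has not exited, which has
  probability about \<open>\<Sum>\<^sub>k P(\<tau> \<ge> k) F(x) = \<mu>\<^sub>n F(x)\<close>.

  Without such a jump the walk must survive until a time of order \<open>n\<close> or pass a small multiple
  of \<open>x\<close>.  By Markov's inequality the former has probability \<open>O(\<mu>\<^sub>n / n)\<close>, and so has the latter,
  because from such a height the walk survives for a time of order \<open>n\<close> with probability at least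
  \<open>1/2\<close>.  Climbing the rest with jumps below \<open>(1 - d) x\<close> costs two further factors \<open>h\<close>, so this
  contributes only \<open>O(h) \<mu>\<^sub>n F(x)\<close>.

  Hence \<open>\<mu>\<^sub>n\<^sub>+\<^sub>1 \<le> \<mu>\<^sub>n (1 + C F(n a))\<close>, and since the sum of \<open>F(j a)\<close> over \<open>j \<ge> n\<close> is \<open>O(h)\<close>, the mean
  exit time is finite and asymptotically equal to \<open>\<mu>\<^sub>n\<close>.

  Regular variation of \<open>F\<close> is derived from the characteristic function \<open>\<phi>\<close> of \<open>X\<close>: the
  logarithms \<open>n (\<phi>(t / b\<^sub>n) - 1)\<close> converge, their second differences are characteristic functions of
  finite measures, and the continuity theorem identifies the limit of \<open>n P(X \<ge> x b\<^sub>n)\<close>.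
\<close>

section \<open>Two Mellin integrals\<close>

text \<open>The shape of the proof is dictated by the factor \<open>mu a n\<close>. It may be much
  smaller than \<open>n\<close>, and nothing is known beforehand about \<open>E \<tau>\<close>, not
  even that it is finite. An error of order \<open>n h\<close> would therefore be useless: each
  unlikely event has to be attached to a stopping time that precedes the exit. The drift enters only
  as the level \<open>k a\<close> that the sums without drift must exceed, so that the maximal
  inequalities are uniform in \<open>a\<close>. The condition \<beta> > -1 gives upward jumps a
  positive share of the Levy measure. The left tail, the truncated second moment and the tail
  expectation are then all bounded through the right tail \<open>F\<close>, and \<open>h\<close>
  alone controls every error. That \<open>h\<close> vanishes is read off from \<open>c_n\<close>,
  which balances \<open>V(u) / u^2\<close> against \<open>1 / n\<close>: \<open>V(u)\<close> is at
  least of order \<open>u^2 F(u)\<close>, and \<open>F\<close> at least halves at each doubling of a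
  large argument, so \<open>n F\<close> decays geometrically beyond \<open>c_n\<close>. The stable
  law is given only by its characteristic function; the Mellin integrals are what identifies the
  weights of its Levy measure.\<close>

lemma Beta_reflection_real:
  assumes "0 < p" "p < (1::real)"
  shows "Beta p (1 - p) = pi / sin (pi * p)"
proof -
  have "complex_of_real (Gamma p * Gamma (1 - p)) = complex_of_real (pi / sin (pi * p))"
    using Gamma_reflection_complex[of "complex_of_real p"]
    by (simp flip: Gamma_complex_of_real sin_of_real)
  then have "Gamma p * Gamma (1 - p) = pi / sin (pi * p)"
    using of_real_eq_iff by blast
  then show ?thesis by (simp add: Beta_def)
qed

text \<open>The substitution \<open>u^2 = v / (1 - v)\<close> turns the integral into half of
  \<open>Beta (p/2) (1 - p/2)\<close>, which the reflection formula evaluates.\<close>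

lemma nn_integral_powr_div_1_plus_square:
  assumes p: "0 < p" "p < (2::real)"
  shows "(\<integral>\<^sup>+u. ennreal (u powr (p - 1) / (1 + u\<^sup>2)) * indicator {0<..} u \<partial>lborel)
           = ennreal (pi / 2 / sin (pi * p / 2))"
proof -
  define g where "g v = (v / (1 - v)) powr (1/2)" for v :: real
  define g' where "g' v = (if v \<in> {0<..<1} then (1/2) * v powr (-1/2) * (1 - v) powr (-3/2) else 0)" for v :: real
  define f where "f u = u powr (p - 1) / (1 + u\<^sup>2)" for u :: real
  let ?h = "\<lambda>v::real. (1/2) * (v powr (p / 2 - 1) * (1 - v) powr ((1 - p/2) - 1))"
  have fg: "f (g v) * g' v = ?h v" if v: "0 < v" "v < 1" for v
  proof -
    have *: "(g v)\<^sup>2 = v / (1 - v)"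
      using v by (simp add: g_def power2_eq_square flip: powr_add)
    have "f (g v) = (v / (1 - v)) powr ((p - 1) / 2) * (1 - v)"
      unfolding f_def * using v by (simp add: g_def powr_powr field_simps)
    also have "\<dots> * g' v = (1/2) * (v powr ((p - 1) / 2) * v powr (-1/2)) *
        ((1 - v) powr (- ((p - 1) / 2)) * (1 - v) powr 1 * (1 - v) powr (-3/2))"
      using v by (simp add: g'_def powr_divide powr_minus field_simps)
    also have "v powr ((p - 1) / 2) * v powr (-1/2) = v powr (p / 2 - 1)"
      by (subst powr_add[symmetric], rule arg_cong[where f="(powr) v"]) (simp add: field_simps)
    also have "(1 - v) powr (- ((p - 1) / 2)) * (1 - v) powr 1 * (1 - v) powr (-3/2)
        = (1 - v) powr ((1 - p/2) - 1)"
      by ((subst powr_add[symmetric])+, rule arg_cong[where f="(powr) (1 - v)"]) (simp add: field_simps)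
    finally show ?thesis by (simp only: mult.assoc)
  qed
  have H: "(?h has_integral (1/2) * Beta (p/2) (1 - p/2)) {0<..<1}"
    using has_integral_mult_right[OF has_integral_Beta_real[of "p/2" "1 - p/2"], of "1/2"] p
    by (simp add: has_integral_Icc_iff_Ioo)
  have Hae: "?h absolutely_integrable_on {0<..<1}"
    using H by (intro nonnegative_absolutely_integrable_1) auto
  have ei0: "einterval 0 \<infinity> = {0<..}" and ei: "einterval 0 1 = {0<..<1::real}"
    by (auto simp: einterval_def zero_ereal_def one_ereal_def)
  have Hint: "set_integrable lborel {0<..<1} ?h"
    using Hae by (auto simp: set_integrable_def integrable_completion)
  have int: "set_integrable lborel (einterval 0 1) (\<lambda>v. f (g v) * g' v)"
    unfolding ei using Hint by (subst set_integrable_cong[OF refl refl, of _ _ ?h]) (auto simp: fg)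
  have deriv: "DERIV g v :> g' v" if v: "0 < v" "v < 1" for v
  proof -
    have "DERIV g v :> (1/2) * (v / (1 - v)) powr (1/2 - 1) * (1 / (1 - v)\<^sup>2)"
      unfolding g_def using v
      by (auto intro!: derivative_eq_intros simp: field_simps power2_eq_square)
    also have "(1/2) * (v / (1 - v)) powr (1/2 - 1) * (1 / (1 - v)\<^sup>2)
       = (1/2) * v powr (-1/2) * ((1 - v) powr (1/2) * (1 - v) powr (-2))"
      using v by (simp add: powr_divide powr_minus field_simps)
    also have "(1 - v) powr (1/2) * (1 - v) powr (-2) = (1 - v) powr (-3/2)"
      by (subst powr_add[symmetric]) simp
    finally show ?thesis using v by (simp add: g'_def)
  qed
  have lim0: "((ereal \<circ> g \<circ> real_of_ereal) \<longlongrightarrow> 0) (at_right 0)"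
  proof -
    have "(g \<longlongrightarrow> 0) (at_right 0)" unfolding g_def by real_asymp
    then show ?thesis
      unfolding zero_ereal_def
      by (intro iffD2[OF ereal_tendsto_simps1(2)]) (simp add: comp_def)
  qed
  have lim1: "((ereal \<circ> g \<circ> real_of_ereal) \<longlongrightarrow> \<infinity>) (at_left 1)"
  proof -
    have "filterlim g at_top (at_left 1)" unfolding g_def by real_asymp
    then show ?thesis
      unfolding one_ereal_def
      by (intro iffD2[OF ereal_tendsto_simps1(1)]) (simp add: comp_def tendsto_PInfty_eq_at_top)
  qed
  have dg: "DERIV g x :> g' x" if "0 < ereal x" "ereal x < 1" for x
    using that deriv by (auto simp: zero_ereal_def one_ereal_def)
  have cf: "isCont f (g x)" if "0 < ereal x" "ereal x < 1" for x
    using that unfolding f_def g_def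
    by (intro continuous_intros) (auto simp: zero_ereal_def one_ereal_def sum_power2_gt_zero_iff add_nonneg_eq_0_iff)
  have cg': "isCont g' x" if "0 < ereal x" "ereal x < 1" for x
  proof -
    have "isCont (\<lambda>v. (1/2) * v powr (-1/2) * (1 - v) powr (-3/2)) x"
      using that by (intro continuous_intros) (auto simp: zero_ereal_def one_ereal_def)
    moreover have "\<forall>\<^sub>F v in nhds x. g' v = (1/2) * v powr (-1/2) * (1 - v) powr (-3/2)"
      using that eventually_nhds_in_open[of "{0<..<1}" x]
      by (auto simp: g'_def zero_ereal_def one_ereal_def elim!: eventually_mono)
    ultimately show ?thesis by (simp only: isCont_cong)
  qed
  have fnn: "f u \<ge> 0" and gnn: "g' u \<ge> 0" for u by (simp_all add: f_def g'_def)
  have sub: "set_integrable lborel (einterval 0 \<infinity>) f" "(LBINT x=0..\<infinity>. f x) = (LBINT x=0..1. (f (g x) * g' x))"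
    using interval_integral_substitution_nonneg[of 0 1 g g' f, OF _ dg cf cg' fnn gnn lim0 lim1 int] by simp_all
  have "(LBINT x=0..1. (f (g x) * g' x)) = (LBINT x:{0<..<1}. f (g x) * g' x)"
    by (simp add: interval_lebesgue_integral_def ei)
  also have "\<dots> = (LBINT x:{0<..<1}. ?h x)"
    by (intro set_lebesgue_integral_cong) (auto simp only: fg greaterThanLessThan_iff, simp)
  also have "\<dots> = (1/2) * Beta (p/2) (1 - p/2)"
    unfolding set_borel_integral_eq_integral(2)[OF Hint] using H by (rule integral_unique)
  also have "\<dots> = pi / 2 / sin (pi * p / 2)"
    using p by (subst Beta_reflection_real) auto
  finally have 1: "(LBINT x:{0<..}. f x) = pi / 2 / sin (pi * p / 2)"
    using sub(2) by (simp add: interval_lebesgue_integral_def ei0)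
  have 2: "set_integrable lborel {0<..} f" using sub(1) ei0 by simp
  have "(\<integral>\<^sup>+u. ennreal (indicator {0<..} u *\<^sub>R f u) \<partial>lborel) = ennreal (pi / 2 / sin (pi * p / 2))"
    using 1 2 unfolding set_integrable_def set_lebesgue_integral_def
    by (subst nn_integral_eq_integral) (auto simp: f_def)
  then show ?thesis
    unfolding f_def nn_integral_set_ennreal by (simp add: mult_ac)
qed

text \<open>Euler's integral for \<open>Gamma (1 + \<alpha>)\<close> after the substitution
  \<open>t = x * u\<close>.\<close>

lemma nn_integral_powr_exp:
  assumes "0 < x" "-1 < (\<alpha>::real)"
  shows "(\<integral>\<^sup>+u. ennreal (u powr \<alpha> * exp (- (u * x))) * indicator {0<..} u \<partial>lborel)
           = ennreal (Gamma (1 + \<alpha>) * x powr (- 1 - \<alpha>))"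
proof -
  have "ennreal (Gamma (1 + \<alpha>)) = (\<integral>\<^sup>+t. ennreal (indicator {0..} t * t powr \<alpha> / exp t) \<partial>lborel)"
    using Gamma_conv_nn_integral_real[of "1 + \<alpha>"] assms by simp
  also have "\<dots> = \<bar>x\<bar> * (\<integral>\<^sup>+u. ennreal (indicator {0..} (0 + x * u) * (0 + x * u) powr \<alpha> / exp (0 + x * u)) \<partial>lborel)"
    by (intro nn_integral_real_affine) (use assms in auto)
  also have "(\<integral>\<^sup>+u. ennreal (indicator {0..} (0 + x * u) * (0 + x * u) powr \<alpha> / exp (0 + x * u)) \<partial>lborel)
    = (\<integral>\<^sup>+u. ennreal (x powr \<alpha>) * (ennreal (u powr \<alpha> * exp (- (u * x))) * indicator {0<..} u) \<partial>lborel)"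
    using assms
    by (intro nn_integral_cong)
       (auto simp: powr_mult exp_minus field_simps zero_le_mult_iff not_less simp flip: ennreal_mult' split: split_indicator)
  also have "\<dots> = ennreal (x powr \<alpha>) * (\<integral>\<^sup>+u. ennreal (u powr \<alpha> * exp (- (u * x))) * indicator {0<..} u \<partial>lborel)"
    by (intro nn_integral_cmult) simp
  finally have "ennreal (Gamma (1 + \<alpha>)) = ennreal (x powr (1 + \<alpha>)) *
      (\<integral>\<^sup>+u. ennreal (u powr \<alpha> * exp (- (u * x))) * indicator {0<..} u \<partial>lborel)"
    using assms by (simp add: powr_add mult_ac flip: ennreal_mult' mult.assoc)
  then have "ennreal (x powr (- 1 - \<alpha>)) * ennreal (Gamma (1 + \<alpha>)) =
      (ennreal (x powr (- 1 - \<alpha>)) * ennreal (x powr (1 + \<alpha>))) *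
      (\<integral>\<^sup>+u. ennreal (u powr \<alpha> * exp (- (u * x))) * indicator {0<..} u \<partial>lborel)"
    by (simp add: mult.assoc)
  also have "ennreal (x powr (- 1 - \<alpha>)) * ennreal (x powr (1 + \<alpha>)) = 1"
    using assms by (simp flip: ennreal_mult' powr_add)
  finally have "(\<integral>\<^sup>+u. ennreal (u powr \<alpha> * exp (- (u * x))) * indicator {0<..} u \<partial>lborel)
      = ennreal (x powr (- 1 - \<alpha>)) * ennreal (Gamma (1 + \<alpha>))" by simp
  also have "\<dots> = ennreal (Gamma (1 + \<alpha>) * x powr (- 1 - \<alpha>))"
    by (subst ennreal_mult'[symmetric]) (simp_all add: mult.commute)
  finally show ?thesis .
qed

text \<open>Writing \<open>x powr (- 1 - \<alpha>)\<close> as a Laplace transform reduces the integral against \<open>f\<close>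
  to the Laplace transform of \<open>f\<close>, by Tonelli.\<close>

lemma nn_integral_powr_via_Laplace:
  fixes f :: "real \<Rightarrow> real"
  assumes [measurable]: "f \<in> borel_measurable borel"
    and f: "\<And>x. x \<ge> 0 \<Longrightarrow> f x \<ge> 0" and \<alpha>: "-1 < \<alpha>"
    and L: "\<And>u. u > 0 \<Longrightarrow> (\<integral>\<^sup>+x. ennreal (f x * exp (- (u * x))) * indicator {0..} x \<partial>lborel) = ennreal (L u)"
    and I: "(\<integral>\<^sup>+u. ennreal (u powr \<alpha> * L u) * indicator {0<..} u \<partial>lborel) = ennreal I" and "I \<ge> 0"
  shows "(\<integral>\<^sup>+x. ennreal (f x * x powr (- 1 - \<alpha>)) * indicator {0<..} x \<partial>lborel) = ennreal (I / Gamma (1 + \<alpha>))"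
proof -
  have G: "Gamma (1 + \<alpha>) > 0" using \<alpha> by (intro Gamma_real_pos) auto
  have "ennreal (Gamma (1 + \<alpha>)) * (\<integral>\<^sup>+x. ennreal (f x * x powr (- 1 - \<alpha>)) * indicator {0<..} x \<partial>lborel)
     = (\<integral>\<^sup>+x. ennreal (f x) * indicator {0<..} x * (\<integral>\<^sup>+u. ennreal (u powr \<alpha> * exp (- (u * x))) * indicator {0<..} u \<partial>lborel) \<partial>lborel)"
  proof -
    have "ennreal (Gamma (1 + \<alpha>)) * (\<integral>\<^sup>+x. ennreal (f x * x powr (- 1 - \<alpha>)) * indicator {0<..} x \<partial>lborel)
      = (\<integral>\<^sup>+x. ennreal (Gamma (1 + \<alpha>)) * (ennreal (f x * x powr (- 1 - \<alpha>)) * indicator {0<..} x) \<partial>lborel)"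
      by (rule nn_integral_cmult[symmetric]) measurable
    also have "\<dots> = (\<integral>\<^sup>+x. ennreal (f x) * indicator {0<..} x * (\<integral>\<^sup>+u. ennreal (u powr \<alpha> * exp (- (u * x))) * indicator {0<..} u \<partial>lborel) \<partial>lborel)"
    proof (intro nn_integral_cong)
      fix x :: real
      show "ennreal (Gamma (1 + \<alpha>)) * (ennreal (f x * x powr (- 1 - \<alpha>)) * indicator {0<..} x) =
        ennreal (f x) * indicator {0<..} x * (\<integral>\<^sup>+u. ennreal (u powr \<alpha> * exp (- (u * x))) * indicator {0<..} u \<partial>lborel)"
      proof (cases "x > 0")
        case True
        then have "indicator {0<..} x = (1::ennreal)" by simp
        then show ?thesis
          using G f[of x] True unfolding nn_integral_powr_exp[OF True \<alpha>]
          by (simp add: mult_ac flip: ennreal_mult)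
      next
        case False
        then have "indicator {0<..} x = (0::ennreal)" by simp
        then show ?thesis by (simp only: mult_zero_left mult_zero_right)
      qed
    qed
    finally show ?thesis .
  qed
  also have "\<dots> = (\<integral>\<^sup>+x. (\<integral>\<^sup>+u. ennreal (f x) * indicator {0<..} x * (ennreal (u powr \<alpha> * exp (- (u * x))) * indicator {0<..} u) \<partial>lborel) \<partial>lborel)"
    by (intro nn_integral_cong nn_integral_cmult[symmetric]) measurable
  also have "\<dots> = (\<integral>\<^sup>+u. (\<integral>\<^sup>+x. ennreal (f x) * indicator {0<..} x * (ennreal (u powr \<alpha> * exp (- (u * x))) * indicator {0<..} u) \<partial>lborel) \<partial>lborel)"
    by (rule lborel_pair.Fubini') measurable
  also have "\<dots> = (\<integral>\<^sup>+u. ennreal (u powr \<alpha> * L u) * indicator {0<..} u \<partial>lborel)"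
  proof (intro nn_integral_cong)
    fix u :: real
    show "(\<integral>\<^sup>+x. ennreal (f x) * indicator {0<..} x * (ennreal (u powr \<alpha> * exp (- (u * x))) * indicator {0<..} u) \<partial>lborel)
      = ennreal (u powr \<alpha> * L u) * indicator {0<..} u"
    proof (cases "u > 0")
      case True
      have "(\<integral>\<^sup>+x. ennreal (f x) * indicator {0<..} x * (ennreal (u powr \<alpha> * exp (- (u * x))) * indicator {0<..} u) \<partial>lborel)
        = (\<integral>\<^sup>+x. ennreal (u powr \<alpha>) * (ennreal (f x * exp (- (u * x))) * indicator {0..} x) \<partial>lborel)"
      proof (rule nn_integral_cong_AE, rule AE_mp[OF AE_lborel_singleton[of 0]], rule AE_I2, rule impI)
        fix x :: real assume "x \<noteq> 0"
        then consider "x > 0" | "x < 0" by linarith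
        then show "ennreal (f x) * indicator {0<..} x * (ennreal (u powr \<alpha> * exp (- (u * x))) * indicator {0<..} u)
            = ennreal (u powr \<alpha>) * (ennreal (f x * exp (- (u * x))) * indicator {0..} x)"
          using f[of x] True by cases (simp_all add: ennreal_mult mult_ac)
      qed
      also have "\<dots> = ennreal (u powr \<alpha>) * ennreal (L u)"
        using True by (subst nn_integral_cmult) (auto simp: L)
      finally show ?thesis using True by (simp add: ennreal_mult')
    next
      case False
      then have "indicator {0<..} u = (0::ennreal)" by simp
      then show ?thesis by (simp only: mult_zero_left mult_zero_right nn_integral_const)
    qed
  qed
  also note I
  finally have *: "ennreal (Gamma (1 + \<alpha>)) * (\<integral>\<^sup>+x. ennreal (f x * x powr (- 1 - \<alpha>)) * indicator {0<..} x \<partial>lborel) = ennreal I" .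
  have "J = ennreal (I / g)" if "ennreal g * J = ennreal I" "g > 0" for g J
  proof -
    have "ennreal (1 / g) * ennreal g = 1" using that by (subst ennreal_mult[symmetric]) auto
    then have "J = ennreal (1 / g) * (ennreal g * J)" by (simp add: mult.assoc[symmetric])
    also have "\<dots> = ennreal (I / g)"
      using that \<open>I \<ge> 0\<close> by (subst that(1), subst ennreal_mult[symmetric]) auto
    finally show ?thesis .
  qed
  from this[OF * G] show ?thesis .
qed

section \<open>Laplace transforms of \<open>1 - cos x\<close> and \<open>x - sin x\<close>\<close>

lemma Laplace_1_minus_cos:
  assumes u: "u > (0::real)"
  shows "(\<integral>\<^sup>+x. ennreal ((1 - cos x) * exp (- (u * x))) * indicator {0..} x \<partial>lborel) = ennreal (1 / (u * (1 + u\<^sup>2)))"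
proof -
  define i where "i = 1 / u"
  define k where "k = 1 / (1 + u\<^sup>2)"
  let ?e = "\<lambda>x. exp (- (u * x))"
  \<comment> \<open>The two summands are antiderivatives of \<open>exp (- u * x)\<close> and of
    \<open>- exp (- u * x) * cos x\<close>. Abbreviating \<open>1 / u\<close> and
    \<open>1 / (1 + u^2)\<close> keeps the verification polynomial.\<close>
  let ?F = "\<lambda>x. - i * ?e x - k * (?e x * (sin x - u * cos x))"
  have pos: "1 + u\<^sup>2 > 0" by (simp add: add_pos_nonneg)
  have i: "i * u = 1" and k: "k * (1 + u\<^sup>2) = 1" using u pos by (simp_all add: i_def k_def)
  have "(\<integral>\<^sup>+x. ennreal ((1 - cos x) * ?e x) * indicator {0..} x \<partial>lborel) = ennreal (0 - ?F 0)"
  proof (rule nn_integral_FTC_atLeast)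
    fix x :: real
    have "DERIV ?F x :> i * u * ?e x - k * (?e x * (cos x + u * sin x) - u * ?e x * (sin x - u * cos x))"
      by (auto intro!: derivative_eq_intros simp: algebra_simps)
    also have "i * u * ?e x - k * (?e x * (cos x + u * sin x) - u * ?e x * (sin x - u * cos x))
        = (i * u) * ?e x - (k * (1 + u\<^sup>2)) * cos x * ?e x"
      by (simp add: algebra_simps power2_eq_square)
    finally show "DERIV ?F x :> (1 - cos x) * ?e x"
      unfolding i k by (simp add: algebra_simps)
  next
    have "((\<lambda>x. (i + k * (1 + u)) * ?e x) \<longlongrightarrow> 0) at_top" using u by real_asymp
    moreover have "norm (?F x) \<le> (i + k * (1 + u)) * ?e x" for x
    proof -
      have "\<bar>sin x - u * cos x\<bar> \<le> 1 + u * 1"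
        using u by (intro order.trans[OF abs_triangle_ineq4] add_mono) (auto simp: abs_mult intro!: mult_mono)
      then have "\<bar>k * (?e x * (sin x - u * cos x))\<bar> \<le> k * (?e x * (1 + u))"
        using pos by (auto simp: abs_mult k_def intro!: divide_right_mono)
      moreover have "i * ?e x \<ge> 0" using u by (simp add: i_def)
      ultimately show ?thesis by (simp add: algebra_simps)
    qed
    ultimately show "(?F \<longlongrightarrow> 0) at_top" by (intro Lim_null_comparison[of ?F]) auto
  qed auto
  also have "0 - ?F 0 = 1 / (u * (1 + u\<^sup>2))"
    using u pos by (simp add: i_def k_def divide_simps) (simp add: algebra_simps power2_eq_square)
  finally show ?thesis .
qed

lemma Laplace_x_minus_sin:
  assumes u: "u > (0::real)"
  shows "(\<integral>\<^sup>+x. ennreal ((x - sin x) * exp (- (u * x))) * indicator {0..} x \<partial>lborel) = ennreal (1 / (u\<^sup>2 * (1 + u\<^sup>2)))"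
proof -
  define i where "i = 1 / u"
  define k where "k = 1 / (1 + u\<^sup>2)"
  let ?e = "\<lambda>x. exp (- (u * x))"
  let ?F = "\<lambda>x. - (i * x + i\<^sup>2) * ?e x + k * (?e x * (u * sin x + cos x))"
  have pos: "1 + u\<^sup>2 > 0" by (simp add: add_pos_nonneg)
  have i: "i * u = 1" and k: "k * (1 + u\<^sup>2) = 1" using u pos by (simp_all add: i_def k_def)
  have "(\<integral>\<^sup>+x. ennreal ((x - sin x) * ?e x) * indicator {0..} x \<partial>lborel) = ennreal (0 - ?F 0)"
  proof (rule nn_integral_FTC_atLeast)
    fix x :: real
    have "DERIV ?F x :> u * (i * x + i\<^sup>2) * ?e x - i * ?e x
        + k * (?e x * (u * cos x - sin x) - u * ?e x * (u * sin x + cos x))"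
      by (auto intro!: derivative_eq_intros simp: algebra_simps)
    also have "u * (i * x + i\<^sup>2) * ?e x - i * ?e x
        + k * (?e x * (u * cos x - sin x) - u * ?e x * (u * sin x + cos x))
        = (i * u) * (x + i) * ?e x - i * ?e x - (k * (1 + u\<^sup>2)) * sin x * ?e x"
      by (simp add: algebra_simps power2_eq_square)
    finally show "DERIV ?F x :> (x - sin x) * ?e x"
      unfolding i k by (simp add: algebra_simps)
  next
    have "((\<lambda>x. (i * x + i\<^sup>2 + k * (1 + u)) * ?e x) \<longlongrightarrow> 0) at_top" using u by real_asymp
    moreover have "norm (?F x) \<le> (i * x + i\<^sup>2 + k * (1 + u)) * ?e x" if "x \<ge> 0" for x
    proof -
      have "\<bar>u * sin x + cos x\<bar> \<le> u * 1 + 1"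
        using u by (intro order.trans[OF abs_triangle_ineq] add_mono) (auto simp: abs_mult intro!: mult_mono)
      then have "\<bar>k * (?e x * (u * sin x + cos x))\<bar> \<le> k * (?e x * (1 + u))"
        using pos by (auto simp: abs_mult k_def intro!: divide_right_mono)
      moreover have "i * x * ?e x \<ge> 0" "i\<^sup>2 * ?e x \<ge> 0" using u that by (simp_all add: i_def)
      moreover have "\<bar>- a - b + c\<bar> \<le> a + b + d" if "\<bar>c\<bar> \<le> d" "a \<ge> 0" "b \<ge> 0" for a b c d :: real
        using that by linarith
      ultimately have "\<bar>- (i * x * ?e x) - i\<^sup>2 * ?e x + k * (?e x * (u * sin x + cos x))\<bar>
          \<le> i * x * ?e x + i\<^sup>2 * ?e x + k * (?e x * (1 + u))" by blast
      then show ?thesis by (simp add: algebra_simps)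
    qed
    ultimately show "(?F \<longlongrightarrow> 0) at_top"
      by (intro Lim_null_comparison[of ?F]) (auto intro: eventually_mono[OF eventually_ge_at_top[of 0]])
  qed (auto simp: sin_x_le_x)
  also have "0 - ?F 0 = 1 / (u\<^sup>2 * (1 + u\<^sup>2))"
    using u pos by (simp add: i_def k_def power_divide divide_simps)
  finally show ?thesis .
qed

text \<open>Both integrals carry the factor \<open>pi / 2 / Gamma (1 + \<alpha>)\<close>; it is
  divided by \<open>sin (pi * \<alpha> / 2)\<close> in the first, where \<open>p = \<alpha>\<close>,
  and by \<open>- cos (pi * \<alpha> / 2)\<close> in the second, where
  \<open>p = \<alpha> - 1\<close>. The ratio \<open>- tan (pi * \<alpha> / 2)\<close> is the source
  of the tangent in the stable characteristic function.\<close>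

lemma stable_integrals:
  assumes \<alpha>: "1 < \<alpha>" "\<alpha> < (2::real)"
  obtains A where "A > 0"
    "(\<integral>\<^sup>+x. ennreal ((1 - cos x) * x powr (- 1 - \<alpha>)) * indicator {0<..} x \<partial>lborel) = ennreal A"
    "(\<integral>\<^sup>+x. ennreal ((x - sin x) * x powr (- 1 - \<alpha>)) * indicator {0<..} x \<partial>lborel) = ennreal (A * (- tan (pi * \<alpha> / 2)))"
proof -
  define s where "s = sin (pi * \<alpha> / 2)"
  define c where "c = cos (pi * \<alpha> / 2)"
  have s: "s > 0" unfolding s_def using \<alpha> by (intro sin_gt_zero) auto
  have c: "c < 0"
  proof -
    have "0 < sin (pi * \<alpha> / 2 - pi / 2)"
      by (rule sin_gt_zero) (use \<alpha> in \<open>auto simp: field_simps\<close>)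
    then show ?thesis by (simp add: sin_diff c_def)
  qed
  have "sin (pi * (\<alpha> - 1) / 2) = sin (pi * \<alpha> / 2 - pi / 2)" by (simp add: field_simps)
  also have "\<dots> = - c" by (simp add: sin_diff c_def)
  finally have sc: "sin (pi * (\<alpha> - 1) / 2) = - c" .
  have G: "Gamma (1 + \<alpha>) > 0" using \<alpha> by (intro Gamma_real_pos) auto
  have 1: "(\<integral>\<^sup>+x. ennreal ((1 - cos x) * x powr (- 1 - \<alpha>)) * indicator {0<..} x \<partial>lborel) = ennreal (pi / 2 / s / Gamma (1 + \<alpha>))"
  proof (rule nn_integral_powr_via_Laplace[OF _ _ _ Laplace_1_minus_cos])
    show "(\<integral>\<^sup>+u. ennreal (u powr \<alpha> * (1 / (u * (1 + u\<^sup>2)))) * indicator {0<..} u \<partial>lborel) = ennreal (pi / 2 / s)"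
      unfolding s_def using \<alpha>
      by (subst nn_integral_powr_div_1_plus_square[symmetric])
         (auto intro!: nn_integral_cong simp: powr_diff split: split_indicator)
  qed (use \<alpha> s in auto)
  have 2: "(\<integral>\<^sup>+x. ennreal ((x - sin x) * x powr (- 1 - \<alpha>)) * indicator {0<..} x \<partial>lborel) = ennreal (pi / 2 / (-c) / Gamma (1 + \<alpha>))"
  proof (rule nn_integral_powr_via_Laplace[OF _ _ _ Laplace_x_minus_sin])
    show "(\<integral>\<^sup>+u. ennreal (u powr \<alpha> * (1 / (u\<^sup>2 * (1 + u\<^sup>2)))) * indicator {0<..} u \<partial>lborel) = ennreal (pi / 2 / - c)"
      unfolding sc[symmetric] using \<alpha>
      by (subst nn_integral_powr_div_1_plus_square[symmetric])
         (auto intro!: nn_integral_cong simp: powr_diff power2_eq_square split: split_indicator)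
  qed (use \<alpha> c in \<open>auto simp: sin_x_le_x divide_nonneg_neg\<close>)
  have "pi / 2 / (-c) / Gamma (1 + \<alpha>) = pi / 2 / s / Gamma (1 + \<alpha>) * (- tan (pi * \<alpha> / 2))"
    using s c G by (simp add: tan_def s_def[symmetric] c_def[symmetric] field_simps)
  with 1 2 s G that[of "pi / 2 / s / Gamma (1 + \<alpha>)"] show thesis by simp
qed

section \<open>From powers of a characteristic function to its logarithm\<close>

lemma cmod_iexp_diff_le: "cmod (iexp x - iexp y) \<le> min 2 \<bar>x - y\<bar>"
proof -
  have eq: "iexp x - iexp y = iexp y * (iexp (x - y) - 1)"
    by (simp add: algebra_simps flip: exp_add)
  have "cmod (iexp (x - y) - 1) \<le> \<bar>x - y\<bar>"
    using iexp_approx1[of "x - y" 0] by simp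
  moreover have "cmod (iexp (x - y) - 1) \<le> 2"
    using norm_triangle_ineq4[of "iexp (x - y)" 1] by simp
  ultimately show ?thesis by (simp add: eq norm_mult)
qed

text \<open>On a Skorohod coupling the difference of the characteristic functions is at most the
  mean of \<open>min 2 (T * |Ys n - Y|)\<close>, a bound free of \<open>t\<close>. Uniformity is
  needed because the logarithm is later followed continuously along a whole interval of
  \<open>t\<close>.\<close>

lemma weak_conv_m_imp_char_uniform:
  fixes \<mu> :: "nat \<Rightarrow> real measure"
  assumes \<mu>: "\<And>n. real_distribution (\<mu> n)" and N: "real_distribution N"
    and wc: "weak_conv_m \<mu> N" and e: "e > 0"
  shows "\<forall>\<^sub>F n in sequentially. \<forall>t. \<bar>t\<bar> \<le> T \<longrightarrow> cmod (char (\<mu> n) t - char N t) \<le> e"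
proof -
  obtain \<Omega> :: "real measure" and Ys and Y :: "real \<Rightarrow> real" where ps: "prob_space \<Omega>"
    and [measurable]: "\<And>n. Ys n \<in> borel_measurable \<Omega>" "Y \<in> borel_measurable \<Omega>"
    and d: "\<And>n. distr \<Omega> borel (Ys n) = \<mu> n" "distr \<Omega> borel Y = N"
    and lim: "\<And>x. x \<in> space \<Omega> \<Longrightarrow> (\<lambda>n. Ys n x) \<longlonglongrightarrow> Y x"
    using Skorohod[OF \<mu> N wc] by (simp only: measurable_lborel1) metis
  interpret prob_space \<Omega> by fact
  let ?w = "\<lambda>n x. min 2 (\<bar>T\<bar> * \<bar>Ys n x - Y x\<bar>)"
  have "(\<lambda>n. \<integral>x. ?w n x \<partial>\<Omega>) \<longlonglongrightarrow> (\<integral>x. min 2 (\<bar>T\<bar> * \<bar>0\<bar>) \<partial>\<Omega>)"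
  proof (rule integral_dominated_convergence[where w = "\<lambda>_. 2"])
    show "AE x in \<Omega>. (\<lambda>n. ?w n x) \<longlonglongrightarrow> min 2 (\<bar>T\<bar> * \<bar>0\<bar>)"
    proof (rule AE_I2)
      fix x assume "x \<in> space \<Omega>"
      then have "(\<lambda>n. Ys n x - Y x) \<longlonglongrightarrow> 0" using lim LIM_zero by blast
      then show "(\<lambda>n. ?w n x) \<longlonglongrightarrow> min 2 (\<bar>T\<bar> * \<bar>0\<bar>)"
        by (intro tendsto_intros)
    qed
  qed (auto simp: abs_le_iff min_def)
  then have "(\<lambda>n. \<integral>x. ?w n x \<partial>\<Omega>) \<longlonglongrightarrow> 0" by simp
  then have "\<forall>\<^sub>F n in sequentially. (\<integral>x. ?w n x \<partial>\<Omega>) < e"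
    using e order_tendstoD(2) by blast
  then show ?thesis
  proof (eventually_elim, intro allI impI)
    fix n t assume *: "(\<integral>x. ?w n x \<partial>\<Omega>) < e" and t: "\<bar>t\<bar> \<le> T"
    have int: "integrable \<Omega> (\<lambda>x. iexp (t * Ys n x))" "integrable \<Omega> (\<lambda>x. iexp (t * Y x))"
      by (auto intro!: integrable_const_bound[where B=1])
    have "char (\<mu> n) t - char N t = (\<integral>x. iexp (t * Ys n x) - iexp (t * Y x) \<partial>\<Omega>)"
      unfolding char_def d(1)[symmetric] d(2)[symmetric] using int
      by (simp add: integral_distr)
    also have "cmod \<dots> \<le> (\<integral>x. ?w n x \<partial>\<Omega>)"
    proof (rule Bochner_Integration.integral_norm_bound_integral)
      show "integrable \<Omega> (?w n)"
        by (rule integrable_const_bound[where B=2]) (auto simp: min_def)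
      fix x
      have "cmod (iexp (t * Ys n x) - iexp (t * Y x)) \<le> min 2 \<bar>t * (Ys n x - Y x)\<bar>"
        using cmod_iexp_diff_le[of "t * Ys n x" "t * Y x"] by (simp add: algebra_simps)
      also have "\<dots> \<le> ?w n x"
        using t by (intro min.mono) (auto simp: abs_mult intro!: mult_right_mono)
      finally show "cmod (iexp (t * Ys n x) - iexp (t * Y x)) \<le> ?w n x" .
    qed (use int in auto)
    finally show "cmod (char (\<mu> n) t - char N t) \<le> e" using * by simp
  qed
qed

lemma continuous_bounded_on_interval:
  fixes \<psi> :: "real \<Rightarrow> 'b::real_normed_vector"
  assumes "continuous_on UNIV \<psi>"
  shows "\<exists>R. \<forall>t. \<bar>t\<bar> \<le> T \<longrightarrow> norm (\<psi> t) \<le> R"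
proof -
  have "bounded (\<psi> ` {-T..T})"
    using assms by (intro compact_imp_bounded compact_continuous_image) (auto intro: continuous_on_subset)
  then obtain R where "\<forall>t\<in>{-T..T}. norm (\<psi> t) \<le> R" unfolding bounded_iff by auto
  then show ?thesis by (intro exI[of _ R]) (auto simp: abs_le_iff)
qed

text \<open>If \<open>b n \<le> B\<close> infinitely often, then for each fixed \<open>s\<close> the
  points \<open>s * b n\<close> stay in a compact set along these \<open>n\<close>, where the limit
  is bounded away from 0. Since \<open>cmod (\<phi> s) ^ n\<close> is close to it,
  \<open>cmod (\<phi> s) = 1\<close> for every \<open>s\<close>, and the limit at 1 would have
  modulus 1 as well.\<close>

lemma norming_filterlim_at_top:
  fixes \<phi> \<psi> :: "real \<Rightarrow> complex" and b :: "nat \<Rightarrow> real"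
  assumes le1: "\<And>s. cmod (\<phi> s) \<le> 1" and b: "\<And>n. b n > 0"
    and \<psi>: "continuous_on UNIV \<psi>" "Re (\<psi> 1) > 0"
    and UC: "\<And>T e. e > 0 \<Longrightarrow> \<forall>\<^sub>F n in sequentially. \<forall>t. \<bar>t\<bar> \<le> T \<longrightarrow> cmod (\<phi> (t / b n) ^ n - exp (- \<psi> t)) \<le> e"
  shows "filterlim b at_top sequentially"
proof (rule ccontr)
  assume "\<not> ?thesis"
  then obtain B where "\<not> (\<forall>\<^sub>F n in sequentially. B \<le> b n)"
    unfolding filterlim_at_top by auto
  then have B: "\<exists>\<^sub>F n in sequentially. b n \<le> B"
    unfolding not_eventually by (rule frequently_elim1) simp
  have mod1: "cmod (\<phi> s) = 1" for s
  proof (rule ccontr)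
    assume "cmod (\<phi> s) \<noteq> 1"
    with le1[of s] have lt: "cmod (\<phi> s) < 1" by simp
    define T where "T = \<bar>s\<bar> * \<bar>B\<bar>"
    obtain R where R: "\<And>t. \<bar>t\<bar> \<le> T \<Longrightarrow> cmod (\<psi> t) \<le> R"
      using continuous_bounded_on_interval[OF \<psi>(1)] by metis
    define g where "g = exp (- R)"
    have g: "cmod (exp (- \<psi> t)) \<ge> g" if "\<bar>t\<bar> \<le> T" for t
      using R[OF that] complex_Re_le_cmod[of "\<psi> t"] by (simp add: g_def)
    have "(\<lambda>n. cmod (\<phi> s) ^ n) \<longlonglongrightarrow> 0" using lt by (intro LIMSEQ_power_zero) auto
    then have "\<forall>\<^sub>F n in sequentially. cmod (\<phi> s) ^ n < g / 2"
      by (rule order_tendstoD) (simp add: g_def)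
    moreover have "\<forall>\<^sub>F n in sequentially. \<forall>t. \<bar>t\<bar> \<le> T \<longrightarrow> cmod (\<phi> (t / b n) ^ n - exp (- \<psi> t)) \<le> g / 2"
      by (rule UC) (simp add: g_def)
    ultimately have "\<forall>\<^sub>F n in sequentially. \<not> b n \<le> B"
    proof (eventually_elim, intro notI)
      fix n assume n: "cmod (\<phi> s) ^ n < g / 2" "b n \<le> B"
        and *: "\<forall>t. \<bar>t\<bar> \<le> T \<longrightarrow> cmod (\<phi> (t / b n) ^ n - exp (- \<psi> t)) \<le> g / 2"
      have t: "\<bar>s * b n\<bar> \<le> T"
        using n(2) b[of n] by (auto simp: T_def abs_mult intro!: mult_left_mono)
      have "g \<le> cmod (exp (- \<psi> (s * b n)))" by (rule g[OF t])
      also have "\<dots> \<le> cmod (\<phi> (s * b n / b n) ^ n) + g / 2"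
        using *[rule_format, OF t] norm_triangle_ineq3[of "\<phi> (s * b n / b n) ^ n" "exp (- \<psi> (s * b n))"] by linarith
      also have "\<dots> < g" using n(1) b[of n] by (simp add: norm_power)
      finally show False by simp
    qed
    with B have False by (simp add: frequently_def)
    then show False by simp
  qed
  define d where "d = 1 - cmod (exp (- \<psi> 1))"
  have d: "d > 0" using \<psi>(2) by (simp add: d_def)
  have "\<forall>\<^sub>F n in sequentially. \<forall>t. \<bar>t\<bar> \<le> 1 \<longrightarrow> cmod (\<phi> (t / b n) ^ n - exp (- \<psi> t)) \<le> d / 2"
    using UC[of "d/2" 1] d by simp
  from eventually_happens[OF this] obtain n where "cmod (\<phi> (1 / b n) ^ n - exp (- \<psi> 1)) \<le> d / 2"
    by (auto dest!: spec[of _ 1])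
  moreover have "cmod (\<phi> (1 / b n) ^ n) = 1" by (simp add: norm_power mod1)
  ultimately have "d \<le> d / 2"
    using norm_triangle_ineq2[of "\<phi> (1 / b n) ^ n" "exp (- \<psi> 1)"] unfolding d_def by linarith
  with d show False by simp
qed

text \<open>The equation \<open>exp (n Ln \<phi> + \<psi>) \<approx> 1\<close> determines the exponent only modulo
  \<open>2 \<pi> \<i>\<close>; since its imaginary part is continuous in \<open>t\<close> and vanishes at 0, it can leave the
  interval of length \<open>\<pi>\<close> around 0 only through a point where the exponential has real part 0.\<close>

lemma char_power_limit_imp_log_limit:
  fixes \<phi> \<psi> :: "real \<Rightarrow> complex" and b :: "nat \<Rightarrow> real"
  assumes \<phi>: "continuous_on UNIV \<phi>" "\<phi> 0 = 1" and b: "filterlim b at_top sequentially" "\<And>n. b n > 0"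
    and \<psi>: "continuous_on UNIV \<psi>" "\<psi> 0 = 0"
    and UC: "\<And>T e. e > 0 \<Longrightarrow> \<forall>\<^sub>F n in sequentially. \<forall>t. \<bar>t\<bar> \<le> T \<longrightarrow> cmod (\<phi> (t / b n) ^ n - exp (- \<psi> t)) \<le> e"
    and T: "T > 0" and e: "e > 0"
  shows "\<forall>\<^sub>F n in sequentially. \<forall>t. \<bar>t\<bar> \<le> T \<longrightarrow> cmod (of_nat n * (\<phi> (t / b n) - 1) + \<psi> t) \<le> e"
proof -
  obtain R where R: "\<And>t. \<bar>t\<bar> \<le> T \<Longrightarrow> cmod (\<psi> t) \<le> R"
    using continuous_bounded_on_interval[OF \<psi>(1)] by metis
  have R0: "R \<ge> 0" using R[of 0] T by (auto simp: \<psi>)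
  define e1 where "e1 = min 1 (e / 2)"
  have e1: "e1 > 0" "e1 \<le> 1" "e1 \<le> e / 2" using e by (auto simp: e1_def)
  have "(exp has_derivative (*) 1) (at (0::complex))"
    using DERIV_exp[of "0::complex"] unfolding has_field_derivative_def by (simp only: exp_zero)
  \<comment> \<open>\<open>R + 1\<close> will bound \<open>n * cmod z\<close> for the logarithm
    \<open>z\<close> of \<open>\<phi> (t / b n)\<close>, so replacing \<open>z\<close> by
    \<open>exp z - 1\<close> costs at most \<open>e1\<close> after multiplication by
    \<open>n\<close>.\<close>
  then obtain d where d: "d > 0" "\<And>z::complex. cmod z < d \<Longrightarrow> cmod (exp z - 1 - z) \<le> e1 / (R + 1) * cmod z"
    unfolding has_derivative_at_alt using e1 R0
    by (auto dest!: spec[of _ "e1 / (R + 1)"])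
  have "isCont Ln 1" by (intro continuous_at_Ln) auto
  then obtain \<eta> where \<eta>: "\<eta> > 0" "\<And>w. cmod (w - 1) < \<eta> \<Longrightarrow> cmod (Ln w) < min e1 d"
    unfolding continuous_at_eps_delta using e1 d(1)
    by (auto simp: dist_norm dest!: spec[of _ "min e1 d"])
  \<comment> \<open>\<open>h < 1\<close> keeps \<open>exp (D u)\<close> in the right half-plane;
    \<open>h < \<eta>\<close> places both \<open>exp (D t)\<close> and
    \<open>\<phi> (t / b n)\<close> where \<open>Ln\<close> is small.\<close>
  define h where "h = min (1/2) (\<eta> / 2)"
  have h: "h > 0" "h < 1" "h < \<eta>" using \<eta> by (auto simp: h_def min_def)
  have "isCont \<phi> 0" using \<phi>(1) by (simp add: continuous_on_eq_continuous_at)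
  then obtain s where s: "s > 0" "\<And>u. \<bar>u\<bar> < s \<Longrightarrow> cmod (\<phi> u - 1) < h"
    unfolding continuous_at_eps_delta using h by (auto simp: dist_norm \<phi>)
  have "\<forall>\<^sub>F n in sequentially. b n > T / s"
    using b(1) by (simp add: filterlim_at_top_dense)
  \<comment> \<open>The factor \<open>exp (- R)\<close> compensates the multiplication by
    \<open>exp (\<psi> u)\<close> in passing to \<open>exp (D u) - 1\<close>.\<close>
  moreover have "\<forall>\<^sub>F n in sequentially. \<forall>t. \<bar>t\<bar> \<le> T \<longrightarrow> cmod (\<phi> (t / b n) ^ n - exp (- \<psi> t)) \<le> h * exp (- R) / 2"
    by (rule UC) (use h in auto)
  ultimately show ?thesis
  proof (eventually_elim, intro allI impI)
    fix n t assume bn: "b n > T / s" and uc: "\<forall>t. \<bar>t\<bar> \<le> T \<longrightarrow> cmod (\<phi> (t / b n) ^ n - exp (- \<psi> t)) \<le> h * exp (- R) / 2"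
      and t: "\<bar>t\<bar> \<le> T"
    have near: "cmod (\<phi> (u / b n) - 1) < h" if "\<bar>u\<bar> \<le> T" for u
    proof (rule s(2))
      have "\<bar>u\<bar> < s * b n" using that bn s(1) by (simp add: field_simps)
      then show "\<bar>u / b n\<bar> < s" using b(2)[of n] by (simp add: field_simps abs_div)
    qed
    have Repos: "Re (\<phi> (u / b n)) > 0" if "\<bar>u\<bar> \<le> T" for u
      using near[OF that] h abs_Re_le_cmod[of "\<phi> (u / b n) - 1"] by (simp add: abs_less_iff)
    define D where "D u = of_nat n * Ln (\<phi> (u / b n)) + \<psi> u" for u
    have expD: "cmod (exp (D u) - 1) < h" if u: "\<bar>u\<bar> \<le> T" for u
    proof -
      have nz: "\<phi> (u / b n) \<noteq> 0" using Repos[OF u] by auto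
      have "exp (D u) = \<phi> (u / b n) ^ n * exp (\<psi> u)"
        using nz by (simp add: D_def exp_add exp_of_nat_mult)
      then have "exp (D u) - 1 = (\<phi> (u / b n) ^ n - exp (- \<psi> u)) * exp (\<psi> u)"
        by (simp add: algebra_simps exp_minus_inverse mult_exp_exp)
      then have "cmod (exp (D u) - 1) = cmod (\<phi> (u / b n) ^ n - exp (- \<psi> u)) * cmod (exp (\<psi> u))"
        by (simp add: norm_mult)
      also have "\<dots> \<le> (h * exp (- R) / 2) * exp R"
        using uc u R[OF u] complex_Re_le_cmod[of "\<psi> u"] h by (intro mult_mono) auto
      also have "\<dots> = h / 2" by (simp add: exp_minus field_simps)
      finally show ?thesis using h by linarith
    qed
    have "continuous_on {-T..T} (\<lambda>u. \<phi> (u / b n))"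
      using b(2)[of n] by (intro continuous_on_compose2[OF \<phi>(1)] continuous_intros) auto
    moreover have "\<phi> (u / b n) \<notin> \<real>\<^sub>\<le>\<^sub>0" if "u \<in> {-T..T}" for u
      using Repos[of u] that by (auto simp: complex_nonpos_Reals_iff abs_le_iff)
    ultimately have contD: "continuous_on {-T..T} D"
      unfolding D_def using \<psi>(1)
      by (intro continuous_intros continuous_on_Ln') (auto intro: continuous_on_subset)
    have ImD: "\<bar>Im (D t)\<bar> < pi / 2"
    proof (rule ccontr)
      assume "\<not> ?thesis"
      then have ge: "\<bar>Im (D t)\<bar> \<ge> pi / 2" by simp
      have "connected ((\<lambda>u. \<bar>Im (D u)\<bar>) ` {-T..T})"
        by (intro connected_continuous_image continuous_intros contD) auto
      moreover have "\<bar>Im (D 0)\<bar> = 0" by (simp add: D_def \<phi> \<psi>)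
      then have "0 \<in> (\<lambda>u. \<bar>Im (D u)\<bar>) ` {-T..T}" using T by (auto intro!: image_eqI[of _ _ 0])
      moreover have "\<bar>Im (D t)\<bar> \<in> (\<lambda>u. \<bar>Im (D u)\<bar>) ` {-T..T}"
        using t by (intro image_eqI[of _ _ t]) (auto simp: abs_le_iff)
      ultimately have "pi / 2 \<in> (\<lambda>u. \<bar>Im (D u)\<bar>) ` {-T..T}"
        using ge by (meson connectedD_interval pi_half_ge_zero)
      then obtain u where u: "u \<in> {-T..T}" "\<bar>Im (D u)\<bar> = pi / 2" by fastforce
      have ut: "\<bar>u\<bar> \<le> T" using u(1) by (auto simp: abs_le_iff)
      have "cos (Im (D u)) = 0" using u(2) by (metis cos_abs_real cos_pi_half)
      then have "Re (exp (D u)) = 0" by (simp add: Re_exp)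
      then show False using expD[OF ut] h abs_Re_le_cmod[of "exp (D u) - 1"] by simp
    qed
    then have "Ln (exp (D t)) = D t" by (intro Ln_exp) (auto simp: abs_less_iff)
    moreover have "cmod (Ln (exp (D t))) < e1" using \<eta>(2)[of "exp (D t)"] expD[OF t] h by auto
    ultimately have Dt: "cmod (D t) < e1" by simp
    define z where "z = Ln (\<phi> (t / b n))"
    have "\<phi> (t / b n) \<noteq> 0" using Repos[OF t] by auto
    then have expz: "exp z = \<phi> (t / b n)" by (simp add: z_def)
    have "cmod z < d" unfolding z_def using \<eta>(2)[of "\<phi> (t / b n)"] near[OF t] h by auto
    then have "cmod (exp z - 1 - z) \<le> e1 / (R + 1) * cmod z" by (rule d(2))
    then have "real n * cmod (exp z - 1 - z) \<le> e1 / (R + 1) * (real n * cmod z)"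
      by (metis mult.left_commute mult_left_mono of_nat_0_le_iff)
    also have "real n * cmod z = cmod (D t - \<psi> t)" by (simp add: D_def z_def norm_mult)
    also have "e1 / (R + 1) * cmod (D t - \<psi> t) \<le> e1 / (R + 1) * (R + 1)"
      using norm_triangle_ineq4[of "D t" "\<psi> t"] R[OF t] Dt e1 R0 by (intro mult_left_mono) auto
    also have "e1 / (R + 1) * (R + 1) = e1" using R0 by simp
    finally have 1: "real n * cmod (exp z - 1 - z) \<le> e1" .
    have "of_nat n * (\<phi> (t / b n) - 1) + \<psi> t = of_nat n * (exp z - 1 - z) + D t"
      unfolding expz D_def z_def[symmetric] by (simp add: algebra_simps)
    also have "cmod \<dots> \<le> e1 + e1"
      using 1 Dt by (intro order.trans[OF norm_triangle_ineq] add_mono) (auto simp: norm_mult)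
    finally show "cmod (of_nat n * (\<phi> (t / b n) - 1) + \<psi> t) \<le> e" using e1 by linarith
  qed
qed

section \<open>Tails of the steps\<close>

definition stable_exponent :: "real \<Rightarrow> real \<Rightarrow> real \<Rightarrow> complex" where
  "stable_exponent \<alpha> \<beta> t =
     complex_of_real (\<bar>t\<bar> powr \<alpha>) * (1 - \<i> * complex_of_real (\<beta> * sgn t * tan (pi * \<alpha> / 2)))"

text \<open>The density of the Levy measure of the stable law: \<open>p\<close> weighs the upward
  and \<open>q\<close> the downward jumps.\<close>

definition stable_levy :: "real \<Rightarrow> real \<Rightarrow> real \<Rightarrow> real \<Rightarrow> real" where
  "stable_levy \<alpha> p q x = (if x > 0 then p * x powr (- 1 - \<alpha>) else if x < 0 then q * (- x) powr (- 1 - \<alpha>) else 0)"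

lemma stable_levy_measurable [measurable]: "stable_levy \<alpha> p q \<in> borel_measurable borel"
  unfolding stable_levy_def[abs_def] by measurable

lemma stable_levy_nonneg: "p \<ge> 0 \<Longrightarrow> q \<ge> 0 \<Longrightarrow> stable_levy \<alpha> p q x \<ge> 0"
  by (simp add: stable_levy_def)

text \<open>The power \<open>x powr (- 1 - \<alpha>)\<close> is homogeneous, so the trigonometric
  integrals need to be known only at frequency 1.\<close>

lemma has_bochner_integral_half_line_scale:
  fixes f :: "real \<Rightarrow> real"
  assumes "has_bochner_integral lborel (\<lambda>x. indicator {0<..} x * (f x * x powr (- 1 - \<alpha>))) I" and s: "s > 0"
  shows "has_bochner_integral lborel (\<lambda>x. indicator {0<..} x * (f (s * x) * x powr (- 1 - \<alpha>))) (s powr \<alpha> * I)"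
proof -
  have "has_bochner_integral lborel (\<lambda>x. indicator {0<..} (0 + s * x) * (f (0 + s * x) * (0 + s * x) powr (- 1 - \<alpha>))) (I /\<^sub>R \<bar>s\<bar>)"
    using assms by (subst (asm) lborel_has_bochner_integral_real_affine_iff[of s _ _ 0]) auto
  from has_bochner_integral_mult_right[OF this, of "s powr (1 + \<alpha>)"]
  have "has_bochner_integral lborel (\<lambda>x. s powr (1 + \<alpha>) * (indicator {0<..} (0 + s * x) * (f (0 + s * x) * (0 + s * x) powr (- 1 - \<alpha>))))
      (s powr (1 + \<alpha>) * (I /\<^sub>R \<bar>s\<bar>))" by simp
  moreover have "s powr (1 + \<alpha>) * (I /\<^sub>R \<bar>s\<bar>) = s powr \<alpha> * I"
    using s by (simp add: powr_add field_simps)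
  moreover have "s powr (1 + \<alpha>) * (indicator {0<..} (0 + s * x) * (f (0 + s * x) * (0 + s * x) powr (- 1 - \<alpha>)))
     = indicator {0<..} x * (f (s * x) * x powr (- 1 - \<alpha>))" for x
  proof (cases "x > 0")
    case True
    have "s powr (1 + \<alpha>) * (s * x) powr (- 1 - \<alpha>) = (s powr (1 + \<alpha>) * s powr (- 1 - \<alpha>)) * x powr (- 1 - \<alpha>)"
      using s True by (simp add: powr_mult)
    also have "s powr (1 + \<alpha>) * s powr (- 1 - \<alpha>) = 1"
      using s by (simp flip: powr_add)
    finally show ?thesis using s True by simp
  qed (use s in \<open>simp add: zero_less_mult_iff\<close>)
  ultimately show ?thesis by (simp only:)
qed

text \<open>\<open>A\<close> is the constant common to the two Mellin integrals; the weights of the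
  Levy density are normalised against it by \<open>p + q = 1 / A\<close> and
  \<open>p - q = \<beta> / A\<close>.\<close>

locale stable_constant =
  fixes \<alpha> A :: real
  assumes \<alpha>: "1 < \<alpha>" "\<alpha> < 2" and A: "A > 0"
    and Acos: "(\<integral>\<^sup>+x. ennreal ((1 - cos x) * x powr (- 1 - \<alpha>)) * indicator {0<..} x \<partial>lborel) = ennreal A"
    and Asin: "(\<integral>\<^sup>+x. ennreal ((x - sin x) * x powr (- 1 - \<alpha>)) * indicator {0<..} x \<partial>lborel) = ennreal (A * (- tan (pi * \<alpha> / 2)))"
begin

lemma minus_tan_pos: "- tan (pi * \<alpha> / 2) > 0"
proof -
  have "0 < sin (pi * \<alpha> / 2 - pi / 2)" "0 < sin (pi * \<alpha> / 2)"
    by (rule sin_gt_zero; use \<alpha> in \<open>auto simp: field_simps\<close>)+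
  then show ?thesis by (simp add: sin_diff tan_def divide_neg_pos divide_pos_neg)
qed

lemma int_cos1: "has_bochner_integral lborel (\<lambda>x. indicator {0<..} x * ((1 - cos x) * x powr (- 1 - \<alpha>))) A"
  using Acos A
  by (intro has_bochner_integral_nn_integral) (auto simp: ennreal_mult' ennreal_indicator mult_ac)

lemma int_sin1: "has_bochner_integral lborel (\<lambda>x. indicator {0<..} x * ((x - sin x) * x powr (- 1 - \<alpha>))) (A * (- tan (pi * \<alpha> / 2)))"
proof (intro has_bochner_integral_nn_integral)
  show "AE x in lborel. 0 \<le> indicator {0<..} x * ((x - sin x) * x powr (- 1 - \<alpha>))"
    by (auto simp: sin_x_le_x indicator_def)
  show "0 \<le> A * (- tan (pi * \<alpha> / 2))" using A minus_tan_pos by (intro mult_nonneg_nonneg) auto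
  have "ennreal (indicator {0<..} x * ((x - sin x) * x powr (- 1 - \<alpha>))) = ennreal ((x - sin x) * x powr (- 1 - \<alpha>)) * indicator {0<..} x" for x :: real
    by (simp add: indicator_def)
  then show "(\<integral>\<^sup>+x. ennreal (indicator {0<..} x * ((x - sin x) * x powr (- 1 - \<alpha>))) \<partial>lborel) = ennreal (A * (- tan (pi * \<alpha> / 2)))"
    using Asin by simp
qed auto

lemma int_cos: "has_bochner_integral lborel (\<lambda>x. indicator {0<..} x * ((1 - cos (t * x)) * x powr (- 1 - \<alpha>))) (\<bar>t\<bar> powr \<alpha> * A)"
proof -
  consider "t = 0" | "t > 0" | "t < 0" by linarith
  then show ?thesis
  proof cases
    case 3
    then show ?thesis using has_bochner_integral_half_line_scale[OF int_cos1, of "-t"] by simp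
  next
    case 2
    then show ?thesis using has_bochner_integral_half_line_scale[OF int_cos1, of t] by simp
  next
    case 1
    then show ?thesis using has_bochner_integral_zero[of lborel] by simp
  qed
qed

lemma int_sin: "has_bochner_integral lborel (\<lambda>x. indicator {0<..} x * ((t * x - sin (t * x)) * x powr (- 1 - \<alpha>)))
    (sgn t * \<bar>t\<bar> powr \<alpha> * (A * (- tan (pi * \<alpha> / 2))))"
proof -
  consider "t = 0" | "t > 0" | "t < 0" by linarith
  then show ?thesis
  proof cases
    case 3
    then show ?thesis
      using has_bochner_integral_minus[OF has_bochner_integral_half_line_scale[OF int_sin1, of "-t"]]
      by (simp add: algebra_simps)
  next
    case 2
    then show ?thesis using has_bochner_integral_half_line_scale[OF int_sin1, of t] by simp
  next
    case 1
    then show ?thesis using has_bochner_integral_zero[of lborel] by simp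
  qed
qed

text \<open>The Levy--Khintchine representation of the stable exponent.\<close>

lemma stable_exponent_integral:
  assumes pq: "p + q = 1 / A" "p - q = \<beta> / A"
  shows "has_bochner_integral lborel (\<lambda>x. (1 - iexp (t * x) + \<i> * of_real (t * x)) * of_real (stable_levy \<alpha> p q x))
     (stable_exponent \<alpha> \<beta> t)"
proof -
  define B where "B = A * (- tan (pi * \<alpha> / 2))"
  have flip: "has_bochner_integral lborel (\<lambda>x. f (- x)) I" if "has_bochner_integral lborel f I" for f :: "real \<Rightarrow> real" and I
    using that lborel_has_bochner_integral_real_affine_iff[of "-1" f I 0] by simp
  have re: "has_bochner_integral lborel (\<lambda>x. (1 - cos (t * x)) * stable_levy \<alpha> p q x) (\<bar>t\<bar> powr \<alpha>)"
  proof -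
    have "has_bochner_integral lborel (\<lambda>x. p * (indicator {0<..} x * ((1 - cos (t * x)) * x powr (- 1 - \<alpha>)))
        + q * (indicator {0<..} (- x) * ((1 - cos (t * (- x))) * (- x) powr (- 1 - \<alpha>)))) (p * (\<bar>t\<bar> powr \<alpha> * A) + q * (\<bar>t\<bar> powr \<alpha> * A))"
      by (intro has_bochner_integral_add has_bochner_integral_mult_right flip[of "\<lambda>x. indicator {0<..} x * ((1 - cos (t * x)) * x powr (- 1 - \<alpha>))"] int_cos)
    moreover have "p * (\<bar>t\<bar> powr \<alpha> * A) + q * (\<bar>t\<bar> powr \<alpha> * A) = \<bar>t\<bar> powr \<alpha>"
    proof -
      have "p * (\<bar>t\<bar> powr \<alpha> * A) + q * (\<bar>t\<bar> powr \<alpha> * A) = (p + q) * A * \<bar>t\<bar> powr \<alpha>"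
        by (simp add: algebra_simps)
      then show ?thesis using A by (simp add: pq)
    qed
    moreover have "p * (indicator {0<..} x * ((1 - cos (t * x)) * x powr (- 1 - \<alpha>)))
        + q * (indicator {0<..} (- x) * ((1 - cos (t * (- x))) * (- x) powr (- 1 - \<alpha>))) = (1 - cos (t * x)) * stable_levy \<alpha> p q x" for x
      by (auto simp: stable_levy_def indicator_def)
    ultimately show ?thesis by (simp only:)
  qed
  have im: "has_bochner_integral lborel (\<lambda>x. (t * x - sin (t * x)) * stable_levy \<alpha> p q x) (sgn t * \<bar>t\<bar> powr \<alpha> * (\<beta> * (- tan (pi * \<alpha> / 2))))"
  proof -
    have "has_bochner_integral lborel (\<lambda>x. p * (indicator {0<..} x * ((t * x - sin (t * x)) * x powr (- 1 - \<alpha>)))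
        + (- q) * (indicator {0<..} (- x) * ((t * (- x) - sin (t * (- x))) * (- x) powr (- 1 - \<alpha>)))) (p * (sgn t * \<bar>t\<bar> powr \<alpha> * B) + (- q) * (sgn t * \<bar>t\<bar> powr \<alpha> * B))"
      unfolding B_def
      by (intro has_bochner_integral_add has_bochner_integral_mult_right flip[of "\<lambda>x. indicator {0<..} x * ((t * x - sin (t * x)) * x powr (- 1 - \<alpha>))"] int_sin)
    moreover have "p * (sgn t * \<bar>t\<bar> powr \<alpha> * B) + (- q) * (sgn t * \<bar>t\<bar> powr \<alpha> * B)
        = sgn t * \<bar>t\<bar> powr \<alpha> * (\<beta> * (- tan (pi * \<alpha> / 2)))"
    proof -
      have "p * (sgn t * \<bar>t\<bar> powr \<alpha> * B) + (- q) * (sgn t * \<bar>t\<bar> powr \<alpha> * B)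
          = (p - q) * A * (sgn t * \<bar>t\<bar> powr \<alpha> * (- tan (pi * \<alpha> / 2)))"
        by (simp add: algebra_simps B_def)
      then show ?thesis using A by (simp add: pq)
    qed
    moreover have "p * (indicator {0<..} x * ((t * x - sin (t * x)) * x powr (- 1 - \<alpha>)))
        + (- q) * (indicator {0<..} (- x) * ((t * (- x) - sin (t * (- x))) * (- x) powr (- 1 - \<alpha>))) = (t * x - sin (t * x)) * stable_levy \<alpha> p q x" for x
      by (auto simp: stable_levy_def indicator_def algebra_simps)
    ultimately show ?thesis by (simp only:)
  qed
  have "has_bochner_integral lborel (\<lambda>x. complex_of_real ((1 - cos (t * x)) * stable_levy \<alpha> p q x)
      + \<i> * complex_of_real ((t * x - sin (t * x)) * stable_levy \<alpha> p q x))
      (complex_of_real (\<bar>t\<bar> powr \<alpha>) + \<i> * complex_of_real (sgn t * \<bar>t\<bar> powr \<alpha> * (\<beta> * (- tan (pi * \<alpha> / 2)))))"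
    by (intro has_bochner_integral_add has_bochner_integral_mult_right has_bochner_integral_of_real re im)
  moreover have "complex_of_real ((1 - cos (t * x)) * stable_levy \<alpha> p q x)
      + \<i> * complex_of_real ((t * x - sin (t * x)) * stable_levy \<alpha> p q x)
      = (1 - iexp (t * x) + \<i> * of_real (t * x)) * of_real (stable_levy \<alpha> p q x)" for x
    by (simp add: complex_eq_iff Re_exp Im_exp algebra_simps)
  moreover have "complex_of_real (\<bar>t\<bar> powr \<alpha>) + \<i> * complex_of_real (sgn t * \<bar>t\<bar> powr \<alpha> * (\<beta> * (- tan (pi * \<alpha> / 2)))) = stable_exponent \<alpha> \<beta> t"
    by (simp add: stable_exponent_def algebra_simps)
  ultimately show ?thesis by (simp only:)
qed

end

section \<open>Tail limits along the norming sequence\<close>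

text \<open>The truncation inequality: integrating \<open>1 - cos (u * x)\<close> over
  \<open>u\<close> from 0 to \<open>h\<close> gives \<open>h - sin (h * x) / x\<close>, which is at
  least \<open>h / 2\<close> once \<open>|x| \<ge> 2 / h\<close>.\<close>

lemma (in real_distribution) tail_le_char:
  assumes h: "h > 0" and B: "\<And>u. 0 \<le> u \<Longrightarrow> u \<le> h \<Longrightarrow> 1 - Re (char M u) \<le> B"
  shows "prob {x. 2 / h \<le> \<bar>x\<bar>} \<le> 2 * B"
proof -
  have B0: "B \<ge> 0" using B[of 0] h by (simp add: char_zero)
  have Reint: "(\<integral>\<^sup>+x. ennreal (1 - cos (u * x)) \<partial>M) = ennreal (1 - Re (char M u))" for u
  proof -
    have i: "integrable M (\<lambda>x. iexp (u * x))" by (rule integrable_iexp) auto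
    have ic: "integrable M (\<lambda>x. cos (u * x))"
      using integrable_Re[OF i] by (simp add: Re_exp)
    have "Re (char M u) = (\<integral>x. cos (u * x) \<partial>M)"
      unfolding char_def using integral_Re[OF i] by (simp add: Re_exp)
    moreover have "(\<integral>x. 1 - cos (u * x) \<partial>M) = 1 - (\<integral>x. cos (u * x) \<partial>M)"
      using ic by (simp add: prob_space[unfolded space_eq_univ])
    ultimately show ?thesis
      using ic by (subst nn_integral_eq_integral) auto
  qed
  have inner: "ennreal (h / 2) * indicator {x. 2 / h \<le> \<bar>x\<bar>} x \<le> (\<integral>\<^sup>+u. ennreal (1 - cos (u * x)) * indicator {0..h} u \<partial>lborel)" for x
  proof (cases "2 / h \<le> \<bar>x\<bar>")
    case True
    then have x: "x \<noteq> 0" using h by auto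
    have "(\<integral>\<^sup>+u. ennreal (1 - cos (u * x)) * indicator {0..h} u \<partial>lborel) = ennreal ((h - sin (h * x) / x) - (0 - sin (0 * x) / x))"
      using h x by (intro nn_integral_FTC_Icc) (auto intro!: derivative_eq_intros simp: DERIV_subset)
    also have "\<dots> \<ge> ennreal (h / 2)"
    proof (intro ennreal_leI)
      have "\<bar>sin (h * x) / x\<bar> \<le> 1 / \<bar>x\<bar>" using x by (simp add: divide_right_mono)
      also have "\<dots> \<le> h / 2" using True h x by (simp add: field_simps)
      finally have "sin (h * x) / x \<le> h / 2" by (rule abs_le_D1)
      then show "h / 2 \<le> (h - sin (h * x) / x) - (0 - sin (0 * x) / x)" by simp
    qed
    finally show ?thesis using True by simp
  qed simp
  have "ennreal (h / 2) * emeasure M {x. 2 / h \<le> \<bar>x\<bar>} = (\<integral>\<^sup>+x. ennreal (h / 2) * indicator {x. 2 / h \<le> \<bar>x\<bar>} x \<partial>M)"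
    by (intro nn_integral_cmult_indicator[symmetric]) measurable
  also have "\<dots> \<le> (\<integral>\<^sup>+x. (\<integral>\<^sup>+u. ennreal (1 - cos (u * x)) * indicator {0..h} u \<partial>lborel) \<partial>M)"
    by (intro nn_integral_mono inner)
  also have "\<dots> = (\<integral>\<^sup>+u. (\<integral>\<^sup>+x. ennreal (1 - cos (u * x)) * indicator {0..h} u \<partial>M) \<partial>lborel)"
  proof -
    interpret P: pair_sigma_finite M lborel ..
    show ?thesis by (rule P.Fubini'[symmetric]) measurable
  qed
  also have "\<dots> \<le> (\<integral>\<^sup>+u. ennreal B * indicator {0..h} u \<partial>lborel)"
  proof (intro nn_integral_mono)
    fix u :: real
    have "(\<integral>\<^sup>+x. ennreal (1 - cos (u * x)) * indicator {0..h} u \<partial>M) = ennreal (1 - Re (char M u)) * indicator {0..h} u"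
      using Reint[of u] by (subst nn_integral_multc) auto
    also have "\<dots> \<le> ennreal B * indicator {0..h} u"
      using B[of u] by (auto simp: indicator_def intro: ennreal_leI)
    finally show "(\<integral>\<^sup>+x. ennreal (1 - cos (u * x)) * indicator {0..h} u \<partial>M) \<le> ennreal B * indicator {0..h} u" .
  qed
  also have "\<dots> = ennreal (B * h)"
    using h B0 by (subst nn_integral_cmult_indicator) (auto simp: ennreal_mult)
  finally have "h / 2 * prob {x. 2 / h \<le> \<bar>x\<bar>} \<le> B * h"
    using h B0 by (simp add: emeasure_eq_measure flip: ennreal_mult)
  then show ?thesis using h by (simp add: field_simps)
qed

lemma char_distr_scale:
  assumes [measurable]: "X \<in> borel_measurable M"
  shows "char (distr M borel (\<lambda>\<omega>. X \<omega> / c)) t = char (distr M borel X) (t / c)"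
  unfolding char_def by (simp add: integral_distr)

context stable_constant
begin

lemma stable_exponent_continuous: "continuous_on UNIV (stable_exponent \<alpha> \<beta>)"
proof -
  \<comment> \<open>The jump of \<open>sgn\<close> at 0 is absorbed by
    \<open>sgn t * |t| powr \<alpha> = t * |t| powr (\<alpha> - 1)\<close>, which is visibly
    continuous because \<open>\<alpha> > 1\<close>.\<close>
  have eq: "stable_exponent \<alpha> \<beta> t = complex_of_real (\<bar>t\<bar> powr \<alpha>) - \<i> * complex_of_real (\<beta> * tan (pi * \<alpha> / 2)) * complex_of_real (t * \<bar>t\<bar> powr (\<alpha> - 1))" for t
  proof (cases "t = 0")
    case False
    then have "\<bar>t\<bar> powr \<alpha> = \<bar>t\<bar> * \<bar>t\<bar> powr (\<alpha> - 1)"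
      by (simp add: powr_diff)
    then have "sgn t * \<bar>t\<bar> powr \<alpha> = t * \<bar>t\<bar> powr (\<alpha> - 1)"
      by (simp add: sgn_mult_abs mult.assoc[symmetric])
    then show ?thesis
      by (simp add: stable_exponent_def algebra_simps flip: of_real_mult)
  qed (simp add: stable_exponent_def)
  show ?thesis
    unfolding eq using \<alpha> by (intro continuous_intros continuous_on_powr') auto
qed

text \<open>Taking the second difference in \<open>t\<close> with step \<open>h\<close> multiplies a
  measure by the weight \<open>1 - cos (h * y)\<close>. The weight tames the Levy density at 0, and
  the affine terms of the Levy-Khintchine formula drop out. Both sides thus become characteristic
  functions of finite measures; after normalisation to mass 1 the continuity theorem gives weak
  convergence, and dividing by the weight on the window undoes the change.\<close>

lemma window_limit:
  fixes X :: "'b \<Rightarrow> real" and b :: "nat \<Rightarrow> real"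
  assumes ps: "prob_space M" and [measurable]: "X \<in> borel_measurable M" and b: "\<And>n. b n > 0"
    and pq: "p + q = 1 / A" "p - q = \<beta> / A" "p \<ge> 0" "q \<ge> 0"
    and lim: "\<And>t. (\<lambda>n. of_nat n * (char (distr M borel X) (t / b n) - 1)) \<longlonglongrightarrow> - stable_exponent \<alpha> \<beta> t"
    and x: "0 < x" "x < R"
  shows "(\<lambda>n. real n * measure M {\<omega> \<in> space M. x * b n \<le> X \<omega> \<and> X \<omega> \<le> R * b n})
           \<longlonglongrightarrow> p / \<alpha> * (x powr (- \<alpha>) - R powr (- \<alpha>))"
proof -
  interpret prob_space M by fact
  \<comment> \<open>With this frequency \<open>h * y\<close> stays in \<open>(0, pi]\<close> for
    \<open>x \<le> y \<le> R\<close>, so on the window the weight is at least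
    \<open>1 - cos (h * x) > 0\<close>.\<close>
  define h where "h = pi / R"
  define \<kappa> where "\<kappa> = h powr \<alpha>"
  define w where "w y = 1 - cos (h * y)" for y
  define \<nu> where "\<nu> = stable_levy \<alpha> p q"
  define \<psi> where "\<psi> = stable_exponent \<alpha> \<beta>"
  define \<mu> where "\<mu> n = distr M borel (\<lambda>\<omega>. X \<omega> / b n)" for n
  define \<phi> where "\<phi> n = char (\<mu> n)" for n
  define m where "m n = 1 - Re (\<phi> n h)" for n
  have h: "h > 0" using x by (simp add: h_def)
  have \<kappa>: "\<kappa> > 0" using h by (simp add: \<kappa>_def)
  have w0: "w y \<ge> 0" for y by (simp add: w_def)
  have [measurable]: "w \<in> borel_measurable borel" "\<nu> \<in> borel_measurable borel"
    unfolding w_def[abs_def] \<nu>_def by measurable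
  have \<nu>0: "\<nu> y \<ge> 0" for y using pq by (simp add: \<nu>_def stable_levy_nonneg)
  have \<mu>: "real_distribution (\<mu> n)" for n
    unfolding \<mu>_def by (intro real_distribution_distr) auto
  interpret \<mu>: real_distribution "\<mu> n" for n by (rule \<mu>)
  have \<phi>eq: "\<phi> n t = char (distr M borel X) (t / b n)" for n t
    by (simp add: \<phi>_def \<mu>_def char_distr_scale)
  have lim': "(\<lambda>n. of_nat n * (\<phi> n t - 1)) \<longlonglongrightarrow> - \<psi> t" for t
    using lim[of t] by (simp add: \<phi>eq \<psi>_def)
  have iexp_int: "integrable (\<mu> n) (\<lambda>y. iexp (t * y))" for n t
    by (rule \<mu>.integrable_iexp) auto
  have cosint: "integrable (\<mu> n) w" and meq: "m n = (\<integral>y. w y \<partial>\<mu> n)" for n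
  proof -
    have ic: "integrable (\<mu> n) (\<lambda>y. cos (h * y))" using integrable_Re[OF iexp_int[of n h]] by (simp add: Re_exp)
    have "Re (\<phi> n h) = (\<integral>y. cos (h * y) \<partial>\<mu> n)"
      unfolding \<phi>_def char_def using integral_Re[OF iexp_int[of n h]] by (simp add: Re_exp)
    with ic show "m n = (\<integral>y. w y \<partial>\<mu> n)" "integrable (\<mu> n) w"
      unfolding m_def w_def[abs_def] by (auto simp: \<mu>.prob_space[simplified])
  qed
  have Re\<psi>: "Re (\<psi> h) = \<kappa>" using h by (simp add: \<psi>_def stable_exponent_def \<kappa>_def)
  have mlim: "(\<lambda>n. real n * m n) \<longlonglongrightarrow> \<kappa>"
    using tendsto_minus[OF tendsto_Re[OF lim'[of h]]] by (simp add: m_def Re\<psi> algebra_simps)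
  have mpos: "\<forall>\<^sub>F n in sequentially. m n > 0"
    using order_tendstoD(1)[OF mlim \<kappa>]
    by eventually_elim (auto simp: zero_less_mult_iff)
  have \<psi>int: "has_bochner_integral lborel (\<lambda>y. (1 - iexp (t * y) + \<i> * of_real (t * y)) * of_real (\<nu> y)) (\<psi> t)" for t
    unfolding \<nu>_def \<psi>_def by (rule stable_exponent_integral) (use pq in auto)
  have w\<nu>: "has_bochner_integral lborel (\<lambda>y. w y * \<nu> y) \<kappa>"
  proof -
    have "has_bochner_integral lborel (\<lambda>y. Re ((1 - iexp (h * y) + \<i> * of_real (h * y)) * of_real (\<nu> y))) (Re (\<psi> h))"
      by (rule has_bochner_integral_bounded_linear[OF bounded_linear_Re \<psi>int])
    then show ?thesis by (simp add: w_def Re_exp Re\<psi>)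
  qed
  define K where "K = density lborel (\<lambda>y. ennreal (w y * \<nu> y / \<kappa>))"
  have K: "real_distribution K"
  proof -
    have "emeasure K (space K) = (\<integral>\<^sup>+y. ennreal (w y * \<nu> y / \<kappa>) \<partial>lborel)"
      unfolding K_def by (subst emeasure_density) (auto simp: space_density)
    also have "\<dots> = ennreal (\<kappa> / \<kappa>)"
      using has_bochner_integral_divide_zero[OF w\<nu>, of \<kappa>] w0 \<nu>0 \<kappa>
      by (subst nn_integral_eq_integral) (auto simp: has_bochner_integral_iff)
    finally have "prob_space K" using \<kappa> by (intro prob_spaceI) simp
    then show ?thesis by (simp add: real_distribution_def real_distribution_axioms_def K_def)
  qed
  interpret K: real_distribution K by (rule K)
  have charK: "char K t = (\<psi> (t + h) / 2 + \<psi> (t - h) / 2 - \<psi> t) / of_real \<kappa>" for t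
  proof -
    have "has_bochner_integral lborel (\<lambda>y. ((1 - iexp ((t + h) * y) + \<i> * of_real ((t + h) * y)) * of_real (\<nu> y) / 2
        + (1 - iexp ((t - h) * y) + \<i> * of_real ((t - h) * y)) * of_real (\<nu> y) / 2
        - (1 - iexp (t * y) + \<i> * of_real (t * y)) * of_real (\<nu> y)) / of_real \<kappa>)
        ((\<psi> (t + h) / 2 + \<psi> (t - h) / 2 - \<psi> t) / of_real \<kappa>)"
      by (intro has_bochner_integral_divide_zero has_bochner_integral_add has_bochner_integral_diff \<psi>int)
    moreover have "((1 - iexp ((t + h) * y) + \<i> * of_real ((t + h) * y)) * of_real (\<nu> y) / 2
        + (1 - iexp ((t - h) * y) + \<i> * of_real ((t - h) * y)) * of_real (\<nu> y) / 2
        - (1 - iexp (t * y) + \<i> * of_real (t * y)) * of_real (\<nu> y)) / of_real \<kappa>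
        = (w y * \<nu> y / \<kappa>) *\<^sub>R iexp (t * y)" for y
    proof -
      have "iexp ((t + h) * y) + iexp ((t - h) * y) = iexp (t * y) * (2 * of_real (cos (h * y)))"
        by (simp add: complex_eq_iff Re_exp Im_exp cos_add sin_add cos_diff sin_diff algebra_simps)
      then have e: "iexp ((t + h) * y) = iexp (t * y) * (2 * of_real (cos (h * y))) - iexp ((t - h) * y)"
        by (simp add: algebra_simps)
      show ?thesis
        unfolding e w_def scaleR_conv_of_real using \<kappa> by (simp add: field_simps)
    qed
    ultimately have "has_bochner_integral lborel (\<lambda>y. (w y * \<nu> y / \<kappa>) *\<^sub>R iexp (t * y)) ((\<psi> (t + h) / 2 + \<psi> (t - h) / 2 - \<psi> t) / of_real \<kappa>)"
      by (simp only:)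
    then show ?thesis
      unfolding char_def K_def using w0 \<nu>0 \<kappa>
      by (subst integral_density) (auto simp: has_bochner_integral_iff)
  qed
  \<comment> \<open>The default \<open>K\<close> makes \<open>Kn n\<close> a probability measure
    even for those \<open>n\<close> with \<open>m n = 0\<close>; eventually
    \<open>m n > 0\<close>.\<close>
  define Kn where "Kn n = (if m n > 0 then density (\<mu> n) (\<lambda>y. ennreal (w y / m n)) else K)" for n
  have Kn: "real_distribution (Kn n)" for n
  proof (cases "m n > 0")
    case True
    have "emeasure (Kn n) (space (Kn n)) = (\<integral>\<^sup>+y. ennreal (w y / m n) \<partial>\<mu> n)"
      using True unfolding Kn_def by (simp, subst emeasure_density) (auto simp: space_density)
    also have "\<dots> = ennreal (m n / m n)"
      using cosint[of n] w0 True by (subst nn_integral_eq_integral) (auto simp: meq)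
    finally have "prob_space (Kn n)" using True by (intro prob_spaceI) simp
    then show ?thesis using True by (simp add: real_distribution_def real_distribution_axioms_def Kn_def)
  qed (simp add: Kn_def K)
  have charKn: "char (Kn n) t = (\<phi> n t - \<phi> n (t + h) / 2 - \<phi> n (t - h) / 2) / of_real (m n)" if "m n > 0" for n t
  proof -
    have "char (Kn n) t = (\<integral>y. (w y / m n) *\<^sub>R iexp (t * y) \<partial>\<mu> n)"
      unfolding char_def Kn_def using that w0 by (simp, subst integral_density) auto
    also have "\<dots> = (\<integral>y. (iexp (t * y) - iexp ((t + h) * y) / 2 - iexp ((t - h) * y) / 2) / of_real (m n) \<partial>\<mu> n)"
    proof (rule Bochner_Integration.integral_cong[OF refl])
      fix y
      have "iexp ((t + h) * y) + iexp ((t - h) * y) = iexp (t * y) * (2 * of_real (cos (h * y)))"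
        by (simp add: complex_eq_iff Re_exp Im_exp cos_add sin_add cos_diff sin_diff algebra_simps)
      then have e: "iexp ((t + h) * y) = iexp (t * y) * (2 * of_real (cos (h * y))) - iexp ((t - h) * y)"
        by (simp add: algebra_simps)
      show "(w y / m n) *\<^sub>R iexp (t * y) = (iexp (t * y) - iexp ((t + h) * y) / 2 - iexp ((t - h) * y) / 2) / of_real (m n)"
        unfolding e w_def scaleR_conv_of_real using that by (simp add: field_simps)
    qed
    also have "\<dots> = (\<phi> n t - \<phi> n (t + h) / 2 - \<phi> n (t - h) / 2) / of_real (m n)"
      unfolding \<phi>_def char_def
      by (intro has_bochner_integral_integral_eq has_bochner_integral_divide_zero has_bochner_integral_diff
          has_bochner_integral_integrable iexp_int)
    finally show ?thesis .
  qed
  have charlim: "(\<lambda>n. char (Kn n) t) \<longlonglongrightarrow> char K t" for t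
  proof -
    let ?g = "\<lambda>n. (of_nat n * (\<phi> n t - 1) - of_nat n * (\<phi> n (t + h) - 1) / 2 - of_nat n * (\<phi> n (t - h) - 1) / 2) / of_real (real n * m n)"
    have "?g \<longlonglongrightarrow> (- \<psi> t - (- \<psi> (t + h)) / 2 - (- \<psi> (t - h)) / 2) / of_real \<kappa>"
      using \<kappa> by (intro tendsto_intros lim' mlim) auto
    also have "(- \<psi> t - (- \<psi> (t + h)) / 2 - (- \<psi> (t - h)) / 2) / of_real \<kappa> = char K t"
      by (simp add: charK algebra_simps)
    finally have "?g \<longlonglongrightarrow> char K t" .
    moreover have "\<forall>\<^sub>F n in sequentially. ?g n = char (Kn n) t"
      using mpos eventually_gt_at_top[of 0]
    proof eventually_elim
      fix n assume n: "m n > 0" "0 < n"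
      have "of_nat n * (\<phi> n t - 1) - of_nat n * (\<phi> n (t + h) - 1) / 2 - of_nat n * (\<phi> n (t - h) - 1) / 2
          = of_nat n * (\<phi> n t - \<phi> n (t + h) / 2 - \<phi> n (t - h) / 2)" by (simp add: field_simps)
      then show "?g n = char (Kn n) t" using n charKn[OF n(1), of t] by simp
    qed
    ultimately show ?thesis by (rule Lim_transform_eventually)
  qed
  have wc: "weak_conv_m Kn K" by (rule levy_continuity[OF Kn K charlim])
  \<comment> \<open>Dividing the indicator of the window by the weight leaves a bounded function
    with discontinuities at most at \<open>x\<close> and \<open>R\<close>, which are null for the
    absolutely continuous limit \<open>K\<close>.\<close>
  define f where "f y = indicator {x..R} y / w y" for y
  have [measurable]: "f \<in> borel_measurable borel" unfolding f_def[abs_def] by measurable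
  have wlow: "w y \<ge> 1 - cos (h * x)" if "x \<le> y" "y \<le> R" for y
  proof -
    have "h * y \<le> pi" using that x by (simp add: h_def field_simps)
    then have "cos (h * y) \<le> cos (h * x)" using that x h by (intro cos_monotone_0_pi_le) auto
    then show ?thesis by (simp add: w_def)
  qed
  have wx: "1 - cos (h * x) > 0"
  proof -
    have "h * x < pi" using x by (simp add: h_def field_simps)
    then have "cos (h * x) < cos 0" using x h by (intro cos_monotone_0_pi) auto
    then show ?thesis by simp
  qed
  have fbd: "norm (f y) \<le> 1 / (1 - cos (h * x))" for y
    using wlow[of y] wx by (auto simp: f_def indicator_def intro!: divide_left_mono mult_pos_pos)
  have fcont: "isCont f y" if ne: "y \<noteq> x" "y \<noteq> R" for y
  proof -
    consider "y < x" | "x < y" "y < R" | "y > R" using ne by linarith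
    then show ?thesis
    proof cases
      case 1
      have "\<forall>\<^sub>F z in nhds y. f z = 0"
        using eventually_nhds_in_open[of "{..<x}" y] 1 by (auto simp: f_def elim!: eventually_mono)
      then show ?thesis by (simp add: isCont_cong)
    next
      case 3
      have "\<forall>\<^sub>F z in nhds y. f z = 0"
        using eventually_nhds_in_open[of "{R<..}" y] 3 by (auto simp: f_def elim!: eventually_mono)
      then show ?thesis by (simp add: isCont_cong)
    next
      case 2
      have "isCont (\<lambda>z. 1 / w z) y"
        unfolding w_def using wlow[of y] wx 2 by (intro continuous_intros) (auto simp: w_def)
      moreover have "\<forall>\<^sub>F z in nhds y. f z = 1 / w z"
        using eventually_nhds_in_open[of "{x<..<R}" y] 2 by (auto simp: f_def elim!: eventually_mono)
      ultimately show ?thesis by (simp only: isCont_cong)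
    qed
  qed
  have "emeasure K {y. \<not> isCont f y} = 0"
  proof -
    have fin: "emeasure lborel {x, R} = 0" by (intro emeasure_lborel_countable) auto
    have "emeasure K {x, R} = 0"
      unfolding K_def by (subst emeasure_density) (auto intro!: nn_integral_null_set simp: null_sets_def fin)
    moreover have "{y. \<not> isCont f y} \<subseteq> {x, R}" using fcont by auto
    ultimately show ?thesis by (metis K.events_eq_borel emeasure_mono le_zero_eq sets.empty_sets sets.insert_in_sets borel_singleton)
  qed
  then have flim: "(\<lambda>n. \<integral>y. f y \<partial>Kn n) \<longlonglongrightarrow> (\<integral>y. f y \<partial>K)"
    by (intro weak_conv_imp_bdd_ae_continuous_conv[OF Kn K wc _ fbd]) auto
  have ae: "- \<alpha> - 1 = - 1 - \<alpha>" by simp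
  have fK: "(\<integral>y. f y \<partial>K) = p / \<alpha> * (x powr (- \<alpha>) - R powr (- \<alpha>)) / \<kappa>"
  proof -
    have "(\<integral>y. f y \<partial>K) = (\<integral>y. (w y * \<nu> y / \<kappa>) *\<^sub>R f y \<partial>lborel)"
      unfolding K_def using w0 \<nu>0 \<kappa> by (intro integral_density) auto
    also have "\<dots> = (\<integral>y. indicator {x..R} y *\<^sub>R (p * y powr (- 1 - \<alpha>) / \<kappa>) \<partial>lborel)"
      using wlow wx x
      by (intro Bochner_Integration.integral_cong) (force simp: f_def \<nu>_def stable_levy_def indicator_def)+
    also have "\<dots> = (- (p / (\<alpha> * \<kappa>)) * R powr (- \<alpha>)) - (- (p / (\<alpha> * \<kappa>)) * x powr (- \<alpha>))"
    proof (rule integral_FTC_Icc)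
      show "((\<lambda>y. - (p / (\<alpha> * \<kappa>)) * y powr (- \<alpha>)) has_vector_derivative p * y powr (- 1 - \<alpha>) / \<kappa>) (at y within {x..R})" if "x \<le> y" "y \<le> R" for y
        using that x \<alpha> \<kappa> unfolding has_real_derivative_iff_has_vector_derivative[symmetric]
        by (auto intro!: derivative_eq_intros simp: field_simps ae)
      show "continuous_on {x..R} (\<lambda>y. p * y powr (- 1 - \<alpha>) / \<kappa>)"
        using x \<kappa> by (intro continuous_intros) auto
    qed (use x in auto)
    also have "\<dots> = p / \<alpha> * (x powr (- \<alpha>) - R powr (- \<alpha>)) / \<kappa>"
      using \<alpha> \<kappa> by (simp add: field_simps)
    finally show ?thesis .
  qed
  have fKn: "(\<integral>y. f y \<partial>Kn n) = measure M {\<omega> \<in> space M. x * b n \<le> X \<omega> \<and> X \<omega> \<le> R * b n} / m n" if "m n > 0" for n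
  proof -
    have "(\<integral>y. f y \<partial>Kn n) = (\<integral>y. (w y / m n) *\<^sub>R f y \<partial>\<mu> n)"
      unfolding Kn_def if_P[OF that] using that w0 by (intro integral_density) auto
    also have "\<dots> = (\<integral>y. indicator {x..R} y / m n \<partial>\<mu> n)"
      using wlow wx by (intro Bochner_Integration.integral_cong) (force simp: f_def indicator_def)+
    also have "\<dots> = measure (\<mu> n) {x..R} / m n" by simp
    also have "measure (\<mu> n) {x..R} = measure M {\<omega> \<in> space M. x * b n \<le> X \<omega> \<and> X \<omega> \<le> R * b n}"
      unfolding \<mu>_def using b[of n]
      by (subst measure_distr) (auto intro!: arg_cong[where f = "measure M"] simp: field_simps)
    finally show ?thesis .
  qed
  have "(\<lambda>n. (real n * m n) * (\<integral>y. f y \<partial>Kn n)) \<longlonglongrightarrow> \<kappa> * (p / \<alpha> * (x powr (- \<alpha>) - R powr (- \<alpha>)) / \<kappa>)"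
    using flim unfolding fK by (intro tendsto_mult mlim)
  also have "\<kappa> * (p / \<alpha> * (x powr (- \<alpha>) - R powr (- \<alpha>)) / \<kappa>) = p / \<alpha> * (x powr (- \<alpha>) - R powr (- \<alpha>))"
    using \<kappa> by simp
  finally show ?thesis
  proof (rule Lim_transform_eventually)
    show "\<forall>\<^sub>F n in sequentially. (real n * m n) * (\<integral>y. f y \<partial>Kn n) = real n * measure M {\<omega> \<in> space M. x * b n \<le> X \<omega> \<and> X \<omega> \<le> R * b n}"
      using mpos by eventually_elim (simp add: fKn)
  qed
qed

text \<open>What the window misses lies beyond \<open>R * b n\<close>; its mass, multiplied by
  \<open>n\<close>, is eventually bounded by a multiple of \<open>R powr (- \<alpha>)\<close>, hence
  negligible for large \<open>R\<close>. This needs the exponents uniformly near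
  \<open>t = 0\<close>, not only pointwise.\<close>

lemma tail_limit:
  fixes X :: "'b \<Rightarrow> real" and b :: "nat \<Rightarrow> real"
  assumes ps: "prob_space M" and [measurable]: "X \<in> borel_measurable M" and b: "\<And>n. b n > 0"
    and pq: "p + q = 1 / A" "p - q = \<beta> / A" "p \<ge> 0" "q \<ge> 0"
    and lim: "\<And>T e. T > 0 \<Longrightarrow> e > 0 \<Longrightarrow> \<forall>\<^sub>F n in sequentially. \<forall>t. \<bar>t\<bar> \<le> T \<longrightarrow>
       cmod (of_nat n * (char (distr M borel X) (t / b n) - 1) + stable_exponent \<alpha> \<beta> t) \<le> e"
    and x: "0 < x"
  shows "(\<lambda>n. real n * measure M {\<omega> \<in> space M. x * b n \<le> X \<omega>}) \<longlonglongrightarrow> p / \<alpha> * x powr (- \<alpha>)"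
proof (rule LIMSEQ_I)
  fix r :: real assume r: "r > 0"
  interpret prob_space M by fact
  have pt: "(\<lambda>n. of_nat n * (char (distr M borel X) (t / b n) - 1)) \<longlonglongrightarrow> - stable_exponent \<alpha> \<beta> t" for t
  proof (rule tendstoI)
    fix e :: real assume "e > 0"
    moreover have "\<bar>t\<bar> + 1 > 0" by linarith
    ultimately have "\<forall>\<^sub>F n in sequentially. \<forall>s. \<bar>s\<bar> \<le> \<bar>t\<bar> + 1 \<longrightarrow>
       cmod (of_nat n * (char (distr M borel X) (s / b n) - 1) + stable_exponent \<alpha> \<beta> s) \<le> e / 2"
      by (intro lim) auto
    then have "\<forall>\<^sub>F n in sequentially. cmod (of_nat n * (char (distr M borel X) (t / b n) - 1) + stable_exponent \<alpha> \<beta> t) \<le> e / 2"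
      by (auto elim!: eventually_mono)
    then show "\<forall>\<^sub>F n in sequentially. dist (of_nat n * (char (distr M borel X) (t / b n) - 1)) (- stable_exponent \<alpha> \<beta> t) < e"
      by eventually_elim (use \<open>e > 0\<close> in \<open>auto simp: dist_norm\<close>)
  qed
  have "((\<lambda>R::real. R powr (- \<alpha>)) \<longlongrightarrow> 0) at_top"
    using \<alpha> by (intro tendsto_neg_powr filterlim_ident) auto
  then have "((\<lambda>R. p / \<alpha> * R powr (- \<alpha>)) \<longlongrightarrow> p / \<alpha> * 0) at_top" "((\<lambda>R. 4 * 2 powr \<alpha> * R powr (- \<alpha>)) \<longlongrightarrow> 4 * 2 powr \<alpha> * 0) at_top"
    by - (rule tendsto_mult[OF tendsto_const], assumption)+
  then have "\<forall>\<^sub>F R in at_top. p / \<alpha> * R powr (- \<alpha>) < r / 3" "\<forall>\<^sub>F R in at_top. 4 * 2 powr \<alpha> * R powr (- \<alpha>) < r / 3"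
    using r by (auto dest!: order_tendstoD(2)[where a = "r / 3"])
  then have "\<forall>\<^sub>F R in at_top. p / \<alpha> * R powr (- \<alpha>) < r / 3 \<and> 4 * (2 / R) powr \<alpha> < r / 3 \<and> R > x"
    using eventually_gt_at_top[of x] by eventually_elim (use x in \<open>auto simp: powr_divide powr_minus field_simps\<close>)
  from eventually_happens[OF this] obtain R where R: "p / \<alpha> * R powr (- \<alpha>) < r / 3" "4 * (2 / R) powr \<alpha> < r / 3" "R > x"
    by auto
  \<comment> \<open>With this \<open>h\<close> the truncation inequality speaks of the tail at
    \<open>R\<close>. The tolerance \<open>h powr \<alpha>\<close> imposed below equals the bound on
    \<open>Re (stable_exponent \<alpha> \<beta> u)\<close> for \<open>u \<le> h\<close>; together
    they produce the quantity \<open>4 * (2 / R) powr \<alpha>\<close> made small above.\<close>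
  define h where "h = 2 / R"
  have h: "h > 0" using R x by (simp add: h_def)
  let ?P = "\<lambda>n. measure M {\<omega> \<in> space M. x * b n \<le> X \<omega>}"
  let ?W = "\<lambda>n. measure M {\<omega> \<in> space M. x * b n \<le> X \<omega> \<and> X \<omega> \<le> R * b n}"
  have "\<forall>\<^sub>F n in sequentially. \<bar>real n * ?W n - p / \<alpha> * (x powr (- \<alpha>) - R powr (- \<alpha>))\<bar> < r / 3"
    using tendstoD[OF window_limit[OF ps _ b pq pt x R(3)], of "r / 3"] r by (simp add: dist_real_def)
  moreover have "\<forall>\<^sub>F n in sequentially. \<forall>t. \<bar>t\<bar> \<le> h \<longrightarrow>
       cmod (of_nat n * (char (distr M borel X) (t / b n) - 1) + stable_exponent \<alpha> \<beta> t) \<le> h powr \<alpha>"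
    by (rule lim) (use h in auto)
  ultimately have "\<forall>\<^sub>F n in sequentially. \<bar>real n * ?P n - p / \<alpha> * x powr (- \<alpha>)\<bar> < r"
    using eventually_gt_at_top[of 0]
  proof eventually_elim
    fix n assume 1: "\<bar>real n * ?W n - p / \<alpha> * (x powr (- \<alpha>) - R powr (- \<alpha>))\<bar> < r / 3"
      and 2: "\<forall>t. \<bar>t\<bar> \<le> h \<longrightarrow> cmod (of_nat n * (char (distr M borel X) (t / b n) - 1) + stable_exponent \<alpha> \<beta> t) \<le> h powr \<alpha>"
      and n: "0 < n"
    interpret Y: real_distribution "distr M borel (\<lambda>\<omega>. X \<omega> / b n)"
      by (intro real_distribution_distr) auto
    have "Y.prob {y. 2 / h \<le> \<bar>y\<bar>} \<le> 2 * (2 * h powr \<alpha> / n)"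
    proof (rule Y.tail_le_char[OF h])
      fix u assume u: "0 \<le> u" "u \<le> h"
      have "Re (of_nat n * (char (distr M borel X) (u / b n) - 1) + stable_exponent \<alpha> \<beta> u) \<ge> - (h powr \<alpha>)"
        using 2[rule_format, of u] u abs_Re_le_cmod[of "of_nat n * (char (distr M borel X) (u / b n) - 1) + stable_exponent \<alpha> \<beta> u"]
        by auto
      moreover have "Re (stable_exponent \<alpha> \<beta> u) \<le> h powr \<alpha>"
        using u \<alpha> by (auto simp: stable_exponent_def intro!: powr_mono2)
      ultimately have "real n * (1 - Re (char (distr M borel X) (u / b n))) \<le> 2 * h powr \<alpha>"
        by (simp add: algebra_simps)
      then show "1 - Re (char (distr M borel (\<lambda>\<omega>. X \<omega> / b n)) u) \<le> 2 * h powr \<alpha> / n"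
        using n by (simp add: char_distr_scale field_simps)
    qed
    also have "Y.prob {y. 2 / h \<le> \<bar>y\<bar>} = measure M {\<omega> \<in> space M. R * b n \<le> \<bar>X \<omega>\<bar>}"
      using b[of n] R x
      by (subst measure_distr) (auto intro!: arg_cong[where f = "measure M"] simp: h_def field_simps abs_div)
    finally have tail: "real n * measure M {\<omega> \<in> space M. R * b n \<le> \<bar>X \<omega>\<bar>} < r / 3"
      using n R(2) by (simp add: h_def field_simps)
    have "?W n \<le> ?P n" by (intro finite_measure_mono) auto
    moreover have "?P n \<le> ?W n + measure M {\<omega> \<in> space M. R * b n \<le> \<bar>X \<omega>\<bar>}"
      by (rule order.trans[OF finite_measure_mono measure_Un_le]) auto
    ultimately have "real n * ?W n \<le> real n * ?P n" "real n * ?P n \<le> real n * ?W n + real n * measure M {\<omega> \<in> space M. R * b n \<le> \<bar>X \<omega>\<bar>}"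
      using n by (auto simp flip: distrib_left)
    moreover have "p / \<alpha> * R powr (- \<alpha>) \<ge> 0" using pq \<alpha> by simp
    ultimately show "\<bar>real n * ?P n - p / \<alpha> * x powr (- \<alpha>)\<bar> < r"
      using 1 tail R(1) unfolding abs_less_iff right_diff_distrib by linarith
  qed
  then show "\<exists>no. \<forall>n\<ge>no. norm (real n * ?P n - p / \<alpha> * x powr (- \<alpha>)) < r"
    by (auto simp: eventually_sequentially)
qed

end

section \<open>Regular variation and truncated moments\<close>

text \<open>Let \<open>N x\<close> be the last index with \<open>b n \<le> x\<close>, so that
  \<open>b (N x) \<le> x < b (Suc (N x))\<close>. Monotonicity encloses the ratio at
  \<open>x\<close> between ratios of values at these two points. Passing from \<open>n\<close> to
  \<open>Suc n\<close> only costs a factor \<open>n / Suc n\<close>, which tends to 1, so both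
  enclosing ratios have the same limit.\<close>

lemma seq_tail_ratio:
  fixes F H :: "real \<Rightarrow> real" and b :: "nat \<Rightarrow> real"
  assumes F: "antimono F" "\<And>x. F x \<ge> 0" and H: "antimono H" "\<And>x. H x \<ge> 0"
    and b: "\<And>n. b n > 0" "filterlim b at_top sequentially" and c: "c > 0"
    and LF: "\<And>x. x > 0 \<Longrightarrow> (\<lambda>n. real n * F (x * b n)) \<longlonglongrightarrow> c * x powr (- \<alpha>)"
    and LH: "\<And>x. x > 0 \<Longrightarrow> (\<lambda>n. real n * H (x * b n)) \<longlonglongrightarrow> c' * x powr (- \<alpha>)"
    and l: "l > 0"
  shows "((\<lambda>x. H (l * x) / F x) \<longlongrightarrow> c' / c * l powr (- \<alpha>)) at_top" and "\<And>x. F x > 0"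
proof -
  have LF1: "(\<lambda>n. real n * F (b n)) \<longlonglongrightarrow> c" using LF[of 1] by simp
  show Fpos: "F x > 0" for x
  proof -
    have "\<forall>\<^sub>F n in sequentially. real n * F (b n) > 0" using order_tendstoD(1)[OF LF1 c] .
    moreover have "\<forall>\<^sub>F n in sequentially. b n \<ge> x" using b(2) by (simp add: filterlim_at_top)
    ultimately have "\<forall>\<^sub>F n in sequentially. F x > 0"
    proof eventually_elim
      case (elim n)
      then have "F (b n) > 0" by (simp add: zero_less_mult_iff)
      also have "F (b n) \<le> F x" using F(1) elim(2) by (rule antimonoD)
      finally show ?case .
    qed
    then show ?thesis by simp
  qed
  define N where "N x = Max {n. b n \<le> x}" for x
  have fin: "finite {n. b n \<le> x}" for x
  proof -
    have "\<forall>\<^sub>F n in sequentially. b n > x" using b(2) by (simp add: filterlim_at_top_dense)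
    then obtain m where "\<forall>n\<ge>m. b n > x" by (auto simp: eventually_sequentially)
    then have "{n. b n \<le> x} \<subseteq> {..<m}" by (auto simp: not_le[symmetric])
    then show ?thesis using finite_subset by blast
  qed
  have N1: "b (N x) \<le> x" "x < b (Suc (N x))" if "x \<ge> b 0" for x
  proof -
    have "N x \<in> {n. b n \<le> x}" unfolding N_def using fin that by (intro Max_in) auto
    then show "b (N x) \<le> x" by simp
    have "Suc (N x) \<notin> {n. b n \<le> x}"
      unfolding N_def using Max_ge[OF fin[of x]] by (metis Suc_n_not_le_n)
    then show "x < b (Suc (N x))" by simp
  qed
  have Nlim: "filterlim N sequentially at_top"
    unfolding filterlim_at_top
  proof
    fix m
    show "\<forall>\<^sub>F x in at_top. m \<le> N x"
      using eventually_ge_at_top[of "b m"] by eventually_elim (auto simp: N_def intro: Max_ge fin)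
  qed
  have L: "(\<lambda>n. H (l * b n) / F (b (Suc n))) \<longlonglongrightarrow> c' / c * l powr (- \<alpha>)"
  proof -
    have "(\<lambda>n. (real n * H (l * b n)) * (real (Suc n) / real n) / (real (Suc n) * F (b (Suc n)))) \<longlonglongrightarrow> (c' * l powr (- \<alpha>)) * 1 / c"
      using c by (intro tendsto_divide tendsto_mult LH[OF l] LIMSEQ_Suc[OF LF1] LIMSEQ_Suc_n_over_n) auto
    moreover have "\<forall>\<^sub>F n in sequentially. (real n * H (l * b n)) * (real (Suc n) / real n) / (real (Suc n) * F (b (Suc n))) = H (l * b n) / F (b (Suc n))"
      using eventually_gt_at_top[of 0] by eventually_elim (simp del: of_nat_Suc)
    ultimately show ?thesis by (auto elim: Lim_transform_eventually)
  qed
  have U: "(\<lambda>n. H (l * b (Suc n)) / F (b n)) \<longlonglongrightarrow> c' / c * l powr (- \<alpha>)"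
  proof -
    have "(\<lambda>n. (real (Suc n) * H (l * b (Suc n))) * (real n / real (Suc n)) / (real n * F (b n))) \<longlonglongrightarrow> (c' * l powr (- \<alpha>)) * 1 / c"
      using c by (intro tendsto_divide tendsto_mult LIMSEQ_Suc[OF LH[OF l]] LF1 LIMSEQ_n_over_Suc_n) auto
    moreover have "\<forall>\<^sub>F n in sequentially. (real (Suc n) * H (l * b (Suc n))) * (real n / real (Suc n)) / (real n * F (b n)) = H (l * b (Suc n)) / F (b n)"
      using eventually_gt_at_top[of 0] by eventually_elim (simp del: of_nat_Suc)
    ultimately show ?thesis by (auto elim: Lim_transform_eventually)
  qed
  show "((\<lambda>x. H (l * x) / F x) \<longlongrightarrow> c' / c * l powr (- \<alpha>)) at_top"
  proof (rule tendsto_sandwich[OF _ _ filterlim_compose[OF U Nlim] filterlim_compose[OF L Nlim]])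
    show "\<forall>\<^sub>F x in at_top. H (l * b (Suc (N x))) / F (b (N x)) \<le> H (l * x) / F x"
      using eventually_ge_at_top[of "b 0"]
    proof eventually_elim
      case (elim x)
      show ?case
        using N1[OF elim] l Fpos[of x] H(2) Fpos[of "b (N x)"]
        by (intro frac_le antimonoD[OF H(1)] antimonoD[OF F(1)]) auto
    qed
    show "\<forall>\<^sub>F x in at_top. H (l * x) / F x \<le> H (l * b (N x)) / F (b (Suc (N x)))"
      using eventually_ge_at_top[of "b 0"]
    proof eventually_elim
      case (elim x)
      show ?case
        using N1[OF elim] l Fpos[of x] H(2) Fpos
        by (intro frac_le antimonoD[OF H(1)] antimonoD[OF F(1)]) auto
    qed
  qed
qed

lemma dyadic_induct:
  fixes x0 :: real
  assumes "x0 > 0" and base: "\<And>x. x0 \<le> x \<Longrightarrow> x \<le> 2 * x0 \<Longrightarrow> P x" and step: "\<And>x. x0 \<le> x \<Longrightarrow> P x \<Longrightarrow> P (2 * x)"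
    and "x0 \<le> x"
  shows "P x"
proof -
  have "P x" if "x0 \<le> x" "x \<le> 2 ^ k * x0" for x k
    using that
  proof (induction k arbitrary: x)
    case (Suc k)
    show ?case
    proof (cases "x \<le> 2 * x0")
      case False
      then show ?thesis using step[of "x / 2"] Suc.IH[of "x / 2"] Suc.prems by simp
    qed (use base Suc.prems in auto)
  qed (use base assms(1) in auto)
  moreover obtain k where "x / x0 < 2 ^ k" using real_arch_pow[of 2 "x / x0"] by auto
  then have "x \<le> 2 ^ k * x0" using assms(1) by (simp add: field_simps)
  ultimately show ?thesis using assms(4) by blast
qed

context prob_space
begin

text \<open>One half of Karamata's theorem, proved by doubling:
  \<open>V (2 * x) \<le> V x + 4 * x^2 * H x\<close>, while \<open>x^2 * H x\<close> itself grows at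
  least by the factor \<open>4 * \<rho> > 1\<close>, because \<open>\<rho>\<close> is the midpoint
  between \<open>1 / 4\<close> and \<open>2 powr (- \<alpha>)\<close> and
  \<open>\<alpha> < 2\<close>.\<close>

lemma truncated_second_moment_bound:
  fixes X :: "'a \<Rightarrow> real"
  defines "H \<equiv> \<lambda>x. prob {\<omega> \<in> space M. x \<le> \<bar>X \<omega>\<bar>}"
  defines "V \<equiv> \<lambda>x. \<integral>\<omega>. indicator {\<omega> \<in> space M. \<bar>X \<omega>\<bar> \<le> x} \<omega> * (X \<omega>)\<^sup>2 \<partial>M"
  assumes [measurable]: "X \<in> borel_measurable M" and \<alpha>: "\<alpha> < 2"
    and RV: "((\<lambda>x. H (2 * x) / H x) \<longlongrightarrow> 2 powr (- \<alpha>)) at_top" and H: "\<And>x. H x > 0"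
  shows "\<exists>C x0. C > 0 \<and> x0 > 0 \<and> (\<forall>x\<ge>x0. V x \<le> C * x\<^sup>2 * H x)"
proof -
  define \<rho> where "\<rho> = (1 / 4 + 2 powr (- \<alpha>)) / 2"
  have "2 powr (- 2) < 2 powr (- \<alpha>)" using \<alpha> by (intro powr_less_mono) auto
  moreover have "2 powr (- 2) = (1 / 4 :: real)" by (simp add: powr_minus)
  ultimately have \<rho>: "1 / 4 < \<rho>" "\<rho> < 2 powr (- \<alpha>)" by (simp_all add: \<rho>_def)
  have "\<forall>\<^sub>F x in at_top. \<rho> < H (2 * x) / H x" using order_tendstoD(1)[OF RV \<rho>(2)] .
  then obtain x1 where "\<forall>x\<ge>x1. \<rho> < H (2 * x) / H x" by (auto simp: eventually_at_top_linorder)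
  then have x1: "\<rho> * H x \<le> H (2 * x)" if "x \<ge> x1" for x
    using that H[of x] by (auto simp: field_simps dest!: spec[of _ x])
  define x0 where "x0 = max 1 x1"
  have x0: "x0 \<ge> 1" "x0 \<ge> x1" by (auto simp: x0_def)
  have Vint: "integrable M (\<lambda>\<omega>. indicator {\<omega> \<in> space M. \<bar>X \<omega>\<bar> \<le> x} \<omega> * (X \<omega>)\<^sup>2)" for x
    by (rule integrable_const_bound[where B = "x\<^sup>2"])
       (auto simp: indicator_def abs_le_square_iff[symmetric])
  have Hanti: "H y \<le> H x" if "x \<le> y" for x y
    unfolding H_def using that by (intro finite_measure_mono) auto
  \<comment> \<open>The first term serves the interval from \<open>x0\<close> to
    \<open>2 * x0\<close>, where \<open>V x \<le> x^2\<close>; the second yields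
    \<open>C + 4 \<le> 4 * \<rho> * C\<close> for the doubling step.\<close>
  define C where "C = max (4 / H (2 * x0)) (4 / (4 * \<rho> - 1))"
  have C: "4 / H (2 * x0) \<le> C" "4 / (4 * \<rho> - 1) \<le> C" "C > 0"
    using H[of "2 * x0"] by (auto simp: C_def less_max_iff_disj)
  have "V x \<le> C * x\<^sup>2 * H x" if "x0 \<le> x" for x
  proof (rule dyadic_induct[OF _ _ _ that])
    show "x0 > 0" using x0 by simp
  next
    fix x assume x: "x0 \<le> x" "x \<le> 2 * x0"
    have "V x \<le> (\<integral>\<omega>. x\<^sup>2 \<partial>M)"
      unfolding V_def using Vint by (intro integral_mono) (auto simp: indicator_def abs_le_square_iff[symmetric])
    also have "\<dots> = x\<^sup>2" by (simp add: prob_space)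
    also have "\<dots> \<le> (4 / H (2 * x0)) * x\<^sup>2 * H (2 * x0)" using H[of "2 * x0"] by simp
    also have "\<dots> \<le> C * x\<^sup>2 * H x"
      using C H[of "2 * x0"] Hanti[OF x(2)] by (intro mult_mono) (auto intro: less_imp_le)
    finally show "V x \<le> C * x\<^sup>2 * H x" .
  next
    fix x assume x: "x0 \<le> x" and IH: "V x \<le> C * x\<^sup>2 * H x"
    have "V (2 * x) \<le> (\<integral>\<omega>. indicator {\<omega> \<in> space M. \<bar>X \<omega>\<bar> \<le> x} \<omega> * (X \<omega>)\<^sup>2 + (2 * x)\<^sup>2 * indicator {\<omega> \<in> space M. x \<le> \<bar>X \<omega>\<bar>} \<omega> \<partial>M)"
      unfolding V_def
    proof (intro integral_mono Vint)
      show "integrable M (\<lambda>\<omega>. indicator {\<omega> \<in> space M. \<bar>X \<omega>\<bar> \<le> x} \<omega> * (X \<omega>)\<^sup>2 + (2 * x)\<^sup>2 * indicator {\<omega> \<in> space M. x \<le> \<bar>X \<omega>\<bar>} \<omega>)"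
        by (intro Bochner_Integration.integrable_add Vint integrable_mult_right integrable_real_indicator) (auto simp: less_top[symmetric])
      fix \<omega> assume "\<omega> \<in> space M"
      have "(X \<omega>)\<^sup>2 \<le> (2 * x)\<^sup>2" if "\<bar>X \<omega>\<bar> \<le> 2 * x" using that x x0 by (intro abs_le_square_iff[THEN iffD1]) auto
      then show "indicator {\<omega> \<in> space M. \<bar>X \<omega>\<bar> \<le> 2 * x} \<omega> * (X \<omega>)\<^sup>2 \<le> indicator {\<omega> \<in> space M. \<bar>X \<omega>\<bar> \<le> x} \<omega> * (X \<omega>)\<^sup>2 + (2 * x)\<^sup>2 * indicator {\<omega> \<in> space M. x \<le> \<bar>X \<omega>\<bar>} \<omega>"
        using x x0 by (auto simp: indicator_def)
    qed
    also have "\<dots> = V x + (2 * x)\<^sup>2 * H x"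
      unfolding V_def H_def using Vint
      by (subst Bochner_Integration.integral_add) (auto simp: less_top[symmetric])
    also have "\<dots> \<le> (C + 4) * x\<^sup>2 * H x" using IH by (simp add: algebra_simps power_mult_distrib)
    also have "\<dots> \<le> (4 * \<rho> * C) * x\<^sup>2 * H x"
    proof -
      have "C + 4 \<le> 4 * \<rho> * C" using C(2) \<rho> by (simp add: field_simps)
      then show ?thesis using H[of x] by (intro mult_right_mono) (auto intro: less_imp_le)
    qed
    also have "\<dots> = C * (2 * x)\<^sup>2 * (\<rho> * H x)" by (simp add: power_mult_distrib)
    also have "\<dots> \<le> C * (2 * x)\<^sup>2 * H (2 * x)"
      using x1[of x] x x0 C by (intro mult_left_mono) auto
    finally show "V (2 * x) \<le> C * (2 * x)\<^sup>2 * H (2 * x)" .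
  qed
  then show ?thesis using C(3) x0 by (intro exI[of _ C] exI[of _ x0]) auto
qed

text \<open>The other half of Karamata's theorem. Here \<open>x * H x\<close> shrinks under doubling
  by the factor \<open>2 * \<rho> < 1\<close>, since \<open>\<alpha> > 1\<close>, and the comparison
  is anchored at infinity, where \<open>W\<close> vanishes by integrability.\<close>

lemma tail_expectation_bound:
  fixes X :: "'a \<Rightarrow> real"
  defines "H \<equiv> \<lambda>x. prob {\<omega> \<in> space M. x \<le> \<bar>X \<omega>\<bar>}"
  defines "W \<equiv> \<lambda>x. \<integral>\<omega>. indicator {\<omega> \<in> space M. x \<le> \<bar>X \<omega>\<bar>} \<omega> * \<bar>X \<omega>\<bar> \<partial>M"
  assumes X: "integrable M X" and \<alpha>: "1 < \<alpha>"
    and RV: "((\<lambda>x. H (2 * x) / H x) \<longlongrightarrow> 2 powr (- \<alpha>)) at_top" and H: "\<And>x. H x > 0"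
  shows "\<exists>C x0. C > 0 \<and> x0 > 0 \<and> (\<forall>x\<ge>x0. W x \<le> C * x * H x)"
proof -
  have [measurable]: "X \<in> borel_measurable M" using X by auto
  define \<rho> where "\<rho> = (1 / 2 + 2 powr (- \<alpha>)) / 2"
  have "2 powr (- \<alpha>) < 2 powr (- 1)" using \<alpha> by (intro powr_less_mono) auto
  moreover have "2 powr (- 1) = (1 / 2 :: real)" by (simp add: powr_minus)
  ultimately have \<rho>: "\<rho> < 1 / 2" "2 powr (- \<alpha>) < \<rho>" by (simp_all add: \<rho>_def)
  have "\<forall>\<^sub>F x in at_top. H (2 * x) / H x < \<rho>" using order_tendstoD(2)[OF RV \<rho>(2)] .
  then obtain x1 where "\<forall>x\<ge>x1. H (2 * x) / H x < \<rho>" by (auto simp: eventually_at_top_linorder)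
  then have x1: "H (2 * x) \<le> \<rho> * H x" if "x \<ge> x1" for x
    using that H[of x] by (auto simp: field_simps dest!: spec[of _ x])
  define x0 where "x0 = max 1 x1"
  have x0: "x0 \<ge> 1" "x0 \<ge> x1" by (auto simp: x0_def)
  have Wint: "integrable M (\<lambda>\<omega>. indicator {\<omega> \<in> space M. x \<le> \<bar>X \<omega>\<bar>} \<omega> * \<bar>X \<omega>\<bar>)" for x
    by (rule Bochner_Integration.integrable_bound[OF integrable_abs[OF X]]) (auto simp: indicator_def)
  define d where "d = 1 - 2 * \<rho>"
  \<comment> \<open>With \<open>C * (1 - 2 * \<rho>) = 2\<close> the decrease of
    \<open>C * x * H x\<close> under doubling pays for the loss \<open>2 * x * H x\<close> of
    \<open>W\<close>. Hence \<open>f\<close> does not decrease along \<open>2 ^ k * x\<close>, and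
    being bounded there by \<open>W\<close>, which tends to 0, it is not positive.\<close>
  define C where "C = 2 / d"
  have "d > 0" using \<rho> by (simp add: d_def)
  then have "C > 0" "C * d = 2" by (simp_all add: C_def)
  then have C: "C > 0" "C * (1 - 2 * \<rho>) = 2" by (simp_all add: d_def)
  define f where "f x = W x - C * x * H x" for x
  have step: "f x \<le> f (2 * x)" if x: "x \<ge> x0" for x
  proof -
    have "W x \<le> (\<integral>\<omega>. 2 * x * indicator {\<omega> \<in> space M. x \<le> \<bar>X \<omega>\<bar>} \<omega> + indicator {\<omega> \<in> space M. 2 * x \<le> \<bar>X \<omega>\<bar>} \<omega> * \<bar>X \<omega>\<bar> \<partial>M)"
      unfolding W_def
    proof (intro integral_mono Wint)
      show "integrable M (\<lambda>\<omega>. 2 * x * indicator {\<omega> \<in> space M. x \<le> \<bar>X \<omega>\<bar>} \<omega> + indicator {\<omega> \<in> space M. 2 * x \<le> \<bar>X \<omega>\<bar>} \<omega> * \<bar>X \<omega>\<bar>)"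
        by (intro Bochner_Integration.integrable_add Wint integrable_mult_right integrable_real_indicator) (auto simp: less_top[symmetric])
    qed (use x x0 in \<open>auto simp: indicator_def\<close>)
    also have "\<dots> = 2 * x * H x + W (2 * x)"
      unfolding W_def H_def using Wint
      by (subst Bochner_Integration.integral_add) (auto simp: less_top[symmetric])
    finally have "W x \<le> 2 * x * H x + W (2 * x)" .
    moreover have "C * (2 * x) * H (2 * x) \<le> C * (2 * x) * (\<rho> * H x)"
      using x1[of x] x x0 C by (intro mult_left_mono) auto
    moreover have "C * x * H x - C * (2 * x) * (\<rho> * H x) = C * (1 - 2 * \<rho>) * x * H x" by (simp add: algebra_simps)
    ultimately show ?thesis unfolding f_def C(2) by linarith
  qed
  have "W x \<le> C * x * H x" if x: "x \<ge> x0" for x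
  proof -
    have le: "f x \<le> W (2 ^ k * x)" for k
    proof -
      have "f x \<le> f (2 ^ k * x)"
      proof (induction k)
        case (Suc k)
        have "1 * x \<le> 2 ^ k * x" using x x0 by (intro mult_right_mono) auto
        then show ?case using Suc step[of "2 ^ k * x"] x by (simp add: mult.assoc)
      qed simp
      also have "\<dots> \<le> W (2 ^ k * x)" using C x x0 H by (simp add: f_def less_imp_le)
      finally show ?thesis .
    qed
    have "(\<lambda>k. W (2 ^ k * x)) \<longlonglongrightarrow> (\<integral>\<omega>. 0 \<partial>M)"
      unfolding W_def
    proof (rule integral_dominated_convergence[where w = "\<lambda>\<omega>. \<bar>X \<omega>\<bar>"])
      show "AE \<omega> in M. (\<lambda>k. indicator {\<omega> \<in> space M. 2 ^ k * x \<le> \<bar>X \<omega>\<bar>} \<omega> * \<bar>X \<omega>\<bar>) \<longlonglongrightarrow> 0"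
      proof (rule AE_I2)
        fix \<omega>
        obtain k where k: "\<bar>X \<omega>\<bar> < 2 ^ k" using real_arch_pow[of 2 "\<bar>X \<omega>\<bar>"] by auto
        have "\<forall>\<^sub>F j in sequentially. indicator {\<omega> \<in> space M. 2 ^ j * x \<le> \<bar>X \<omega>\<bar>} \<omega> * \<bar>X \<omega>\<bar> = 0"
          using eventually_ge_at_top[of k]
        proof eventually_elim
          fix j assume "k \<le> j"
          then have "(2::real) ^ k * 1 \<le> 2 ^ j * x" using x x0 by (intro mult_mono power_increasing) auto
          then show "indicator {\<omega> \<in> space M. 2 ^ j * x \<le> \<bar>X \<omega>\<bar>} \<omega> * \<bar>X \<omega>\<bar> = 0" using k by (auto simp: indicator_def)
        qed
        then show "(\<lambda>k. indicator {\<omega> \<in> space M. 2 ^ k * x \<le> \<bar>X \<omega>\<bar>} \<omega> * \<bar>X \<omega>\<bar>) \<longlonglongrightarrow> 0"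
          by (rule tendsto_eventually)
      qed
    qed (use X in \<open>auto simp: indicator_def\<close>)
    then have "f x \<le> 0" using le by (intro LIMSEQ_le_const) auto
    then show ?thesis by (simp add: f_def)
  qed
  then show ?thesis using C(1) x0 by (intro exI[of _ C] exI[of _ x0]) auto
qed

end

section \<open>Tails of a variable in the domain of attraction\<close>

lemma stable_char_eq_exp: "stable_char \<alpha> \<beta> t = exp (- stable_exponent \<alpha> \<beta> t)"
  by (simp add: stable_char_def stable_exponent_def sgn_real_def real_sgn_eq)

lemma stable_exponent_uminus: "stable_exponent \<alpha> (- \<beta>) t = stable_exponent \<alpha> \<beta> (- t)"
  by (simp add: stable_exponent_def sgn_minus)

lemma (in prob_space) char_normed_sum:
  assumes iid: "iid_copies M X \<xi>"
  shows "char (distr M borel (\<lambda>\<omega>. (\<Sum>i=1..n. \<xi> i \<omega>) / c)) t = char (distr M borel X) (t / c) ^ n"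
proof -
  have iv: "indep_vars (\<lambda>_. borel) \<xi> {1..}" and d: "\<And>i. i \<ge> 1 \<Longrightarrow> distr M borel (\<xi> i) = distr M borel X"
    using iid by (auto simp: iid_copies_def)
  have m: "\<xi> i \<in> borel_measurable M" if "i \<in> {1..}" for i
    using iv that by (auto simp: indep_vars_def)
  have "char (distr M borel (\<lambda>\<omega>. (\<Sum>i=1..n. \<xi> i \<omega>) / c)) t = char (distr M borel (\<lambda>\<omega>. \<Sum>i=1..n. \<xi> i \<omega>)) (t / c)"
    by (intro char_distr_scale borel_measurable_sum m) auto
  also have "\<dots> = (\<Prod>i=1..n. char (distr M borel (\<xi> i)) (t / c))"
    by (intro char_distr_sum indep_vars_subset[OF iv]) auto
  also have "\<dots> = char (distr M borel X) (t / c) ^ n" by (simp add: d)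
  finally show ?thesis .
qed

text \<open>Passing from \<open>X\<close> to \<open>- X\<close> exchanges \<open>p\<close> and
  \<open>q\<close> and changes the sign of \<open>\<beta>\<close>, so one tail limit serves both
  sides. The three ratios are then comparisons of tails that have been evaluated along the same
  sequence \<open>b\<close>.\<close>

lemma (in prob_space) attracted_tails:
  fixes X :: "'a \<Rightarrow> real"
  defines "F \<equiv> \<lambda>x. prob {\<omega> \<in> space M. x \<le> X \<omega>}"
    and "H \<equiv> \<lambda>x. prob {\<omega> \<in> space M. x \<le> \<bar>X \<omega>\<bar>}"
  assumes iid: "iid_copies M X \<xi>" and \<alpha>: "1 < \<alpha>" "\<alpha> < 2" and \<beta>: "-1 < \<beta>" "\<beta> \<le> 1"
    and attr: "attracted_to_stable M \<xi> \<alpha> \<beta>"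
  shows "\<And>l. l > 0 \<Longrightarrow> ((\<lambda>x. F (l * x) / F x) \<longlongrightarrow> l powr (- \<alpha>)) at_top"
    and "((\<lambda>x. H (2 * x) / H x) \<longlongrightarrow> 2 powr (- \<alpha>)) at_top"
    and "\<exists>C. ((\<lambda>x. H x / F x) \<longlongrightarrow> C) at_top" and "\<And>x. F x > 0"
proof -
  have [measurable]: "X \<in> borel_measurable M" using iid by (simp add: iid_copies_def)
  obtain b \<mu> where b: "\<And>n. b n > 0" and \<mu>: "real_distribution \<mu>" "\<And>t. char \<mu> t = stable_char \<alpha> \<beta> t"
    and wc: "weak_conv_m (\<lambda>n. distr M borel (\<lambda>\<omega>. (\<Sum>i=1..n. \<xi> i \<omega>) / b n)) \<mu>"
    using attr unfolding attracted_to_stable_def by auto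
  obtain A where A: "A > 0"
    "(\<integral>\<^sup>+x. ennreal ((1 - cos x) * x powr (- 1 - \<alpha>)) * indicator {0<..} x \<partial>lborel) = ennreal A"
    "(\<integral>\<^sup>+x. ennreal ((x - sin x) * x powr (- 1 - \<alpha>)) * indicator {0<..} x \<partial>lborel) = ennreal (A * (- tan (pi * \<alpha> / 2)))"
    by (rule stable_integrals[OF \<alpha>])
  interpret stable_constant \<alpha> A
    using \<alpha> A by (simp only: stable_constant_def)
  define \<phi> where "\<phi> = char (distr M borel X)"
  interpret X: real_distribution "distr M borel X" by (rule real_distribution_distr) auto
  have \<xi>m: "\<xi> i \<in> borel_measurable M" if "i \<ge> 1" for i
    using iid that by (auto simp: iid_copies_def indep_vars_def)
  have UC: "\<forall>\<^sub>F n in sequentially. \<forall>t. \<bar>t\<bar> \<le> T \<longrightarrow> cmod (\<phi> (t / b n) ^ n - exp (- stable_exponent \<alpha> \<beta> t)) \<le> e" if "e > 0" for T e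
  proof -
    have rd: "real_distribution (distr M borel (\<lambda>\<omega>. (\<Sum>i=1..n. \<xi> i \<omega>) / b n))" for n
      by (intro real_distribution_distr borel_measurable_divide borel_measurable_sum) (auto intro: \<xi>m)
    show ?thesis
      using weak_conv_m_imp_char_uniform[OF rd \<mu>(1) wc that, of T]
      by (simp only: char_normed_sum[OF iid] \<phi>_def \<mu>(2) stable_char_eq_exp)
  qed
  have \<psi>: "stable_exponent \<alpha> \<beta> 0 = 0" "Re (stable_exponent \<alpha> \<beta> 1) > 0"
    by (simp_all add: stable_exponent_def)
  have \<phi>c: "continuous_on UNIV \<phi>" "\<phi> 0 = 1"
    unfolding \<phi>_def using X.isCont_char by (auto simp: continuous_on_eq_continuous_at X.char_zero)
  have bt: "filterlim b at_top sequentially"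
    by (rule norming_filterlim_at_top[OF _ b stable_exponent_continuous \<psi>(2) UC])
       (auto simp: \<phi>_def X.cmod_char_le_1)
  have lim: "\<forall>\<^sub>F n in sequentially. \<forall>t. \<bar>t\<bar> \<le> T \<longrightarrow> cmod (of_nat n * (\<phi> (t / b n) - 1) + stable_exponent \<alpha> \<beta> t) \<le> e"
    if "T > 0" "e > 0" for T e
    by (rule char_power_limit_imp_log_limit[OF \<phi>c bt b stable_exponent_continuous \<psi>(1) UC that])
  \<comment> \<open>The solution of \<open>p + q = 1 / A\<close>,
    \<open>p - q = \<beta> / A\<close>. Since \<open>\<beta> > -1\<close>, the weight
    \<open>p\<close> of the right tail is positive, which makes it a legitimate denominator;
    \<open>q\<close> vanishes when \<open>\<beta> = 1\<close>.\<close>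
  define p q where "p = (1 + \<beta>) / (2 * A)" and "q = (1 - \<beta>) / (2 * A)"
  have pq: "p + q = 1 / A" "p - q = \<beta> / A" "p > 0" "q \<ge> 0"
    using A(1) \<beta> by (simp_all add: p_def q_def field_simps)
  define G where "G x = prob {\<omega> \<in> space M. x \<le> - X \<omega>}" for x
  have LF: "(\<lambda>n. real n * F (x * b n)) \<longlonglongrightarrow> (p / \<alpha>) * x powr (- \<alpha>)" if "x > 0" for x
    unfolding F_def
    by (rule tail_limit[OF prob_space_axioms _ b pq(1,2) _ pq(4) _ that]) (use lim pq in \<open>auto simp: \<phi>_def\<close>)
  have LG: "(\<lambda>n. real n * G (x * b n)) \<longlonglongrightarrow> (q / \<alpha>) * x powr (- \<alpha>)" if x: "x > 0" for x
    unfolding G_def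
  proof (rule tail_limit[where q = p and \<beta> = "- \<beta>", OF prob_space_axioms _ b _ _ _ _ _ x])
    have ch: "char (distr M borel (\<lambda>\<omega>. - X \<omega>)) t = \<phi> (- t)" for t
      unfolding \<phi>_def char_def by (simp add: integral_distr)
    show "\<forall>\<^sub>F n in sequentially. \<forall>t. \<bar>t\<bar> \<le> T \<longrightarrow>
       cmod (of_nat n * (char (distr M borel (\<lambda>\<omega>. - X \<omega>)) (t / b n) - 1) + stable_exponent \<alpha> (- \<beta>) t) \<le> e"
      if "T > 0" "e > 0" for T e
      using lim[OF that]
    proof eventually_elim
      case (elim n)
      show ?case
      proof (intro allI impI)
        fix t assume "\<bar>t\<bar> \<le> T"
        with elim[rule_format, of "- t"] show "cmod (of_nat n * (char (distr M borel (\<lambda>\<omega>. - X \<omega>)) (t / b n) - 1) + stable_exponent \<alpha> (- \<beta>) t) \<le> e"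
          by (simp add: ch stable_exponent_uminus)
      qed
    qed
  qed (use pq in \<open>auto simp: algebra_simps\<close>)
  have HFG: "H x = F x + G x" if "x > 0" for x
  proof -
    have "H x = prob ({\<omega> \<in> space M. x \<le> X \<omega>} \<union> {\<omega> \<in> space M. x \<le> - X \<omega>})"
      unfolding H_def by (intro arg_cong[where f = prob]) auto
    also have "\<dots> = F x + G x"
      unfolding F_def G_def using that by (intro finite_measure_Union) auto
    finally show ?thesis .
  qed
  have LH: "(\<lambda>n. real n * H (x * b n)) \<longlonglongrightarrow> ((p + q) / \<alpha>) * x powr (- \<alpha>)" if "x > 0" for x
    using tendsto_add[OF LF[OF that] LG[OF that]] b that
    by (simp add: HFG algebra_simps add_divide_distrib)
  have F: "antimono F" "\<And>x. F x \<ge> 0" and H: "antimono H" "\<And>x. H x \<ge> 0"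
    unfolding F_def H_def by (auto intro!: antimonoI finite_measure_mono)
  have c: "p / \<alpha> > 0" "(p + q) / \<alpha> > 0" using pq(3,4) \<alpha> by (auto intro!: divide_pos_pos add_pos_nonneg)
  show "((\<lambda>x. F (l * x) / F x) \<longlongrightarrow> l powr (- \<alpha>)) at_top" if "l > 0" for l
    using seq_tail_ratio(1)[OF F F b bt c(1) LF LF that] divide_self[of "p / \<alpha>"] c(1) by (simp only: mult_1_left)
  show "((\<lambda>x. H (2 * x) / H x) \<longlongrightarrow> 2 powr (- \<alpha>)) at_top"
    using seq_tail_ratio(1)[OF H H b bt c(2) LH LH, of 2] divide_self[of "(p + q) / \<alpha>"] c(2) by (simp only: mult_1_left)
  show "\<exists>C. ((\<lambda>x. H x / F x) \<longlongrightarrow> C) at_top"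
    using seq_tail_ratio(1)[OF F H b bt c(1) LF LH zero_less_one] by (auto simp only: mult_1_left)
  show "F x > 0" for x
    by (rule seq_tail_ratio(2)[OF F F b bt c(1) LF LF zero_less_one])
qed

section \<open>Independent steps and stopping\<close>

locale iid_seq = prob_space M for M :: "'a measure" +
  fixes X :: "'a \<Rightarrow> real" and \<xi> :: "nat \<Rightarrow> 'a \<Rightarrow> real"
  assumes iid: "iid_copies M X \<xi>"
begin

text \<open>Steps are indexed from 0, so that the first \<open>k\<close> of them are those with index below \<open>k\<close>.\<close>

definition step :: "nat \<Rightarrow> 'a \<Rightarrow> real" where "step i = \<xi> (Suc i)"

text \<open>Increments without drift, so that a single maximal inequality serves all values of
  \<open>a\<close>.\<close>

definition block :: "nat \<Rightarrow> nat \<Rightarrow> 'a \<Rightarrow> real" where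
  "block k j \<omega> = (\<Sum>i\<in>{k..<k + j}. step i \<omega>)"

text \<open>The sigma-algebra is encoded as a measure, so that membership of events follows from the
  rules for measurable functions.\<close>

definition info :: "nat set \<Rightarrow> 'a measure" where
  "info I = sigma (space M) (\<Union>i\<in>I. {step i -` A \<inter> space M | A. A \<in> sets borel})"

lemma X_measurable [measurable]: "X \<in> borel_measurable M"
  using iid by (simp add: iid_copies_def)

lemma indep_vars_step: "indep_vars (\<lambda>_. borel) step UNIV"
proof -
  have "indep_vars (\<lambda>_. borel) \<xi> {1..}" using iid by (simp add: iid_copies_def)
  then have i: "indep_sets (\<lambda>i. sigma_sets (space M) {\<xi> i -` A \<inter> space M | A. A \<in> sets borel}) {1..}"
    and m: "\<And>i. i \<ge> 1 \<Longrightarrow> \<xi> i \<in> borel_measurable M" by (auto simp: indep_vars_def)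
  show ?thesis
    unfolding indep_vars_def
  proof (intro conjI ballI indep_setsI)
    show "step i \<in> borel_measurable M" for i by (simp add: step_def m)
    show "sigma_sets (space M) {step i -` A \<inter> space M | A. A \<in> sets borel} \<subseteq> events" for i
      using m[of "Suc i"] by (intro sets.sigma_sets_subset) (auto simp: step_def)
  next
    fix A and J :: "nat set" assume J: "J \<noteq> {}" "finite J" "\<forall>j\<in>J. A j \<in> sigma_sets (space M) {step j -` A \<inter> space M | A. A \<in> sets borel}"
    have "prob (\<Inter>j\<in>Suc ` J. A (j - 1)) = (\<Prod>j\<in>Suc ` J. prob (A (j - 1)))"
      by (rule indep_setsD[OF i]) (use J in \<open>auto simp: step_def\<close>)
    then show "prob (\<Inter>j\<in>J. A j) = (\<Prod>j\<in>J. prob (A j))"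
      by (simp add: prod.reindex)
  qed
qed

lemma step_measurable [measurable]: "step i \<in> borel_measurable M"
  using indep_vars_step by (simp add: indep_vars_def)

lemma block_measurable [measurable]: "block k j \<in> borel_measurable M"
  unfolding block_def[abs_def] by measurable

lemma space_info [simp]: "space (info I) = space M"
  by (simp add: info_def space_measure_of_conv)

lemma sets_info: "sets (info I) = sigma_sets (space M) (\<Union>i\<in>I. {step i -` A \<inter> space M | A. A \<in> sets borel})"
  unfolding info_def by (intro sets_measure_of) auto

lemma step_info: "i \<in> I \<Longrightarrow> step i \<in> borel_measurable (info I)"
  by (rule measurableI) (auto simp: sets_info intro!: sigma_sets.Basic)

lemma block_info: "{k..<k + j} \<subseteq> I \<Longrightarrow> block k j \<in> borel_measurable (info I)"
  unfolding block_def[abs_def] by (intro borel_measurable_sum step_info) auto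

lemma info_events: "A \<in> sets (info I) \<Longrightarrow> A \<in> events"
proof -
  have "sets (info I) \<subseteq> events"
    unfolding sets_info by (intro sets.sigma_sets_subset) auto
  then show "A \<in> sets (info I) \<Longrightarrow> A \<in> events" by auto
qed

text \<open>The grouping theorem for independent families closed under intersection, with the two
  groups indexed by a Boolean.\<close>

lemma prob_info_indep:
  assumes "I \<inter> J = {}" and A: "A \<in> sets (info I)" and B: "B \<in> sets (info J)"
  shows "prob (A \<inter> B) = prob A * prob B"
proof -
  have "indep_sets (\<lambda>i. {step i -` A \<inter> space M | A. A \<in> sets borel}) UNIV"
    using indep_vars_step by (simp add: indep_vars_def2)
  then have "indep_sets (\<lambda>j. sigma_sets (space M) (\<Union>i\<in>case_bool I J j. {step i -` A \<inter> space M | A. A \<in> sets borel})) UNIV"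
  proof (intro indep_sets_collect_sigma)
    show "Int_stable {step i -` A \<inter> space M | A. A \<in> sets borel}" for i
    proof (rule Int_stableI)
      fix a b assume "a \<in> {step i -` A \<inter> space M | A. A \<in> sets borel}" "b \<in> {step i -` A \<inter> space M | A. A \<in> sets borel}"
      then obtain A B where "a = step i -` A \<inter> space M" "b = step i -` B \<inter> space M" "A \<in> sets borel" "B \<in> sets borel" by auto
      then show "a \<inter> b \<in> {step i -` A \<inter> space M | A. A \<in> sets borel}"
        by (intro CollectI exI[of _ "A \<inter> B"]) auto
    qed
    show "disjoint_family_on (case_bool I J) UNIV"
      using assms(1) by (auto simp: disjoint_family_on_def split: bool.split)
  qed (auto intro: indep_sets_mono_index)
  from indep_setsD[OF this, of UNIV "case_bool A B"] show ?thesis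
    using A B by (simp add: UNIV_bool sets_info Int_commute mult.commute)
qed

lemma prob_step:
  assumes "A \<in> sets borel"
  shows "prob {\<omega> \<in> space M. step i \<omega> \<in> A} = prob {\<omega> \<in> space M. X \<omega> \<in> A}"
proof -
  have "distr M borel (step i) = distr M borel X"
    using iid by (simp add: iid_copies_def step_def)
  then have "measure (distr M borel (step i)) A = measure (distr M borel X) A" by simp
  then show ?thesis
    using assms by (simp add: measure_distr vimage_def Int_def conj_commute)
qed

lemma integral_step:
  fixes f :: "real \<Rightarrow> real"
  assumes [measurable]: "f \<in> borel_measurable borel"
  shows "(\<integral>\<omega>. f (step i \<omega>) \<partial>M) = (\<integral>\<omega>. f (X \<omega>) \<partial>M)"
    and "integrable M (\<lambda>\<omega>. f (step i \<omega>)) \<longleftrightarrow> integrable M (\<lambda>\<omega>. f (X \<omega>))"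
proof -
  have d: "distr M borel (step i) = distr M borel X"
    using iid by (simp add: iid_copies_def step_def)
  show "(\<integral>\<omega>. f (step i \<omega>) \<partial>M) = (\<integral>\<omega>. f (X \<omega>) \<partial>M)"
    using integral_distr[of "step i" M borel f] integral_distr[of X M borel f] d by simp
  show "integrable M (\<lambda>\<omega>. f (step i \<omega>)) \<longleftrightarrow> integrable M (\<lambda>\<omega>. f (X \<omega>))"
    using integrable_distr_eq[of "step i" M borel f] integrable_distr_eq[of X M borel f] d by simp
qed

text \<open>A form of the strong Markov property: \<open>A j\<close> is the event that a stopping time equals
  \<open>t j\<close>, and \<open>B j\<close> concerns the steps made afterwards.\<close>

lemma prob_stopping_le:
  assumes "finite K" and A: "\<And>j. j \<in> K \<Longrightarrow> A j \<in> sets (info {..<t j})"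
    and B: "\<And>j. j \<in> K \<Longrightarrow> B j \<in> sets (info {t j..})"
    and le: "\<And>j. j \<in> K \<Longrightarrow> prob (B j) \<le> r" and E: "E \<subseteq> (\<Union>j\<in>K. A j \<inter> B j)"
  shows "prob E \<le> r * (\<Sum>j\<in>K. prob (A j))"
proof -
  have ev: "A j \<in> events" "B j \<in> events" if "j \<in> K" for j
    using A[OF that] B[OF that] info_events by auto
  have "prob E \<le> prob (\<Union>j\<in>K. A j \<inter> B j)"
    using assms(1) ev by (intro finite_measure_mono E sets.finite_UN) auto
  also have "\<dots> \<le> (\<Sum>j\<in>K. prob (A j \<inter> B j))"
    using assms(1) ev by (intro finite_measure_subadditive_finite) auto
  also have "\<dots> = (\<Sum>j\<in>K. prob (A j) * prob (B j))"
    by (intro sum.cong prob_info_indep[OF _ A B]) auto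
  also have "\<dots> \<le> (\<Sum>j\<in>K. prob (A j) * r)"
    by (intro sum_mono mult_left_mono le) auto
  finally show ?thesis by (simp add: sum_distrib_left mult.commute)
qed

text \<open>In this direction the \<open>A j\<close> have to be disjoint, so that the probabilities
  of \<open>A j \<inter> B j\<close> may be added inside \<open>E\<close>.\<close>

lemma prob_stopping_ge:
  assumes "finite K" and A: "\<And>j. j \<in> K \<Longrightarrow> A j \<in> sets (info {..<t j})"
    and B: "\<And>j. j \<in> K \<Longrightarrow> B j \<in> sets (info {t j..})" and dis: "disjoint_family_on A K"
    and ge: "\<And>j. j \<in> K \<Longrightarrow> prob (B j) \<ge> r" and E: "E \<in> events" "\<And>j. j \<in> K \<Longrightarrow> A j \<inter> B j \<subseteq> E"
  shows "r * (\<Sum>j\<in>K. prob (A j)) \<le> prob E"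
proof -
  have ev: "A j \<in> events" "B j \<in> events" if "j \<in> K" for j
    using A[OF that] B[OF that] info_events by auto
  have disAB: "disjoint_family_on (\<lambda>j. A j \<inter> B j) K"
    using dis unfolding disjoint_family_on_def by blast
  have "r * (\<Sum>j\<in>K. prob (A j)) = (\<Sum>j\<in>K. prob (A j) * r)" by (simp add: sum_distrib_left mult.commute)
  also have "\<dots> \<le> (\<Sum>j\<in>K. prob (A j) * prob (B j))"
    by (intro sum_mono mult_left_mono ge) auto
  also have "\<dots> = (\<Sum>j\<in>K. prob (A j \<inter> B j))"
    by (intro sum.cong prob_info_indep[OF _ A B, symmetric]) auto
  also have "\<dots> = prob (\<Union>j\<in>K. A j \<inter> B j)"
    using assms(1) ev disAB by (intro finite_measure_finite_Union[symmetric]) auto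
  also have "\<dots> \<le> prob E" using E by (intro finite_measure_mono) auto
  finally show ?thesis .
qed

lemma sum_prob_disjoint_le:
  assumes "finite K" "disjoint_family_on A K" "\<And>j. j \<in> K \<Longrightarrow> A j \<in> events" "\<And>j. j \<in> K \<Longrightarrow> A j \<subseteq> E" "E \<in> events"
  shows "(\<Sum>j\<in>K. prob (A j)) \<le> prob E"
proof -
  have "(\<Sum>j\<in>K. prob (A j)) = prob (\<Union>j\<in>K. A j)"
    using assms by (intro finite_measure_finite_Union[symmetric]) auto
  also have "\<dots> \<le> prob E" using assms by (intro finite_measure_mono) auto
  finally show ?thesis .
qed

end

section \<open>Maximal inequalities\<close>

text \<open>What the analysis of the walk takes from regular variation: every quantity in the
  truncation argument is bounded through the right tail, and rescaling the argument of that tail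
  costs a constant. The index \<alpha> returns only for the exact limits in the final
  theorem.\<close>

locale heavy_walk = iid_seq +
  fixes c x0 :: real
  assumes c: "c > 0" and x0: "x0 > 0" and X_int: "integrable M X" and mean0: "(\<integral>\<omega>. X \<omega> \<partial>M) = 0"
    and two_sided: "\<And>x. x \<ge> x0 \<Longrightarrow> prob {\<omega> \<in> space M. x \<le> \<bar>X \<omega>\<bar>} \<le> c * prob {\<omega> \<in> space M. x \<le> X \<omega>}"
    and second: "\<And>x. x \<ge> x0 \<Longrightarrow> (\<integral>\<omega>. indicator {\<omega> \<in> space M. \<bar>X \<omega>\<bar> \<le> x} \<omega> * (X \<omega>)\<^sup>2 \<partial>M)
        \<le> c * x\<^sup>2 * prob {\<omega> \<in> space M. x \<le> X \<omega>}"
    and first: "\<And>x. x \<ge> x0 \<Longrightarrow> (\<integral>\<omega>. indicator {\<omega> \<in> space M. x \<le> \<bar>X \<omega>\<bar>} \<omega> * \<bar>X \<omega>\<bar> \<partial>M)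
        \<le> c * x * prob {\<omega> \<in> space M. x \<le> X \<omega>}"
    and dominated: "\<And>l. l > 0 \<Longrightarrow> \<exists>D y. D > 0 \<and> y > 0 \<and>
        (\<forall>x\<ge>y. prob {\<omega> \<in> space M. l * x \<le> X \<omega>} \<le> D * prob {\<omega> \<in> space M. x \<le> X \<omega>})"
begin

definition tail :: "real \<Rightarrow> real" where "tail x = prob {\<omega> \<in> space M. x \<le> X \<omega>}"

lemma tail_nonneg [simp]: "tail x \<ge> 0" by (simp add: tail_def)

lemma tail_antimono: "x \<le> y \<Longrightarrow> tail y \<le> tail x"
  unfolding tail_def by (intro finite_measure_mono) auto

lemma prob_step_ge: "prob {\<omega> \<in> space M. x \<le> step i \<omega>} = tail x"
  using prob_step[of "{x..}" i] by (simp add: tail_def)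

lemma block_Suc: "block k (Suc j) \<omega> = block k j \<omega> + step (k + j) \<omega>"
  by (simp add: block_def)

lemma block_add: "block k (i + j) \<omega> = block k i \<omega> + block (k + i) j \<omega>"
  by (induction j) (simp_all add: block_Suc algebra_simps block_def)

lemma indep_trunc_sum:
  fixes f :: "real \<Rightarrow> real"
  assumes [measurable]: "f \<in> borel_measurable borel"
  shows "indep_var borel (\<lambda>\<omega>. f (step (k + m) \<omega>)) borel (\<lambda>\<omega>. \<Sum>i\<in>{k..<k + m}. f (step i \<omega>))"
proof -
  have "indep_vars (\<lambda>_. borel) (\<lambda>i \<omega>. f (step i \<omega>)) UNIV"
    by (rule indep_vars_compose2[OF indep_vars_step]) auto
  then have "indep_vars (\<lambda>_. borel) (\<lambda>i \<omega>. f (step i \<omega>)) (insert (k + m) {k..<k + m})"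
    by (rule indep_vars_subset) auto
  then show ?thesis using indep_vars_sum[of "{k..<k + m}" "k + m" "\<lambda>i \<omega>. f (step i \<omega>)"] by simp
qed

text \<open>Induction on \<open>m\<close>, the last summand being independent of the sum before it.
  The term \<open>(m * e)^2\<close> appears because truncated steps are no longer centred.\<close>

lemma truncated_sum_moments:
  fixes f :: "real \<Rightarrow> real" and k :: nat
  assumes [measurable]: "f \<in> borel_measurable borel" and bd: "\<And>x. \<bar>f x\<bar> \<le> B"
  defines "U \<equiv> \<lambda>m \<omega>. \<Sum>i\<in>{k..<k + m}. f (step i \<omega>)"
    and "e \<equiv> (\<integral>\<omega>. f (X \<omega>) \<partial>M)" and "v \<equiv> (\<integral>\<omega>. (f (X \<omega>))\<^sup>2 \<partial>M)"
  shows "integrable M (U m) \<and> (\<integral>\<omega>. U m \<omega> \<partial>M) = real m * e \<and>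
    integrable M (\<lambda>\<omega>. (U m \<omega>)\<^sup>2) \<and> (\<integral>\<omega>. (U m \<omega>)\<^sup>2 \<partial>M) \<le> real m * v + (real m * e)\<^sup>2"
proof (induction m)
  case 0
  then show ?case by (simp add: U_def)
next
  case (Suc m)
  have fsq: "(f y)\<^sup>2 \<le> B\<^sup>2" for y
    by (rule abs_le_square_iff[THEN iffD1]) (use bd[of y] in linarith)
  have fi: "integrable M (\<lambda>\<omega>. f (step i \<omega>))" for i
    by (rule integrable_const_bound[where B = B]) (auto simp: bd)
  have fi2: "integrable M (\<lambda>\<omega>. (f (step i \<omega>))\<^sup>2)" for i
    by (rule integrable_const_bound[where B = "B\<^sup>2"]) (auto simp: fsq)
  have fe: "(\<integral>\<omega>. f (step i \<omega>) \<partial>M) = e" for i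
    unfolding e_def by (rule integral_step) auto
  have fv: "(\<integral>\<omega>. (f (step i \<omega>))\<^sup>2 \<partial>M) = v" for i
    unfolding v_def by (rule integral_step) auto
  have US: "U (Suc m) \<omega> = U m \<omega> + f (step (k + m) \<omega>)" for \<omega> by (simp add: U_def)
  have iv: "indep_var borel (\<lambda>\<omega>. f (step (k + m) \<omega>)) borel (U m)"
    unfolding U_def by (rule indep_trunc_sum) auto
  have pi: "integrable M (\<lambda>\<omega>. f (step (k + m) \<omega>) * U m \<omega>)"
    using Suc.IH fi by (intro indep_var_integrable iv) auto
  have pe: "(\<integral>\<omega>. f (step (k + m) \<omega>) * U m \<omega> \<partial>M) = e * (real m * e)"
    using Suc.IH fi by (subst indep_var_lebesgue_integral[OF iv]) (auto simp: fe)
  have sq: "(U (Suc m) \<omega>)\<^sup>2 = (U m \<omega>)\<^sup>2 + 2 * (f (step (k + m) \<omega>) * U m \<omega>) + (f (step (k + m) \<omega>))\<^sup>2" for \<omega>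
    by (simp add: US power2_eq_square algebra_simps)
  have v: "v \<ge> 0" by (simp add: v_def)
  have "(\<integral>\<omega>. (U (Suc m) \<omega>)\<^sup>2 \<partial>M) = (\<integral>\<omega>. (U m \<omega>)\<^sup>2 \<partial>M) + 2 * (e * (real m * e)) + v"
    unfolding sq using Suc.IH pi fi2 by (simp add: pe fv)
  also have "\<dots> \<le> (real m * v + (real m * e)\<^sup>2) + 2 * (e * (real m * e)) + v + e\<^sup>2"
    using conjunct2[OF conjunct2[OF conjunct2[OF Suc.IH]]] zero_le_power2[of e] by linarith
  also have "\<dots> = real (Suc m) * v + (real (Suc m) * e)\<^sup>2"
    by (simp add: algebra_simps power2_eq_square)
  finally show ?case
    using Suc.IH fi pi fi2 unfolding sq unfolding US by (auto simp: fe algebra_simps)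
qed

text \<open>Either some step reaches \<open>x\<close> in modulus, with probability at most
  \<open>c * m * tail x\<close>, or the sum of the truncated steps does, to which Chebyshev's
  inequality applies. Variance and squared mean contribute \<open>c * m * tail x\<close> each: the
  mean gives the square of this number, which is no larger than the number itself unless that
  exceeds 1, when the claim is trivial.\<close>

lemma prob_block_ge:
  assumes x: "x \<ge> x0"
  shows "prob {\<omega> \<in> space M. x \<le> \<bar>block k m \<omega>\<bar>} \<le> 3 * c * (real m * tail x)"
proof -
  define f where "f y = (if \<bar>y\<bar> < x then y else 0)" for y :: real
  have [measurable]: "f \<in> borel_measurable borel" unfolding f_def[abs_def] by measurable
  have xp: "x > 0" using x x0 by simp
  have bd: "\<bar>f y\<bar> \<le> x" for y using xp by (auto simp: f_def)
  have fsq: "(f y)\<^sup>2 \<le> x\<^sup>2" for y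
    by (rule abs_le_square_iff[THEN iffD1]) (use bd[of y] in linarith)
  define U where "U \<omega> = (\<Sum>i\<in>{k..<k + m}. f (step i \<omega>))" for \<omega>
  have [measurable]: "U \<in> borel_measurable M" unfolding U_def[abs_def] by measurable
  define e where "e = (\<integral>\<omega>. f (X \<omega>) \<partial>M)"
  define v where "v = (\<integral>\<omega>. (f (X \<omega>))\<^sup>2 \<partial>M)"
  note mom = truncated_sum_moments[OF \<open>f \<in> borel_measurable borel\<close> bd, where k = k and m = m, folded e_def v_def]
  have Uint: "integrable M (\<lambda>\<omega>. (U \<omega>)\<^sup>2)" and U2: "(\<integral>\<omega>. (U \<omega>)\<^sup>2 \<partial>M) \<le> real m * v + (real m * e)\<^sup>2"
    using mom unfolding U_def by auto
  have T: "tail x \<ge> 0" by simp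
  have v: "v \<le> c * x\<^sup>2 * tail x"
  proof -
    have "v \<le> (\<integral>\<omega>. indicator {\<omega> \<in> space M. \<bar>X \<omega>\<bar> \<le> x} \<omega> * (X \<omega>)\<^sup>2 \<partial>M)"
      unfolding v_def
    proof (rule integral_mono)
      show "integrable M (\<lambda>\<omega>. indicator {\<omega> \<in> space M. \<bar>X \<omega>\<bar> \<le> x} \<omega> * (X \<omega>)\<^sup>2)"
        by (rule integrable_const_bound[where B = "x\<^sup>2"]) (auto simp: indicator_def abs_le_square_iff[symmetric])
      show "integrable M (\<lambda>\<omega>. (f (X \<omega>))\<^sup>2)"
        by (rule integrable_const_bound[where B = "x\<^sup>2"]) (auto simp: fsq)
    qed (auto simp: f_def indicator_def)
    also have "\<dots> \<le> c * x\<^sup>2 * tail x" using second[OF x] by (simp add: tail_def)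
    finally show ?thesis .
  qed
  \<comment> \<open>As \<open>X\<close> has mean zero, truncation moves the mean by exactly minus
    the expectation of the part with \<open>|X| \<ge> x\<close>.\<close>
  have e: "\<bar>e\<bar> \<le> c * x * tail x"
  proof -
    have fi: "integrable M (\<lambda>\<omega>. f (X \<omega>))" by (rule integrable_const_bound[where B = x]) (auto simp: bd)
    have gi: "integrable M (\<lambda>\<omega>. indicator {\<omega> \<in> space M. x \<le> \<bar>X \<omega>\<bar>} \<omega> * \<bar>X \<omega>\<bar>)"
      by (rule Bochner_Integration.integrable_bound[OF integrable_abs[OF X_int]]) (auto simp: indicator_def)
    have "e = (\<integral>\<omega>. f (X \<omega>) - X \<omega> \<partial>M)" unfolding e_def using fi X_int by (simp add: mean0)
    also have "\<bar>\<dots>\<bar> \<le> (\<integral>\<omega>. \<bar>f (X \<omega>) - X \<omega>\<bar> \<partial>M)" by (rule integral_abs_bound)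
    also have "\<dots> = (\<integral>\<omega>. indicator {\<omega> \<in> space M. x \<le> \<bar>X \<omega>\<bar>} \<omega> * \<bar>X \<omega>\<bar> \<partial>M)"
      by (intro Bochner_Integration.integral_cong) (auto simp: f_def indicator_def)
    also have "\<dots> \<le> c * x * tail x" using first[OF x] by (simp add: tail_def)
    finally show ?thesis .
  qed
  show ?thesis
  proof (cases "c * (real m * tail x) \<le> 1")
    case False
    moreover have "prob {\<omega> \<in> space M. x \<le> \<bar>block k m \<omega>\<bar>} \<le> 1" by simp
    ultimately show ?thesis by linarith
  next
    case True
    have big: "prob (\<Union>i\<in>{k..<k + m}. {\<omega> \<in> space M. x \<le> \<bar>step i \<omega>\<bar>}) \<le> c * (real m * tail x)"
    proof -
      have "prob (\<Union>i\<in>{k..<k + m}. {\<omega> \<in> space M. x \<le> \<bar>step i \<omega>\<bar>}) \<le> (\<Sum>i\<in>{k..<k + m}. prob {\<omega> \<in> space M. x \<le> \<bar>step i \<omega>\<bar>})"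
        by (intro finite_measure_subadditive_finite) auto
      also have "\<dots> \<le> (\<Sum>i\<in>{k..<k + m}. c * tail x)"
      proof (intro sum_mono)
        fix i
        have "prob {\<omega> \<in> space M. x \<le> \<bar>step i \<omega>\<bar>} = prob {\<omega> \<in> space M. x \<le> \<bar>X \<omega>\<bar>}"
          using prob_step[of "{y. x \<le> \<bar>y\<bar>}" i] by simp
        also have "\<dots> \<le> c * tail x" using two_sided[OF x] by (simp add: tail_def)
        finally show "prob {\<omega> \<in> space M. x \<le> \<bar>step i \<omega>\<bar>} \<le> c * tail x" .
      qed
      finally show ?thesis by (simp add: algebra_simps)
    qed
    have small: "prob {\<omega> \<in> space M. x \<le> \<bar>U \<omega>\<bar>} \<le> 2 * (c * (real m * tail x))"
    proof -
      have "prob {\<omega> \<in> space M. x \<le> \<bar>U \<omega>\<bar>} = prob {\<omega> \<in> space M. x\<^sup>2 \<le> (U \<omega>)\<^sup>2}"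
        using xp by (intro arg_cong[where f = prob]) (auto simp: abs_le_square_iff[symmetric])
      also have "\<dots> \<le> (\<integral>\<omega>. (U \<omega>)\<^sup>2 \<partial>M) / x\<^sup>2"
        using Uint xp by (intro integral_Markov_inequality_measure[where A = "space M", simplified]) auto
      also have "\<dots> \<le> (real m * (c * x\<^sup>2 * tail x) + (c * (real m * tail x)) * x\<^sup>2) / x\<^sup>2"
      proof (intro divide_right_mono)
        have "(real m * e)\<^sup>2 = (real m * \<bar>e\<bar>)\<^sup>2" by (simp add: power_mult_distrib)
        also have "\<dots> \<le> (c * (real m * tail x) * x)\<^sup>2"
          using mult_left_mono[OF e, of "real m"] by (intro power_mono) (auto simp: algebra_simps)
        also have "\<dots> = (c * (real m * tail x))\<^sup>2 * x\<^sup>2" by (simp add: power_mult_distrib)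
        also have "\<dots> \<le> (c * (real m * tail x)) * x\<^sup>2"
        proof (rule mult_right_mono)
          have "z\<^sup>2 \<le> z" if "0 \<le> z" "z \<le> 1" for z :: real
            using that by (simp add: power2_eq_square mult_left_le)
          then show "(c * (real m * tail x))\<^sup>2 \<le> c * (real m * tail x)" using True c T by simp
        qed simp
        finally have "(real m * e)\<^sup>2 \<le> (c * (real m * tail x)) * x\<^sup>2" .
        moreover have "real m * v \<le> real m * (c * x\<^sup>2 * tail x)" using v by (intro mult_left_mono) auto
        ultimately show "(\<integral>\<omega>. (U \<omega>)\<^sup>2 \<partial>M) \<le> real m * (c * x\<^sup>2 * tail x) + (c * (real m * tail x)) * x\<^sup>2"
          using U2 by linarith
      qed auto
      also have "\<dots> = 2 * (c * (real m * tail x))" using xp by (simp add: field_simps)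
      finally show ?thesis .
    qed
    have "{\<omega> \<in> space M. x \<le> \<bar>block k m \<omega>\<bar>} \<subseteq> (\<Union>i\<in>{k..<k + m}. {\<omega> \<in> space M. x \<le> \<bar>step i \<omega>\<bar>}) \<union> {\<omega> \<in> space M. x \<le> \<bar>U \<omega>\<bar>}"
    proof
      fix \<omega> assume \<omega>: "\<omega> \<in> {\<omega> \<in> space M. x \<le> \<bar>block k m \<omega>\<bar>}"
      show "\<omega> \<in> (\<Union>i\<in>{k..<k + m}. {\<omega> \<in> space M. x \<le> \<bar>step i \<omega>\<bar>}) \<union> {\<omega> \<in> space M. x \<le> \<bar>U \<omega>\<bar>}"
      proof (cases "\<exists>i\<in>{k..<k + m}. x \<le> \<bar>step i \<omega>\<bar>")
        case False
        then have "U \<omega> = block k m \<omega>"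
          unfolding U_def block_def by (intro sum.cong) (auto simp: f_def not_le)
        then show ?thesis using \<omega> by simp
      qed (use \<omega> in auto)
    qed
    then have "prob {\<omega> \<in> space M. x \<le> \<bar>block k m \<omega>\<bar>} \<le> prob ((\<Union>i\<in>{k..<k + m}. {\<omega> \<in> space M. x \<le> \<bar>step i \<omega>\<bar>}) \<union> {\<omega> \<in> space M. x \<le> \<bar>U \<omega>\<bar>})"
      by (intro finite_measure_mono) auto
    also have "\<dots> \<le> c * (real m * tail x) + 2 * (c * (real m * tail x))"
      by (rule order.trans[OF measure_Un_le]) (use big small in auto)
    finally show ?thesis by simp
  qed
qed

lemma tail_scale:
  assumes "l > 0"
  obtains D y where "D > 0" "y > 0" "\<And>x. x \<ge> y \<Longrightarrow> tail (l * x) \<le> D * tail x"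
  using dominated[OF assms] unfolding tail_def by blast

lemma block_pred_info:
  assumes "{k..<k + j} \<subseteq> I"
  shows "{\<omega> \<in> space M. r \<le> block k j \<omega>} \<in> sets (info I)" "{\<omega> \<in> space M. block k j \<omega> < r} \<in> sets (info I)"
    "{\<omega> \<in> space M. r \<le> \<bar>block k j \<omega>\<bar>} \<in> sets (info I)" "{\<omega> \<in> space M. \<bar>block k j \<omega>\<bar> < r} \<in> sets (info I)"
proof -
  note [measurable] = block_info[OF assms]
  have "{\<omega> \<in> space (info I). r \<le> block k j \<omega>} \<in> sets (info I)" "{\<omega> \<in> space (info I). block k j \<omega> < r} \<in> sets (info I)"
    "{\<omega> \<in> space (info I). r \<le> \<bar>block k j \<omega>\<bar>} \<in> sets (info I)" "{\<omega> \<in> space (info I). \<bar>block k j \<omega>\<bar> < r} \<in> sets (info I)"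
    by measurable
  then show "{\<omega> \<in> space M. r \<le> block k j \<omega>} \<in> sets (info I)" "{\<omega> \<in> space M. block k j \<omega> < r} \<in> sets (info I)"
    "{\<omega> \<in> space M. r \<le> \<bar>block k j \<omega>\<bar>} \<in> sets (info I)" "{\<omega> \<in> space M. \<bar>block k j \<omega>\<bar> < r} \<in> sets (info I)"
    by simp_all
qed

lemma info_Ball:
  assumes "finite J" "\<And>j. j \<in> J \<Longrightarrow> {\<omega> \<in> space M. P j \<omega>} \<in> sets (info I)"
  shows "{\<omega> \<in> space M. \<forall>j\<in>J. P j \<omega>} \<in> sets (info I)"
  using sets.sets_Collect_finite_All'[of J "info I" P] assms sets.top[of "info I"] by (cases "J = {}") auto

lemma info_Bex:
  assumes "finite J" "\<And>j. j \<in> J \<Longrightarrow> {\<omega> \<in> space M. P j \<omega>} \<in> sets (info I)"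
  shows "{\<omega> \<in> space M. \<exists>j\<in>J. P j \<omega>} \<in> sets (info I)"
  using sets.sets_Collect_finite_Ex[of J "info I" P] assms by auto

lemma info_conj:
  assumes "{\<omega> \<in> space M. P \<omega>} \<in> sets (info I)" "{\<omega> \<in> space M. Q \<omega>} \<in> sets (info I)"
  shows "{\<omega> \<in> space M. P \<omega> \<and> Q \<omega>} \<in> sets (info I)"
  using sets.sets_Collect_conj[of "info I" Q P] assms by simp

text \<open>Ottaviani's inequality.\<close>

lemma prob_block_max_ge:
  assumes x: "x \<ge> x0"
  shows "prob {\<omega> \<in> space M. \<exists>j\<in>{..m}. 2 * x \<le> \<bar>block k j \<omega>\<bar>} \<le> 6 * c * (real m * tail x)"
proof (cases "3 * c * (real m * tail x) \<le> 1 / 2")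
  case False
  moreover have "prob {\<omega> \<in> space M. \<exists>j\<in>{..m}. 2 * x \<le> \<bar>block k j \<omega>\<bar>} \<le> 1" by simp
  ultimately show ?thesis by linarith
next
  case True
  define A where "A j = {\<omega> \<in> space M. 2 * x \<le> \<bar>block k j \<omega>\<bar> \<and> (\<forall>i\<in>{..<j}. \<bar>block k i \<omega>\<bar> < 2 * x)}" for j
  define B where "B j = {\<omega> \<in> space M. \<bar>block (k + j) (m - j) \<omega>\<bar> < x}" for j
  have A: "A j \<in> sets (info {..<k + j})" for j
    unfolding A_def by (intro info_conj info_Ball block_pred_info) auto
  have "1 / 2 * (\<Sum>j\<in>{..m}. prob (A j)) \<le> prob {\<omega> \<in> space M. x \<le> \<bar>block k m \<omega>\<bar>}"
  proof (rule prob_stopping_ge[where A = A and B = B and t = "\<lambda>j. k + j"])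
    show "disjoint_family_on A {..m}"
      by (auto simp: disjoint_family_on_def A_def) (metis lessThan_iff linorder_neqE_nat not_less)
    show "B j \<in> sets (info {k + j..})" for j unfolding B_def by (intro block_pred_info) auto
    fix j assume "j \<in> {..m}"
    then have j: "j \<le> m" by simp
    have "prob (B j) = 1 - prob {\<omega> \<in> space M. x \<le> \<bar>block (k + j) (m - j) \<omega>\<bar>}"
      unfolding B_def by (subst prob_compl[symmetric]) (auto intro!: arg_cong[where f = prob])
    moreover have "prob {\<omega> \<in> space M. x \<le> \<bar>block (k + j) (m - j) \<omega>\<bar>} \<le> 3 * c * (real (m - j) * tail x)"
      by (rule prob_block_ge[OF x])
    moreover have "3 * c * (real (m - j) * tail x) \<le> 3 * c * (real m * tail x)"
      using c by (intro mult_left_mono mult_right_mono) auto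
    ultimately show "1 / 2 \<le> prob (B j)" using True by linarith
    show "A j \<inter> B j \<subseteq> {\<omega> \<in> space M. x \<le> \<bar>block k m \<omega>\<bar>}"
      using block_add[of k j "m - j"] j by (auto simp: A_def B_def)
  qed (use A in auto)
  then have "(\<Sum>j\<in>{..m}. prob (A j)) \<le> 6 * c * (real m * tail x)"
    using prob_block_ge[OF x, of k m] by linarith
  moreover have "prob {\<omega> \<in> space M. \<exists>j\<in>{..m}. 2 * x \<le> \<bar>block k j \<omega>\<bar>} \<le> (\<Sum>j\<in>{..m}. prob (A j))"
  proof -
    have "{\<omega> \<in> space M. \<exists>j\<in>{..m}. 2 * x \<le> \<bar>block k j \<omega>\<bar>} \<subseteq> (\<Union>j\<in>{..m}. A j)"
    proof
      fix \<omega> assume \<omega>: "\<omega> \<in> {\<omega> \<in> space M. \<exists>j\<in>{..m}. 2 * x \<le> \<bar>block k j \<omega>\<bar>}"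
      define j where "j = (LEAST j. 2 * x \<le> \<bar>block k j \<omega>\<bar>)"
      have 1: "2 * x \<le> \<bar>block k j \<omega>\<bar>" unfolding j_def using \<omega> by (auto intro: LeastI)
      moreover have "\<bar>block k i \<omega>\<bar> < 2 * x" if "i < j" for i
        using not_less_Least[of i "\<lambda>j. 2 * x \<le> \<bar>block k j \<omega>\<bar>"] that by (simp add: j_def)
      moreover have "j \<le> m" using \<omega> unfolding j_def by (auto intro: order.trans[OF Least_le])
      ultimately show "\<omega> \<in> (\<Union>j\<in>{..m}. A j)" using \<omega> by (auto simp: A_def)
    qed
    then have "prob {\<omega> \<in> space M. \<exists>j\<in>{..m}. 2 * x \<le> \<bar>block k j \<omega>\<bar>} \<le> prob (\<Union>j\<in>{..m}. A j)"
      using info_events[OF A] by (intro finite_measure_mono sets.finite_UN) auto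
    also have "\<dots> \<le> (\<Sum>j\<in>{..m}. prob (A j))"
      using info_events[OF A] by (intro finite_measure_subadditive_finite) auto
    finally show ?thesis .
  qed
  ultimately show ?thesis by linarith
qed

text \<open>Ottaviani's bound brought to the scale at which it is used: the level may be any fixed
  multiple of \<open>x\<close>, while the estimate keeps \<open>tail x\<close>, at the cost of a
  constant from dominated variation.\<close>

lemma block_max_bound:
  assumes l: "l > 0"
  obtains C y where "C > 0" "y > 0"
    "\<And>x k m. x \<ge> y \<Longrightarrow> prob {\<omega> \<in> space M. \<exists>j\<in>{..m}. l * x \<le> \<bar>block k j \<omega>\<bar>} \<le> C * (real m * tail x)"
proof -
  obtain D y where D: "D > 0" "y > 0" "\<And>x. x \<ge> y \<Longrightarrow> tail (l / 2 * x) \<le> D * tail x"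
    using tail_scale[of "l / 2"] l by auto
  show thesis
  proof (rule that[of "6 * c * D" "max y (x0 / (l / 2))"])
    show "6 * c * D > 0" "max y (x0 / (l / 2)) > 0" using D c by auto
    fix x k m assume x: "x \<ge> max y (x0 / (l / 2))"
    then have "x0 \<le> l / 2 * x" using l by (simp add: field_simps)
    then have "prob {\<omega> \<in> space M. \<exists>j\<in>{..m}. 2 * (l / 2 * x) \<le> \<bar>block k j \<omega>\<bar>} \<le> 6 * c * (real m * tail (l / 2 * x))"
      by (rule prob_block_max_ge)
    also have "\<dots> \<le> 6 * c * (real m * (D * tail x))"
      using D(3)[of x] x c by (intro mult_left_mono) auto
    finally show "prob {\<omega> \<in> space M. \<exists>j\<in>{..m}. l * x \<le> \<bar>block k j \<omega>\<bar>} \<le> 6 * c * D * (real m * tail x)"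
      by (simp add: algebra_simps)
  qed
qed

end

section \<open>Survival probabilities\<close>

context heavy_walk
begin

text \<open>If all jumps stay below \<open>(1 - d) x\<close>, then after the first passage above \<open>d x / 3\<close> the walk
  still has to climb by \<open>2 d x / 3\<close>: two unlikely events are needed.\<close>

lemma two_jumps_bound:
  assumes d: "0 < d" "d < 1"
  obtains C y where "C > 0" "y > 0"
    "\<And>x k m. x \<ge> y \<Longrightarrow> prob {\<omega> \<in> space M. (\<exists>j\<in>{..m}. x \<le> block k j \<omega>) \<and> (\<forall>i\<in>{k..<k + m}. step i \<omega> < (1 - d) * x)}
       \<le> C * (real m * tail x)\<^sup>2"
proof -
  obtain C1 y1 where C1: "C1 > 0" "y1 > 0"
    "\<And>x k m. x \<ge> y1 \<Longrightarrow> prob {\<omega> \<in> space M. \<exists>j\<in>{..m}. d / 3 * x \<le> \<bar>block k j \<omega>\<bar>} \<le> C1 * (real m * tail x)"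
    using block_max_bound[of "d / 3"] d by auto
  obtain C2 y2 where C2: "C2 > 0" "y2 > 0"
    "\<And>x k m. x \<ge> y2 \<Longrightarrow> prob {\<omega> \<in> space M. \<exists>j\<in>{..m}. 2 * d / 3 * x \<le> \<bar>block k j \<omega>\<bar>} \<le> C2 * (real m * tail x)"
    using block_max_bound[of "2 * d / 3"] d by auto
  show thesis
  proof (rule that[of "C2 * C1" "max y1 y2"])
    show "C2 * C1 > 0" "max y1 y2 > 0" using C1 C2 by auto
    fix x k m assume x: "x \<ge> max y1 y2"
    then have xp: "x > 0" using C1 by auto
    let ?E = "{\<omega> \<in> space M. (\<exists>j\<in>{..m}. x \<le> block k j \<omega>) \<and> (\<forall>i\<in>{k..<k + m}. step i \<omega> < (1 - d) * x)}"
    define A where "A j = {\<omega> \<in> space M. d / 3 * x \<le> block k j \<omega> \<and> (\<forall>i\<in>{..<j}. block k i \<omega> < d / 3 * x)}" for j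
    define B where "B j = {\<omega> \<in> space M. \<exists>i\<in>{..m}. 2 * d / 3 * x \<le> \<bar>block (k + j) i \<omega>\<bar>}" for j
    have A: "A j \<in> sets (info {..<k + j})" for j
      unfolding A_def by (intro info_conj info_Ball block_pred_info) auto
    have "prob ?E \<le> C2 * (real m * tail x) * (\<Sum>j\<in>{..m}. prob (A j))"
    proof (rule prob_stopping_le[where A = A and B = B and t = "\<lambda>j. k + j"])
      show "B j \<in> sets (info {k + j..})" for j unfolding B_def by (intro info_Bex block_pred_info) auto
      show "prob (B j) \<le> C2 * (real m * tail x)" for j
        unfolding B_def using C2(3) x by auto
      show "?E \<subseteq> (\<Union>j\<in>{..m}. A j \<inter> B j)"
      proof
        fix \<omega> assume \<omega>: "\<omega> \<in> ?E"
        then obtain l where l: "l \<le> m" "x \<le> block k l \<omega>" by auto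
        define P where "P j \<longleftrightarrow> d / 3 * x \<le> block k j \<omega>" for j
        define j where "j = (LEAST j. P j)"
        have "d / 3 * x \<le> x" using d xp by simp
        then have ex: "P l" using l unfolding P_def by linarith
        have 1: "d / 3 * x \<le> block k j \<omega>" using LeastI[of P, OF ex] by (simp add: P_def j_def)
        have 2: "block k i \<omega> < d / 3 * x" if "i < j" for i
          using not_less_Least[of i P] that by (simp add: j_def P_def)
        have jl: "j \<le> l" unfolding j_def by (rule Least_le[of P, OF ex])
        \<comment> \<open>The passage is not at index 0, so it is made by a step. This step is below
          \<open>(1 - d) * x\<close> and starts below \<open>d / 3 * x\<close>, which limits the
          height reached.\<close>
        have "d / 3 * x > 0" using d xp by simp
        then have "j \<noteq> 0" using 1 by (intro notI) (simp add: block_def)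
        then obtain i where i: "j = Suc i" by (cases j) auto
        have "block k j \<omega> = block k i \<omega> + step (k + i) \<omega>" by (simp add: i block_Suc)
        moreover have "step (k + i) \<omega> < (1 - d) * x" using \<omega> jl l i by auto
        ultimately have "block k j \<omega> < x - 2 * d / 3 * x" using 2[of i] i by (simp add: algebra_simps)
        moreover have "block k l \<omega> = block k j \<omega> + block (k + j) (l - j) \<omega>"
          using block_add[of k j "l - j" \<omega>] jl by simp
        ultimately have "2 * d / 3 * x \<le> \<bar>block (k + j) (l - j) \<omega>\<bar>" using l by linarith
        then have "\<omega> \<in> A j \<inter> B j"
          using \<omega> 1 2 l unfolding A_def B_def by (auto intro!: bexI[of _ "l - j"])
        then show "\<omega> \<in> (\<Union>j\<in>{..m}. A j \<inter> B j)" using jl l by auto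
      qed
    qed (use A in auto)
    also have "\<dots> \<le> C2 * (real m * tail x) * (C1 * (real m * tail x))"
    proof (intro mult_left_mono)
      have "(\<Sum>j\<in>{..m}. prob (A j)) \<le> prob {\<omega> \<in> space M. \<exists>j\<in>{..m}. d / 3 * x \<le> \<bar>block k j \<omega>\<bar>}"
      proof (rule sum_prob_disjoint_le)
        show "disjoint_family_on A {..m}"
          by (auto simp: disjoint_family_on_def A_def) (metis lessThan_iff linorder_neqE_nat not_less)
        show "A j \<in> events" for j using A by (rule info_events)
        show "A j \<subseteq> {\<omega> \<in> space M. \<exists>j\<in>{..m}. d / 3 * x \<le> \<bar>block k j \<omega>\<bar>}" if "j \<in> {..m}" for j
          using that unfolding A_def by (auto intro!: bexI[of _ j])
      qed auto
      also have "\<dots> \<le> C1 * (real m * tail x)" using C1(3) x by auto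
      finally show "(\<Sum>j\<in>{..m}. prob (A j)) \<le> C1 * (real m * tail x)" .
    qed (use C2 in auto)
    finally show "prob ?E \<le> C2 * C1 * (real m * tail x)\<^sup>2" by (simp add: power2_eq_square algebra_simps)
  qed
qed

section \<open>Survival events and the truncated mean exit time\<close>

text \<open>This is the event \<open>\<tau> > n\<close>, written through sums of steps so that it is
  visibly decided by the first \<open>n\<close> of them.\<close>

definition surv :: "real \<Rightarrow> nat \<Rightarrow> 'a set" where
  "surv a n = {\<omega> \<in> space M. \<forall>k\<in>{1..n}. real k * a \<le> block 0 k \<omega>}"

text \<open>The expectation of \<open>min \<tau> n\<close> as a sum of tail probabilities, finite
  before anything is known about \<open>E \<tau>\<close>.\<close>

definition mu :: "real \<Rightarrow> nat \<Rightarrow> real" where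
  "mu a n = (\<Sum>k<n. prob (surv a k))"

lemma surv_info: "surv a n \<in> sets (info {..<n})"
  unfolding surv_def by (intro info_Ball block_pred_info) auto

lemma surv_events [measurable]: "surv a n \<in> events"
  using surv_info by (rule info_events)

lemma surv_block_ge: "\<omega> \<in> surv a l \<Longrightarrow> k \<le> l \<Longrightarrow> real k * a \<le> block 0 k \<omega>"
  by (cases "k = 0") (auto simp: surv_def block_def)

lemma surv_antimono: "m \<le> n \<Longrightarrow> surv a n \<subseteq> surv a m"
  by (auto simp: surv_def)

lemma mu_mono: "m \<le> n \<Longrightarrow> mu a m \<le> mu a n"
  unfolding mu_def by (intro sum_mono2) auto

lemma mu_nonneg: "mu a n \<ge> 0" by (simp add: mu_def sum_nonneg)

lemma mu_ge_1: "n \<ge> 1 \<Longrightarrow> mu a n \<ge> 1"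
  using mu_mono[of 1 n a] by (simp add: mu_def surv_def prob_space)

text \<open>Markov's inequality for \<open>min \<tau> n\<close>.\<close>

lemma prob_surv_le_mu: "m \<le> n \<Longrightarrow> real m * prob (surv a m) \<le> mu a n"
proof -
  assume "m \<le> n"
  have "real m * prob (surv a m) = (\<Sum>k<m. prob (surv a m))" by simp
  also have "\<dots> \<le> mu a m"
    unfolding mu_def by (intro sum_mono finite_measure_mono surv_antimono) auto
  also have "\<dots> \<le> mu a n" using \<open>m \<le> n\<close> by (rule mu_mono)
  finally show ?thesis .
qed

lemma sum_surv_eq_mu: "(\<Sum>k\<in>{1..n}. prob (surv a (k - 1))) = mu a n"
  unfolding mu_def
  by (rule sum.reindex_bij_witness[of _ Suc "\<lambda>k. k - 1"]) auto

lemma step_pred_info: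
  assumes "i \<in> I"
  shows "{\<omega> \<in> space M. r \<le> step i \<omega>} \<in> sets (info I)" "{\<omega> \<in> space M. step i \<omega> < r} \<in> sets (info I)"
proof -
  note [measurable] = step_info[OF assms]
  have "{\<omega> \<in> space (info I). r \<le> step i \<omega>} \<in> sets (info I)" "{\<omega> \<in> space (info I). step i \<omega> < r} \<in> sets (info I)"
    by measurable
  then show "{\<omega> \<in> space M. r \<le> step i \<omega>} \<in> sets (info I)" "{\<omega> \<in> space M. step i \<omega> < r} \<in> sets (info I)"
    by simp_all
qed

lemma prob_surv_jump:
  assumes "k \<ge> 1"
  shows "prob (surv a (k - 1) \<inter> {\<omega> \<in> space M. r \<le> step (k - 1) \<omega>}) = prob (surv a (k - 1)) * tail r"
proof -
  have "prob (surv a (k - 1) \<inter> {\<omega> \<in> space M. r \<le> step (k - 1) \<omega>}) = prob (surv a (k - 1)) * prob {\<omega> \<in> space M. r \<le> step (k - 1) \<omega>}"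
    by (rule prob_info_indep[OF _ surv_info step_pred_info(1), of _ "{k - 1..}"]) auto
  then show ?thesis by (simp add: prob_step_ge)
qed

text \<open>The \<open>k\<close>-th step is independent of survival up to time \<open>k - 1\<close>.
  The union over \<open>k\<close> therefore costs \<open>mu a n\<close>, where a bound ignoring
  survival would cost \<open>n\<close>.\<close>

lemma prob_surv_ex_jump_le:
  "prob {\<omega> \<in> space M. \<exists>k\<in>{1..n}. \<omega> \<in> surv a (k - 1) \<and> r \<le> step (k - 1) \<omega>} \<le> mu a n * tail r"
proof -
  have "{\<omega> \<in> space M. \<exists>k\<in>{1..n}. \<omega> \<in> surv a (k - 1) \<and> r \<le> step (k - 1) \<omega>}
     \<subseteq> (\<Union>k\<in>{1..n}. surv a (k - 1) \<inter> {\<omega> \<in> space M. r \<le> step (k - 1) \<omega>})" by auto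
  then have "prob {\<omega> \<in> space M. \<exists>k\<in>{1..n}. \<omega> \<in> surv a (k - 1) \<and> r \<le> step (k - 1) \<omega>}
     \<le> prob (\<Union>k\<in>{1..n}. surv a (k - 1) \<inter> {\<omega> \<in> space M. r \<le> step (k - 1) \<omega>})"
    by (intro finite_measure_mono) auto
  also have "\<dots> \<le> (\<Sum>k\<in>{1..n}. prob (surv a (k - 1) \<inter> {\<omega> \<in> space M. r \<le> step (k - 1) \<omega>}))"
    by (intro finite_measure_subadditive_finite) auto
  also have "\<dots> = mu a n * tail r"
    unfolding sum_surv_eq_mu[symmetric] sum_distrib_right by (intro sum.cong prob_surv_jump) auto
  finally show ?thesis .
qed

lemma prob_block_max_compl:
  "prob {\<omega> \<in> space M. \<forall>j\<in>{..m}. \<bar>block k j \<omega>\<bar> < r} = 1 - prob {\<omega> \<in> space M. \<exists>j\<in>{..m}. r \<le> \<bar>block k j \<omega>\<bar>}"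
proof -
  have "{\<omega> \<in> space M. \<forall>j\<in>{..m}. \<bar>block k j \<omega>\<bar> < r} = space M - {\<omega> \<in> space M. \<exists>j\<in>{..m}. r \<le> \<bar>block k j \<omega>\<bar>}"
    by (auto simp: not_le[symmetric])
  then show ?thesis by (simp add: prob_compl)
qed

text \<open>A step of size at least \<open>(1 + d) * n * a\<close>, made before the exit, lifts the
  walk above that height; fluctuations below \<open>d * n * a\<close> during the next
  \<open>n\<close> steps then leave it above \<open>n * a\<close>, the highest level required up to
  time \<open>n\<close>. The last two factors pay for demanding that the jump be the first of its
  size, and for the fluctuations.\<close>

lemma lower_bound:
  assumes d: "d > 0"
  obtains C y where "C > 0" "y > 0"
    "\<And>a n. a > 0 \<Longrightarrow> n \<ge> 1 \<Longrightarrow> real n * a \<ge> y \<Longrightarrow> C * (real n * tail (real n * a)) \<le> 1 \<Longrightarrow>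
       prob (surv a n) \<ge> mu a n * tail ((1 + d) * (real n * a)) * (1 - real n * tail (real n * a)) * (1 - C * (real n * tail (real n * a)))"
proof -
  obtain C y where C: "C > 0" "y > 0"
    "\<And>x k m. x \<ge> y \<Longrightarrow> prob {\<omega> \<in> space M. \<exists>j\<in>{..m}. d * x \<le> \<bar>block k j \<omega>\<bar>} \<le> C * (real m * tail x)"
    using block_max_bound[OF d] by auto
  show thesis
  proof (rule that[OF C(1,2)])
    fix a n assume a: "a > 0" and n: "n \<ge> (1::nat)" and y: "real n * a \<ge> y"
      and Cle: "C * (real n * tail (real n * a)) \<le> 1"
    define x where "x = real n * a"
    have xp: "x > 0" using a n by (simp add: x_def)
    define r where "r = (1 + d) * x"
    have rx: "x \<le> r" using d xp by (simp add: r_def)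
    \<comment> \<open>Excluding earlier steps of size \<open>r\<close> makes these events disjoint,
      so their probabilities may be summed. The \<open>k\<close>-th step carries index
      \<open>k - 1\<close>.\<close>
    define A where "A k = (surv a (k - 1) \<inter> {\<omega> \<in> space M. \<forall>j\<in>{..<k - 1}. step j \<omega> < r}) \<inter> {\<omega> \<in> space M. r \<le> step (k - 1) \<omega>}" for k
    define B where "B k = {\<omega> \<in> space M. \<forall>j\<in>{..n}. \<bar>block k j \<omega>\<bar> < d * x}" for k
    have A0: "surv a (k - 1) \<inter> {\<omega> \<in> space M. \<forall>j\<in>{..<k - 1}. step j \<omega> < r} \<in> sets (info {..<k - 1})" for k
      by (intro sets.Int surv_info info_Ball step_pred_info) auto
    have A: "A k \<in> sets (info {..<k})" if "k \<ge> 1" for k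
    proof -
      have "surv a (k - 1) \<in> sets (info {..<k})"
        unfolding surv_def using that by (intro info_Ball block_pred_info) auto
      then show ?thesis unfolding A_def using that by (intro sets.Int info_Ball step_pred_info) auto
    qed
    have 1: "(1 - C * (real n * tail x)) * (\<Sum>k\<in>{1..n}. prob (A k)) \<le> prob (surv a n)"
    proof (rule prob_stopping_ge[where A = A and B = B and t = "\<lambda>k. k"])
      show "B k \<in> sets (info {k..})" for k unfolding B_def by (intro info_Ball block_pred_info) auto
      show "disjoint_family_on A {1..n}"
      proof -
        have *: "A k \<inter> A l = {}" if "k < l" "k \<ge> 1" for k l
        proof -
          have kl: "k - 1 < l - 1" using that by auto
          show ?thesis
          proof (rule equals0I)
            fix \<omega> assume "\<omega> \<in> A k \<inter> A l"
            then have "r \<le> step (k - 1) \<omega>" "step (k - 1) \<omega> < r" using kl unfolding A_def by auto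
            then show False by simp
          qed
        qed
        show ?thesis
          unfolding disjoint_family_on_def
          using * by (metis Int_commute atLeastAtMost_iff linorder_neqE_nat)
      qed
      fix k assume k: "k \<in> {1..n}"
      have "prob (B k) = 1 - prob {\<omega> \<in> space M. \<exists>j\<in>{..n}. d * x \<le> \<bar>block k j \<omega>\<bar>}"
        unfolding B_def by (rule prob_block_max_compl)
      then show "1 - C * (real n * tail x) \<le> prob (B k)" using C(3)[of x n k] y by (simp add: x_def)
      show "A k \<inter> B k \<subseteq> surv a n"
      proof
        fix \<omega> assume \<omega>: "\<omega> \<in> A k \<inter> B k"
        have "real i * a \<le> block 0 i \<omega>" if i: "i \<in> {1..n}" for i
        proof (cases "i < k")
          case True
          then show ?thesis using \<omega> i by (auto simp: A_def surv_def)
        next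
          case False
          have "0 \<le> block 0 (k - 1) \<omega>"
          proof -
            have "real (k - 1) * a \<le> block 0 (k - 1) \<omega>"
              by (rule surv_block_ge[of _ _ "k - 1"]) (use \<omega> in \<open>auto simp: A_def\<close>)
            moreover have "0 \<le> real (k - 1) * a" using a by (intro mult_nonneg_nonneg) auto
            ultimately show ?thesis by (rule order.trans[rotated])
          qed
          moreover have "r \<le> step (k - 1) \<omega>" using \<omega> by (auto simp: A_def)
          moreover have "block 0 k \<omega> = block 0 (k - 1) \<omega> + step (k - 1) \<omega>"
            using block_Suc[of 0 "k - 1" \<omega>] k by simp
          moreover have "block 0 i \<omega> = block 0 k \<omega> + block k (i - k) \<omega>"
            using block_add[of 0 k "i - k" \<omega>] False by simp
          moreover have "\<bar>block k (i - k) \<omega>\<bar> < d * x" using \<omega> i by (auto simp: B_def)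
          moreover have "r = x + d * x" by (simp add: r_def algebra_simps)
          moreover have "real i * a \<le> x" unfolding x_def using i a by (intro mult_right_mono) auto
          ultimately show ?thesis by linarith
        qed
        then show "\<omega> \<in> surv a n" using \<omega> by (auto simp: surv_def A_def)
      qed
    qed (use A in auto)
    have "(\<Sum>k\<in>{1..n}. prob (A k)) \<ge> mu a n * tail r * (1 - real n * tail r)"
    proof -
      \<comment> \<open>Paths are discarded only if they survive up to their large jump. This makes
        the total loss \<open>mu a n * (n * tail r) * tail r\<close>, small relative to the main
        term; discarding with the cruder probability \<open>n * tail r\<close> would put
        \<open>n\<close> in place of \<open>mu a n\<close>.\<close>
      have "prob (A k) \<ge> (prob (surv a (k - 1)) - mu a n * tail r) * tail r" if k: "k \<in> {1..n}" for k
      proof -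
        let ?S = "surv a (k - 1) \<inter> {\<omega> \<in> space M. \<forall>j\<in>{..<k - 1}. step j \<omega> < r}"
        let ?J = "{\<omega> \<in> space M. \<exists>i\<in>{1..n}. \<omega> \<in> surv a (i - 1) \<and> r \<le> step (i - 1) \<omega>}"
        have "prob (A k) = prob ?S * prob {\<omega> \<in> space M. r \<le> step (k - 1) \<omega>}"
          unfolding A_def by (rule prob_info_indep[OF _ A0 step_pred_info(1), of _ "{k - 1..}"]) auto
        also have "prob {\<omega> \<in> space M. r \<le> step (k - 1) \<omega>} = tail r" by (rule prob_step_ge)
        finally have e: "prob (A k) = prob ?S * tail r" .
        have "surv a (k - 1) \<subseteq> ?S \<union> ?J"
        proof
          fix \<omega> assume \<omega>: "\<omega> \<in> surv a (k - 1)"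
          then have sp: "\<omega> \<in> space M" by (simp add: surv_def)
          show "\<omega> \<in> ?S \<union> ?J"
          proof (cases "\<forall>j\<in>{..<k - 1}. step j \<omega> < r")
            case False
            then obtain j where j: "j < k - 1" "r \<le> step j \<omega>" by (auto simp: not_less)
            then have "\<omega> \<in> surv a j" using surv_antimono[of j "k - 1" a] \<omega> by auto
            then have "\<omega> \<in> ?J" using sp j k by (auto intro!: bexI[of _ "Suc j"])
            then show ?thesis by simp
          qed (use \<omega> sp in auto)
        qed
        then have "prob (surv a (k - 1)) \<le> prob (?S \<union> ?J)" by (intro finite_measure_mono) auto
        also have "\<dots> \<le> prob ?S + prob ?J" by (rule measure_Un_le) auto
        also have "prob ?J \<le> mu a n * tail r" by (rule prob_surv_ex_jump_le)
        finally show ?thesis unfolding e by (intro mult_right_mono) auto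
      qed
      then have "(\<Sum>k\<in>{1..n}. prob (A k)) \<ge> (\<Sum>k\<in>{1..n}. (prob (surv a (k - 1)) - mu a n * tail r) * tail r)"
        by (rule sum_mono)
      also have "(\<Sum>k\<in>{1..n}. (prob (surv a (k - 1)) - mu a n * tail r) * tail r) = (mu a n - real n * (mu a n * tail r)) * tail r"
        unfolding sum_distrib_right[symmetric] sum_subtractf sum_surv_eq_mu by simp
      finally show ?thesis by (simp add: algebra_simps)
    qed
    moreover have "mu a n * tail r * (1 - real n * tail x) \<le> mu a n * tail r * (1 - real n * tail r)"
      using tail_antimono[OF rx] mu_nonneg[of a n] by (intro mult_left_mono) (auto intro!: mult_left_mono)
    ultimately have "mu a n * tail r * (1 - real n * tail x) \<le> (\<Sum>k\<in>{1..n}. prob (A k))" by linarith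
    then have "(1 - C * (real n * tail x)) * (mu a n * tail r * (1 - real n * tail x)) \<le> (1 - C * (real n * tail x)) * (\<Sum>k\<in>{1..n}. prob (A k))"
      using Cle by (intro mult_left_mono) (auto simp: x_def)
    with 1 show "prob (surv a n) \<ge> mu a n * tail ((1 + d) * (real n * a)) * (1 - real n * tail (real n * a)) * (1 - C * (real n * tail (real n * a)))"
      by (simp add: r_def x_def mult_ac)
  qed
qed


text \<open>Stop the walk at the first passage above the low level \<open>\<theta> x\<close>, but not later than at time
  \<open>m\<close>. Surviving until then without a jump of size \<open>\<theta> x\<close> costs a factor \<open>mu a n / n\<close>, and the
  remaining climb costs two further unlikely events; if the level is passed by a jump of size
  \<open>\<theta> x\<close>, this jump and the remaining climb are the two unlikely events.\<close>

lemma surv_small_jumps_bound: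
  assumes d: "0 < d" "d < 1"
  obtains C y h0 N where "C > 0" "y > 0" "h0 > 0"
    "\<And>a n. a > 0 \<Longrightarrow> n \<ge> N \<Longrightarrow> real n * a \<ge> y \<Longrightarrow> real n * tail (real n * a) \<le> h0 \<Longrightarrow>
       prob (surv a n \<inter> {\<omega> \<in> space M. \<forall>i\<in>{..<n}. step i \<omega> < (1 - d) * (real n * a)})
         \<le> C * (real n * tail (real n * a)) * (mu a n * tail (real n * a))"
proof -
  \<comment> \<open>Small enough that the height \<open>2 * \<theta> * x\<close> together with a
    drift of \<open>\<theta> / 2 * x\<close> up to the stopping time stays below
    \<open>d / 2 * x\<close>.\<close>
  define \<theta> where "\<theta> = d / 8"
  have \<theta>: "\<theta> > 0" "\<theta> < 1 / 8" using d by (simp_all add: \<theta>_def)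
  obtain C1 y1 where C1: "C1 > 0" "y1 > 0"
    "\<And>x k m. x \<ge> y1 \<Longrightarrow> prob {\<omega> \<in> space M. \<exists>j\<in>{..m}. \<theta> / 2 * x \<le> \<bar>block k j \<omega>\<bar>} \<le> C1 * (real m * tail x)"
    using block_max_bound[of "\<theta> / 2"] \<theta> by auto
  obtain C2 y2 where C2: "C2 > 0" "y2 > 0"
    "\<And>x k m. x \<ge> y2 \<Longrightarrow> prob {\<omega> \<in> space M. \<exists>j\<in>{..m}. d / 2 * x \<le> \<bar>block k j \<omega>\<bar>} \<le> C2 * (real m * tail x)"
    using block_max_bound[of "d / 2"] d by auto
  obtain C3 y3 where C3: "C3 > 0" "y3 > 0"
    "\<And>x k m. x \<ge> y3 \<Longrightarrow> prob {\<omega> \<in> space M. (\<exists>j\<in>{..m}. x \<le> block k j \<omega>) \<and> (\<forall>i\<in>{k..<k + m}. step i \<omega> < (1 - d / 2) * x)}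
       \<le> C3 * (real m * tail x)\<^sup>2"
    using two_jumps_bound[of "d / 2"] d by auto
  obtain D4 y4 where D4: "D4 > 0" "y4 > 0" "\<And>x. x \<ge> y4 \<Longrightarrow> tail (\<theta> * x) \<le> D4 * tail x"
    using tail_scale[OF \<theta>(1)] by auto
  obtain D5 y5 where D5: "D5 > 0" "y5 > 0" "\<And>x. x \<ge> y5 \<Longrightarrow> tail ((1 - d / 2) * x) \<le> D5 * tail x"
    using tail_scale[of "1 - d / 2"] d by auto
  \<comment> \<open>Ensures \<open>C1 * h \<le> 1 / 2\<close>, so that fluctuations of size
    \<open>\<theta> / 2 * x\<close> up to time \<open>m\<close> have probability at most one
    half.\<close>
  define h0 where "h0 = 1 / (2 * C1)"
  \<comment> \<open>From here on \<open>\<theta> * n / 4 \<ge> 1\<close>, so rounding down in the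
    choice of \<open>m\<close> costs at most a factor 2.\<close>
  define N where "N = nat \<lceil>4 / \<theta>\<rceil>"
  define y where "y = max (max y1 y2) (max (max y4 y5) (2 * y3))"
  \<comment> \<open>\<open>12 / \<theta>\<close> is three times \<open>4 / \<theta>\<close>: the
    stopping events have total probability at most \<open>3 * prob (surv a m)\<close>, and
    \<open>prob (surv a m)\<close> is at most \<open>4 / (\<theta> * n) * mu a n\<close>.\<close>
  define C where "C = C3 * D5\<^sup>2 * (12 / \<theta>) + C2 * D4"
  show thesis
  proof (rule that[of C y h0 N])
    show "C > 0" "y > 0" "h0 > 0"
      using C1 C2 C3 D4 D5 \<theta> by (auto simp: C_def y_def h0_def intro!: add_pos_pos)
    fix a n assume a: "a > 0" and n: "n \<ge> N" and y: "real n * a \<ge> y" and h: "real n * tail (real n * a) \<le> h0"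
    define x where "x = real n * a"
    have ys: "x \<ge> y1" "x \<ge> y2" "x \<ge> y4" "x \<ge> y5" "x \<ge> 2 * y3" using y by (auto simp: y_def x_def)
    have xp: "x > 0" using ys C1 by linarith
    have n4: "real n \<ge> 4 / \<theta>"
    proof -
      have "4 / \<theta> \<le> real (nat \<lceil>4 / \<theta>\<rceil>)" by (rule real_nat_ceiling_ge)
      also have "\<dots> \<le> real n" using n by (simp add: N_def)
      finally show ?thesis .
    qed
    have "4 / \<theta> > 0" using \<theta> by simp
    with n4 have np: "real n > 0" by linarith
    \<comment> \<open>A fixed fraction of \<open>n\<close>, so that Markov's inequality still gives
      the order \<open>mu a n / n\<close>, yet so small that the drift up to time \<open>m\<close>
      is at most \<open>\<theta> / 2 * x\<close>.\<close>
    define m where "m = nat \<lfloor>\<theta> * real n / 2\<rfloor>"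
    have z0: "0 \<le> \<theta> * real n / 2" using \<theta> np by simp
    have m1: "real m \<le> \<theta> * real n / 2" unfolding m_def by (rule of_nat_floor[OF z0])
    have n1: "\<theta> * real n / 4 \<ge> 1" using n4 \<theta> by (simp add: field_simps)
    have m2: "\<theta> * real n / 4 \<le> real m"
    proof -
      have "real m = of_int \<lfloor>\<theta> * real n / 2\<rfloor>" unfolding m_def using z0 by (intro of_nat_nat) simp
      moreover have "\<theta> * real n / 2 < of_int \<lfloor>\<theta> * real n / 2\<rfloor> + 1" by (rule real_of_int_floor_add_one_gt)
      ultimately show ?thesis using n1 by linarith
    qed
    have mp: "real m > 0" using m2 n1 by linarith
    have mn: "m \<le> n"
    proof -
      have "\<theta> * real n / 2 \<le> real n" using \<theta> np by simp
      then show ?thesis using m1 by linarith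
    qed
    have ma: "real m * a \<le> \<theta> / 2 * x"
      using mult_right_mono[OF m1, of a] a by (simp add: x_def algebra_simps)
    \<comment> \<open>The level is raised by \<open>k * a\<close>: what is recorded is the first
      passage of the walk with drift above \<open>\<theta> * x\<close>.\<close>
    define Q where "Q k = surv a k \<inter> {\<omega> \<in> space M. (\<theta> * x + real k * a \<le> block 0 k \<omega>) \<and> (\<forall>i\<in>{1..<k}. block 0 i \<omega> < \<theta> * x + real i * a)}" for k
    have Qinfo: "Q k \<in> sets (info {..<k})" for k
      unfolding Q_def by (intro sets.Int surv_info info_conj info_Ball block_pred_info) auto
    have Qdis: "disjoint_family_on Q {1..m}"
    proof -
      have *: "Q k \<inter> Q l = {}" if "k < l" "k \<ge> 1" for k l
      proof (rule equals0I)
        fix \<omega> assume "\<omega> \<in> Q k \<inter> Q l"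
        then have "\<theta> * x + real k * a \<le> block 0 k \<omega>" "block 0 k \<omega> < \<theta> * x + real k * a"
          using that unfolding Q_def by auto
        then show False by simp
      qed
      show ?thesis unfolding disjoint_family_on_def using * by (metis Int_commute atLeastAtMost_iff linorder_neqE_nat)
    qed
    have Qsum: "(\<Sum>k\<in>{1..m}. prob (Q k)) \<le> 2 * prob (surv a m)"
    proof -
      define B where "B k = {\<omega> \<in> space M. \<forall>j\<in>{..m}. \<bar>block k j \<omega>\<bar> < \<theta> / 2 * x}" for k
      have "1 / 2 * (\<Sum>k\<in>{1..m}. prob (Q k)) \<le> prob (surv a m)"
      proof (rule prob_stopping_ge[where A = Q and B = B and t = "\<lambda>k. k"])
        show "B k \<in> sets (info {k..})" for k unfolding B_def by (intro info_Ball block_pred_info) auto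
        fix k assume k: "k \<in> {1..m}"
        have "prob (B k) = 1 - prob {\<omega> \<in> space M. \<exists>j\<in>{..m}. \<theta> / 2 * x \<le> \<bar>block k j \<omega>\<bar>}"
          unfolding B_def by (rule prob_block_max_compl)
        moreover have "prob {\<omega> \<in> space M. \<exists>j\<in>{..m}. \<theta> / 2 * x \<le> \<bar>block k j \<omega>\<bar>} \<le> C1 * (real m * tail x)"
          using C1(3) ys by auto
        moreover have "C1 * (real m * tail x) \<le> C1 * h0"
          using h mn C1 by (intro mult_left_mono order.trans[OF mult_right_mono h[folded x_def]]) auto
        moreover have "C1 * h0 = 1 / 2" using C1 by (simp add: h0_def)
        ultimately show "1 / 2 \<le> prob (B k)" by linarith
        show "Q k \<inter> B k \<subseteq> surv a m"
        proof
          fix \<omega> assume \<omega>: "\<omega> \<in> Q k \<inter> B k"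
          have "real i * a \<le> block 0 i \<omega>" if i: "i \<in> {1..m}" for i
          proof (cases "i \<le> k")
            case True
            then show ?thesis using \<omega> i by (auto simp: Q_def surv_def)
          next
            case False
            then have "block 0 i \<omega> = block 0 k \<omega> + block k (i - k) \<omega>" using block_add[of 0 k "i - k" \<omega>] by simp
            moreover have "\<bar>block k (i - k) \<omega>\<bar> < \<theta> / 2 * x" using \<omega> i by (auto simp: B_def)
            moreover have "\<theta> * x + real k * a \<le> block 0 k \<omega>" using \<omega> by (auto simp: Q_def)
            moreover have "real i * a \<le> real m * a" using i a by (intro mult_right_mono) auto
            moreover have "real k * a \<ge> 0" using a by simp
            moreover have "\<theta> * x = \<theta> / 2 * x + \<theta> / 2 * x" by simp
            ultimately show ?thesis using ma by linarith
          qed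
          then show "\<omega> \<in> surv a m" using \<omega> by (auto simp: surv_def Q_def)
        qed
      qed (use Qinfo Qdis in auto)
      then show ?thesis by simp
    qed
    let ?E = "surv a n \<inter> {\<omega> \<in> space M. \<forall>i\<in>{..<n}. step i \<omega> < (1 - d) * x}"
    \<comment> \<open>Index 0 stands for stopping at the fixed time \<open>m\<close>, an index
      \<open>k \<ge> 1\<close> for a passage at time \<open>k\<close> that does not overshoot
      \<open>2 * \<theta> * x\<close>; \<open>t2\<close> is the corresponding stopping time.\<close>
    define A2 where "A2 k = (if k = 0 then surv a m \<inter> {\<omega> \<in> space M. block 0 m \<omega> < 2 * \<theta> * x + real m * a}
        else Q k \<inter> {\<omega> \<in> space M. block 0 k \<omega> < 2 * \<theta> * x + real k * a})" for k
    define t2 where "t2 k = (if k = 0 then m else k)" for k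
    \<comment> \<open>After a low stop at least \<open>x'\<close> remains to be climbed. Since
      \<open>(1 - d / 2)^2 \<ge> 1 - d\<close>, all steps are below \<open>(1 - d / 2) * x'\<close>,
      and \<open>two_jumps_bound\<close> applies with \<open>d / 2\<close> in place of
      \<open>d\<close>.\<close>
    define x' where "x' = (1 - d / 2) * x"
    have x'y: "x' \<ge> y3"
    proof -
      have "1 / 2 * x \<le> x'" unfolding x'_def using d xp by (intro mult_right_mono) auto
      then show ?thesis using ys by linarith
    qed
    define B2 where "B2 k = {\<omega> \<in> space M. (\<exists>j\<in>{..n - t2 k}. x' \<le> block (t2 k) j \<omega>) \<and> (\<forall>i\<in>{t2 k..<t2 k + (n - t2 k)}. step i \<omega> < (1 - d / 2) * x')}" for k
    define E2 where "E2 = (\<Union>k\<in>{0..m}. A2 k \<inter> B2 k)"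
    \<comment> \<open>Overshooting \<open>2 * \<theta> * x\<close> at the passage requires a step of
      at least \<open>\<theta> * x\<close>. That step is still below \<open>(1 - d) * x\<close>, so
      at least \<open>d / 2 * x\<close> remains to be climbed, the event \<open>B1\<close>.\<close>
    define A1 where "A1 k = surv a (k - 1) \<inter> {\<omega> \<in> space M. \<theta> * x \<le> step (k - 1) \<omega>}" for k
    define B1 where "B1 k = {\<omega> \<in> space M. \<exists>j\<in>{..n}. d / 2 * x \<le> \<bar>block k j \<omega>\<bar>}" for k
    define E1 where "E1 = (\<Union>k\<in>{1..m}. A1 k \<inter> B1 k)"
    have A1info: "A1 k \<in> sets (info {..<k})" if "k \<ge> 1" for k
    proof -
      have "surv a (k - 1) \<in> sets (info {..<k})"
        unfolding surv_def using that by (intro info_Ball block_pred_info) auto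
      then show ?thesis unfolding A1_def using that by (intro sets.Int step_pred_info) auto
    qed
    have B1info: "B1 k \<in> sets (info {k..})" for k unfolding B1_def by (intro info_Bex block_pred_info) auto
    have A2info: "A2 k \<in> sets (info {..<t2 k})" for k
      unfolding A2_def t2_def by (auto intro!: sets.Int surv_info Qinfo block_pred_info)
    have B2info: "B2 k \<in> sets (info {t2 k..})" for k
      unfolding B2_def by (intro info_conj info_Bex info_Ball block_pred_info step_pred_info) auto
    have t2m: "t2 k \<le> m" if "k \<le> m" for k using that by (simp add: t2_def)
    have E1: "prob E1 \<le> C2 * (real n * tail x) * (mu a n * (D4 * tail x))"
    proof -
      have "prob E1 \<le> C2 * (real n * tail x) * (\<Sum>k\<in>{1..m}. prob (A1 k))"
        by (rule prob_stopping_le[where A = A1 and B = B1 and t = "\<lambda>k. k"])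
           (use A1info B1info C2(3) ys in \<open>auto simp: E1_def B1_def\<close>)
      also have "\<dots> \<le> C2 * (real n * tail x) * (mu a n * (D4 * tail x))"
      proof (intro mult_left_mono)
        have "(\<Sum>k\<in>{1..m}. prob (A1 k)) = (\<Sum>k\<in>{1..m}. prob (surv a (k - 1)) * tail (\<theta> * x))"
          unfolding A1_def by (intro sum.cong prob_surv_jump) auto
        also have "\<dots> = mu a m * tail (\<theta> * x)" unfolding sum_distrib_right[symmetric] sum_surv_eq_mu by simp
        also have "\<dots> \<le> mu a n * (D4 * tail x)"
          using D4(3)[of x] ys mu_mono[OF mn] mu_nonneg by (intro mult_mono) auto
        finally show "(\<Sum>k\<in>{1..m}. prob (A1 k)) \<le> mu a n * (D4 * tail x)" .
      qed (use C2 in auto)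
      finally show ?thesis .
    qed
    have E2: "prob E2 \<le> C3 * (D5 * (real n * tail x))\<^sup>2 * (3 * prob (surv a m))"
    proof -
      have "prob E2 \<le> C3 * (D5 * (real n * tail x))\<^sup>2 * (\<Sum>k\<in>{0..m}. prob (A2 k))"
      proof (rule prob_stopping_le[where A = A2 and B = B2 and t = t2])
        fix k assume "k \<in> {0..m}"
        have "prob (B2 k) \<le> C3 * (real (n - t2 k) * tail x')\<^sup>2" unfolding B2_def by (rule C3(3)[OF x'y])
        also have "\<dots> \<le> C3 * (real n * (D5 * tail x))\<^sup>2"
          using C3(1) D5(3)[of x] ys unfolding x'_def by (intro mult_left_mono power_mono mult_mono) auto
        finally show "prob (B2 k) \<le> C3 * (D5 * (real n * tail x))\<^sup>2" by (simp add: mult_ac)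
      qed (use A2info B2info in \<open>auto simp: E2_def\<close>)
      also have "\<dots> \<le> C3 * (D5 * (real n * tail x))\<^sup>2 * (3 * prob (surv a m))"
      proof (intro mult_left_mono)
        have "(\<Sum>k\<in>{0..m}. prob (A2 k)) = prob (A2 0) + (\<Sum>k\<in>{1..m}. prob (A2 k))"
          by (simp add: sum.atLeast_Suc_atMost)
        also have "\<dots> \<le> prob (surv a m) + (\<Sum>k\<in>{1..m}. prob (Q k))"
          by (intro add_mono sum_mono finite_measure_mono) (auto simp: A2_def intro: info_events[OF Qinfo])
        finally show "(\<Sum>k\<in>{0..m}. prob (A2 k)) \<le> 3 * prob (surv a m)" using Qsum by linarith
      qed (use C3 in auto)
      finally show ?thesis .
    qed
    have sub: "?E \<subseteq> E2 \<union> E1"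
    proof
      fix \<omega> assume \<omega>: "\<omega> \<in> ?E"
      then have sp: "\<omega> \<in> space M" by simp
      have jump: "step i \<omega> < (1 - d) * x" if "i < n" for i using \<omega> that by auto
      have Sn: "x \<le> block 0 n \<omega>" using surv_block_ge[of \<omega> a n n] \<omega> by (simp add: x_def)
      have rest: "block 0 n \<omega> = block 0 k \<omega> + block k (n - k) \<omega>" if "k \<le> n" for k
        using block_add[of 0 k "n - k" \<omega>] that by simp
      have km: "real k * a \<le> \<theta> / 2 * x" if "k \<le> m" for k
        using that a by (intro order.trans[OF mult_right_mono ma]) auto
      have inB2: "\<omega> \<in> B2 k" if k: "k \<le> m" "block 0 (t2 k) \<omega> < 2 * \<theta> * x + real (t2 k) * a" for k
      proof -
        have t: "t2 k \<le> m" "t2 k \<le> n" using t2m k mn by (auto intro: order.trans)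
        have "5 / 2 * \<theta> * x \<le> d / 2 * x" using xp d by (intro mult_right_mono) (auto simp: \<theta>_def)
        then have 1: "x' \<le> block (t2 k) (n - t2 k) \<omega>"
          using Sn rest[OF t(2)] k(2) km[OF t(1)] unfolding x'_def by (simp add: algebra_simps)
        have "(1 - d / 2) * x' = (1 - d) * x + (d / 2)\<^sup>2 * x" by (simp add: x'_def field_simps power2_eq_square)
        moreover have "0 \<le> (d / 2)\<^sup>2 * x" using xp by simp
        ultimately have xx: "(1 - d) * x \<le> (1 - d / 2) * x'" by linarith
        have 2: "\<forall>i\<in>{t2 k..<t2 k + (n - t2 k)}. step i \<omega> < (1 - d / 2) * x'"
        proof
          fix i assume "i \<in> {t2 k..<t2 k + (n - t2 k)}"
          then have "i < n" using t(2) by simp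
          from less_le_trans[OF jump[OF this] xx] show "step i \<omega> < (1 - d / 2) * x'" .
        qed
        show ?thesis
          unfolding B2_def by (rule CollectI, intro conjI, rule sp, rule bexI[of _ "n - t2 k"], rule 1, simp, rule 2)
      qed
      define P where "P k \<longleftrightarrow> k \<ge> 1 \<and> \<theta> * x + real k * a \<le> block 0 k \<omega>" for k
      show "\<omega> \<in> E2 \<union> E1"
      proof (cases "\<exists>k\<le>m. P k")
        case False
        then have "block 0 m \<omega> < \<theta> * x + real m * a" using mp by (auto simp: P_def not_le)
        moreover have "0 \<le> \<theta> * x" using \<theta> xp by simp
        ultimately have s: "block 0 m \<omega> < 2 * \<theta> * x + real m * a" by simp
        have "\<omega> \<in> surv a m" using \<omega> surv_antimono[OF mn] by auto
        then have "\<omega> \<in> A2 0" using s sp by (simp add: A2_def)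
        moreover have "\<omega> \<in> B2 0" using s by (intro inB2) (auto simp: t2_def)
        ultimately show ?thesis by (auto simp: E2_def)
      next
        case True
        then obtain l where l: "l \<le> m" "P l" by auto
        define k where "k = (LEAST k. P k)"
        have Pk: "P k" unfolding k_def using l(2) by (rule LeastI[of P])
        have k: "k \<le> m" "k \<ge> 1" using l Least_le[of P, OF l(2)] Pk by (auto simp: k_def P_def)
        have min: "block 0 i \<omega> < \<theta> * x + real i * a" if "i \<ge> 1" "i < k" for i
          using not_less_Least[of i P] that by (auto simp: k_def P_def)
        have "\<omega> \<in> surv a k" using \<omega> surv_antimono[of k n a] k mn by auto
        then have Qk: "\<omega> \<in> Q k" using Pk min sp by (auto simp: Q_def P_def)
        show ?thesis
        proof (cases "block 0 k \<omega> < 2 * \<theta> * x + real k * a")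
          case True
          then have "\<omega> \<in> A2 k" using Qk sp k by (simp add: A2_def)
          moreover have "\<omega> \<in> B2 k" using True k by (intro inB2) (auto simp: t2_def)
          ultimately show ?thesis using k by (auto simp: E2_def)
        next
          case False
          have prev: "block 0 (k - 1) \<omega> < \<theta> * x + real (k - 1) * a"
          proof (cases "k = 1")
            case True
            then show ?thesis using \<theta> xp by (simp add: block_def)
          next
            case False
            then show ?thesis using k by (intro min) auto
          qed
          have split: "block 0 k \<omega> = block 0 (k - 1) \<omega> + step (k - 1) \<omega>"
            using block_Suc[of 0 "k - 1" \<omega>] k by simp
          have ka: "real k * a = real (k - 1) * a + a" using k by (simp add: of_nat_diff algebra_simps)
          have big: "\<theta> * x \<le> step (k - 1) \<omega>" using False prev split ka a by linarith
          have "k - 1 \<le> n" using k mn by simp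
          then have "\<omega> \<in> surv a (k - 1)" using subsetD[OF surv_antimono[of "k - 1" n a]] \<omega> by blast
          then have "\<omega> \<in> A1 k" using big sp by (simp add: A1_def)
          moreover have "\<omega> \<in> B1 k"
          proof -
            have "step (k - 1) \<omega> < (1 - d) * x" using k mn by (intro jump) auto
            then have "block 0 k \<omega> < \<theta> * x + \<theta> / 2 * x + (1 - d) * x" using prev split km[of "k - 1"] k by linarith
            then have "x - (\<theta> * x + \<theta> / 2 * x + (1 - d) * x) \<le> block k (n - k) \<omega>"
              using Sn rest[of k] k mn by linarith
            moreover have "3 / 2 * \<theta> * x \<le> d / 2 * x" using xp d by (intro mult_right_mono) (auto simp: \<theta>_def)
            ultimately have "d / 2 * x \<le> block k (n - k) \<omega>" by (simp add: algebra_simps)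
            then show ?thesis using sp unfolding B1_def by (auto intro!: bexI[of _ "n - k"])
          qed
          ultimately show ?thesis using k by (auto simp: E1_def)
        qed
      qed
    qed
    have ev: "E1 \<in> events" "E2 \<in> events"
      unfolding E1_def E2_def
      using info_events[OF A1info] info_events[OF B1info] info_events[OF A2info] info_events[OF B2info] by auto
    have "prob ?E \<le> prob (E2 \<union> E1)" using sub ev by (intro finite_measure_mono) auto
    also have "\<dots> \<le> prob E2 + prob E1" using ev by (intro measure_Un_le) auto
    \<comment> \<open>With \<open>h = n * tail x\<close> the first term is of order
      \<open>h^2 * mu a n / n\<close>, that is \<open>h * (mu a n * tail x)\<close>, the same order
      as the second.\<close>
    also have "\<dots> \<le> C3 * (D5 * (real n * tail x))\<^sup>2 * (3 * (4 / (\<theta> * real n) * mu a n)) + C2 * (real n * tail x) * (mu a n * (D4 * tail x))"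
    proof (intro add_mono order.trans[OF E2] mult_left_mono E1)
      have "prob (surv a m) \<le> mu a n / real m"
        using prob_surv_le_mu[OF mn, of a] mp by (simp add: field_simps)
      also have "\<dots> \<le> mu a n / (\<theta> * real n / 4)"
        using m2 mp \<theta> np mu_nonneg by (intro divide_left_mono) auto
      finally show "prob (surv a m) \<le> 4 / (\<theta> * real n) * mu a n" by (simp add: field_simps)
    qed (use C3 in auto)
    also have "\<dots> = C * (real n * tail x) * (mu a n * tail x)"
      using np \<theta> by (simp add: C_def field_simps power2_eq_square)
    finally show "prob (surv a n \<inter> {\<omega> \<in> space M. \<forall>i\<in>{..<n}. step i \<omega> < (1 - d) * (real n * a)})
         \<le> C * (real n * tail (real n * a)) * (mu a n * tail (real n * a))"
      by (simp add: x_def)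
  qed
qed

text \<open>A step of size \<open>(1 - d) * n * a\<close> before the exit is charged by the union
  bound over its time; all other surviving paths belong to the small-jump case.\<close>

lemma upper_bound:
  assumes d: "0 < d" "d < 1"
  obtains C y h0 N where "C > 0" "y > 0" "h0 > 0"
    "\<And>a n. a > 0 \<Longrightarrow> n \<ge> N \<Longrightarrow> real n * a \<ge> y \<Longrightarrow> real n * tail (real n * a) \<le> h0 \<Longrightarrow>
       prob (surv a n) \<le> mu a n * (tail ((1 - d) * (real n * a)) + C * (real n * tail (real n * a)) * tail (real n * a))"
proof (rule surv_small_jumps_bound[OF d])
  fix C y h0 N assume C: "C > 0" "y > 0" "h0 > 0" and
    b: "\<And>a n. a > 0 \<Longrightarrow> n \<ge> N \<Longrightarrow> real n * a \<ge> y \<Longrightarrow> real n * tail (real n * a) \<le> h0 \<Longrightarrow>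
       prob (surv a n \<inter> {\<omega> \<in> space M. \<forall>i\<in>{..<n}. step i \<omega> < (1 - d) * (real n * a)})
         \<le> C * (real n * tail (real n * a)) * (mu a n * tail (real n * a))"
  show thesis
  proof (rule that[OF C, of N])
    fix a n assume *: "a > 0" "n \<ge> N" "real n * a \<ge> y" "real n * tail (real n * a) \<le> h0"
    define r where "r = (1 - d) * (real n * a)"
    let ?E = "surv a n \<inter> {\<omega> \<in> space M. \<forall>i\<in>{..<n}. step i \<omega> < r}"
    let ?J = "{\<omega> \<in> space M. \<exists>k\<in>{1..n}. \<omega> \<in> surv a (k - 1) \<and> r \<le> step (k - 1) \<omega>}"
    have "surv a n \<subseteq> ?E \<union> ?J"
    proof
      fix \<omega> assume \<omega>: "\<omega> \<in> surv a n"
      then have sp: "\<omega> \<in> space M" by (simp add: surv_def)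
      show "\<omega> \<in> ?E \<union> ?J"
      proof (cases "\<forall>i\<in>{..<n}. step i \<omega> < r")
        case False
        then obtain i where i: "i < n" "r \<le> step i \<omega>" by (auto simp: not_less)
        then have "\<omega> \<in> surv a i" using surv_antimono[of i n a] \<omega> by auto
        then have "\<omega> \<in> ?J" using sp i by (auto intro!: bexI[of _ "Suc i"])
        then show ?thesis by simp
      qed (use \<omega> sp in auto)
    qed
    then have "prob (surv a n) \<le> prob (?E \<union> ?J)" by (intro finite_measure_mono) auto
    also have "\<dots> \<le> prob ?E + prob ?J" by (rule measure_Un_le) auto
    also have "prob ?J \<le> mu a n * tail r" by (rule prob_surv_ex_jump_le)
    also have "prob ?E \<le> C * (real n * tail (real n * a)) * (mu a n * tail (real n * a))"
      unfolding r_def using * by (rule b)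
    finally show "prob (surv a n) \<le> mu a n * (tail ((1 - d) * (real n * a)) + C * (real n * tail (real n * a)) * tail (real n * a))"
      by (simp add: r_def algebra_simps)
  qed
qed

end

section \<open>Mean exit time and norming constants\<close>

context heavy_walk
begin

section \<open>Sums of tails and the growth of the truncated mean\<close>

lemma X_part_integrable: "integrable M (\<lambda>\<omega>. indicator {\<omega> \<in> space M. x \<le> \<bar>X \<omega>\<bar>} \<omega> * \<bar>X \<omega>\<bar>)"
  by (rule Bochner_Integration.integrable_bound[OF integrable_abs[OF X_int]]) (auto simp: indicator_def)

lemma tail_eq_integral: "tail x = (\<integral>\<omega>. indicator {\<omega> \<in> space M. x \<le> X \<omega>} \<omega> \<partial>M)"
  by (simp add: tail_def)

text \<open>Pointwise, \<open>a\<close> times the number of \<open>i \<ge> n\<close> with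
  \<open>i * a \<le> X\<close> is at most \<open>X\<close>, and it is 0 unless
  \<open>X \<ge> n * a\<close>. Taking expectations reduces the sum to the tail expectation bounded
  by \<open>first\<close>.\<close>

lemma sum_tail_le:
  assumes a: "a > 0" and n: "n \<ge> 1" and y: "real n * a \<ge> x0"
  shows "(\<Sum>i\<in>{n..<j}. tail (real i * a)) \<le> c * (real n * tail (real n * a))"
proof -
  have pw: "(\<Sum>i\<in>{n..<j}. a * indicator {\<omega> \<in> space M. real i * a \<le> X \<omega>} \<omega>) \<le> indicator {\<omega> \<in> space M. real n * a \<le> \<bar>X \<omega>\<bar>} \<omega> * \<bar>X \<omega>\<bar>"
    if sp: "\<omega> \<in> space M" for \<omega>
  proof (cases "real n * a \<le> X \<omega>")
    case True
    have "{i \<in> {n..<j}. real i * a \<le> X \<omega>} \<subseteq> {1..nat \<lfloor>X \<omega> / a\<rfloor>}"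
    proof
      fix i assume i: "i \<in> {i \<in> {n..<j}. real i * a \<le> X \<omega>}"
      then have "real i \<le> X \<omega> / a" using a by (simp add: field_simps)
      then have "i \<le> nat \<lfloor>X \<omega> / a\<rfloor>" by (rule le_nat_floor)
      then show "i \<in> {1..nat \<lfloor>X \<omega> / a\<rfloor>}" using i n by auto
    qed
    then have "card {i \<in> {n..<j}. real i * a \<le> X \<omega>} \<le> nat \<lfloor>X \<omega> / a\<rfloor>"
      using card_mono[of "{1..nat \<lfloor>X \<omega> / a\<rfloor>}"] by force
    moreover have "real n * a \<ge> 0" using a by simp
    then have "0 \<le> X \<omega> / a" using True a by (intro divide_nonneg_pos order.trans[OF _ True]) auto
    then have "real (nat \<lfloor>X \<omega> / a\<rfloor>) \<le> X \<omega> / a" by (rule of_nat_floor)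
    ultimately have cd: "real (card {i \<in> {n..<j}. real i * a \<le> X \<omega>}) \<le> X \<omega> / a" by linarith
    have "(\<Sum>i\<in>{n..<j}. a * indicator {\<omega> \<in> space M. real i * a \<le> X \<omega>} \<omega>) = a * (\<Sum>i\<in>{n..<j}. if real i * a \<le> X \<omega> then 1 else 0)"
      unfolding sum_distrib_left using sp by (intro sum.cong) (auto simp: indicator_def)
    also have "(\<Sum>i\<in>{n..<j}. if real i * a \<le> X \<omega> then 1 else 0) = real (card {i \<in> {n..<j}. real i * a \<le> X \<omega>})"
      by (subst sum.inter_filter[symmetric]) auto
    also have "a * real (card {i \<in> {n..<j}. real i * a \<le> X \<omega>}) \<le> a * (X \<omega> / a)"
      using cd a by (intro mult_left_mono) auto
    also have "\<dots> \<le> indicator {\<omega> \<in> space M. real n * a \<le> \<bar>X \<omega>\<bar>} \<omega> * \<bar>X \<omega>\<bar>"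
      using True sp a by (auto simp: indicator_def)
    finally show ?thesis .
  next
    case False
    have "\<not> real i * a \<le> X \<omega>" if "i \<ge> n" for i
    proof -
      have "real n * a \<le> real i * a" using that a by (intro mult_right_mono) auto
      then show ?thesis using False by linarith
    qed
    then show ?thesis by (auto simp: indicator_def intro!: sum_nonpos)
  qed
  have ii: "integrable M (\<lambda>\<omega>. a * indicator {\<omega> \<in> space M. real i * a \<le> X \<omega>} \<omega>)" for i
    by (intro integrable_mult_right integrable_real_indicator) (auto simp: less_top[symmetric])
  have "a * (\<Sum>i\<in>{n..<j}. tail (real i * a)) = (\<Sum>i\<in>{n..<j}. (\<integral>\<omega>. a * indicator {\<omega> \<in> space M. real i * a \<le> X \<omega>} \<omega> \<partial>M))"
    by (simp add: sum_distrib_left tail_eq_integral)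
  also have "\<dots> = (\<integral>\<omega>. (\<Sum>i\<in>{n..<j}. a * indicator {\<omega> \<in> space M. real i * a \<le> X \<omega>} \<omega>) \<partial>M)"
    by (rule Bochner_Integration.integral_sum[symmetric]) (rule ii)
  also have "\<dots> \<le> (\<integral>\<omega>. indicator {\<omega> \<in> space M. real n * a \<le> \<bar>X \<omega>\<bar>} \<omega> * \<bar>X \<omega>\<bar> \<partial>M)"
    by (intro integral_mono X_part_integrable Bochner_Integration.integrable_sum ii pw)
  also have "\<dots> \<le> c * (real n * a) * tail (real n * a)"
    using first[OF y] by (simp add: tail_def)
  finally have "a * (\<Sum>i\<in>{n..<j}. tail (real i * a)) \<le> a * (c * (real n * tail (real n * a)))"
    by (simp add: mult_ac)
  then show ?thesis using a by simp
qed

text \<open>\<open>tail (j * a)\<close> does not exceed any of the summands, so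
  \<open>(j - n) * tail (j * a)\<close> is below the sum. Hence a smallness condition on
  \<open>h\<close> imposed at \<open>n\<close> persists at all later times up to the factor
  \<open>c + 1\<close>.\<close>

lemma mult_tail_le:
  assumes a: "a > 0" and n: "n \<ge> 1" and y: "real n * a \<ge> x0" and j: "j \<ge> n"
  shows "real j * tail (real j * a) \<le> (c + 1) * (real n * tail (real n * a))"
proof -
  have "(\<Sum>i\<in>{n..<j}. tail (real j * a)) \<le> (\<Sum>i\<in>{n..<j}. tail (real i * a))"
    using a by (intro sum_mono tail_antimono mult_right_mono) auto
  also have "\<dots> \<le> c * (real n * tail (real n * a))" by (rule sum_tail_le[OF a n y])
  finally have "(real j - real n) * tail (real j * a) \<le> c * (real n * tail (real n * a))"
    using j by (simp add: of_nat_diff)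
  moreover have "real n * tail (real j * a) \<le> real n * tail (real n * a)"
    using a j by (intro mult_left_mono tail_antimono mult_right_mono) auto
  ultimately show ?thesis by (simp add: algebra_simps)
qed

text \<open>Only the order of the tail matters here, so \<open>d = 1/2\<close> is enough, dominated
  variation absorbing the factor in the argument. The bound is uniform in \<open>j\<close> and its
  exponent vanishes with \<open>h\<close>, so it yields both finiteness of the mean and its
  asymptotics.\<close>

lemma mu_growth_bound:
  obtains K y h0 N where "K > 0" "y > 0" "h0 > 0"
    "\<And>a n j. a > 0 \<Longrightarrow> n \<ge> N \<Longrightarrow> n \<ge> 1 \<Longrightarrow> real n * a \<ge> y \<Longrightarrow> real n * tail (real n * a) \<le> h0 \<Longrightarrow> j \<ge> n \<Longrightarrow>
       mu a j \<le> mu a n * exp (K * (real n * tail (real n * a)))"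
proof (rule upper_bound[of "1/2"])
  fix C y h0 N assume C: "C > 0" "y > 0" "h0 > 0"
    and b: "\<And>a n. a > 0 \<Longrightarrow> n \<ge> N \<Longrightarrow> real n * a \<ge> y \<Longrightarrow> real n * tail (real n * a) \<le> h0 \<Longrightarrow>
       prob (surv a n) \<le> mu a n * (tail ((1 - 1/2) * (real n * a)) + C * (real n * tail (real n * a)) * tail (real n * a))"
  obtain D y' where D: "D > 0" "y' > 0" "\<And>x. x \<ge> y' \<Longrightarrow> tail ((1/2) * x) \<le> D * tail x"
    by (rule tail_scale[of "1/2"]) auto
  define K0 where "K0 = D + C * h0"
  have K0: "K0 > 0" using D C by (auto simp: K0_def intro!: add_pos_pos)
  \<comment> \<open>The threshold is divided by \<open>c + 1\<close> so that
    \<open>upper_bound\<close>, with threshold \<open>h0\<close>, remains applicable at every later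
    time \<open>j\<close>.\<close>
  show thesis
  proof (rule that[of "K0 * c" "max (max y y') x0" "h0 / (c + 1)" N])
    show "K0 * c > 0" "max (max y y') x0 > 0" "h0 / (c + 1) > 0" using K0 c C by auto
    fix a n j assume a: "a > 0" and n: "n \<ge> N" "n \<ge> 1" and y: "real n * a \<ge> max (max y y') x0"
      and h: "real n * tail (real n * a) \<le> h0 / (c + 1)" and j: "j \<ge> n"
    have "mu a j \<le> mu a n * exp (K0 * (\<Sum>i\<in>{n..<j}. tail (real i * a)))"
      using j
    proof (induction j rule: dec_induct)
      case (step j)
      have ja: "real n * a \<le> real j * a" using step a by (intro mult_right_mono) auto
      have "real j * tail (real j * a) \<le> (c + 1) * (real n * tail (real n * a))"
        using a n y step by (intro mult_tail_le) auto
      also have "\<dots> \<le> h0" using h c by (simp add: field_simps)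
      finally have hj: "real j * tail (real j * a) \<le> h0" .
      have "prob (surv a j) \<le> mu a j * (tail ((1 - 1/2) * (real j * a)) + C * (real j * tail (real j * a)) * tail (real j * a))"
      proof (rule b)
        have "y \<le> real n * a" using y by simp
        then show "y \<le> real j * a" using ja by linarith
      qed (use a n step hj in auto)
      also have "\<dots> \<le> mu a j * (K0 * tail (real j * a))"
      proof (rule mult_left_mono[OF _ mu_nonneg])
        have "tail ((1 - 1/2) * (real j * a)) \<le> D * tail (real j * a)" using D(3)[of "real j * a"] y ja by simp
        moreover have "C * (real j * tail (real j * a)) * tail (real j * a) \<le> C * h0 * tail (real j * a)"
          using hj C by (intro mult_right_mono mult_left_mono) auto
        ultimately show "tail ((1 - 1/2) * (real j * a)) + C * (real j * tail (real j * a)) * tail (real j * a) \<le> K0 * tail (real j * a)"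
          by (simp add: K0_def algebra_simps)
      qed
      finally have "mu a (Suc j) \<le> mu a j * (1 + K0 * tail (real j * a))" by (simp add: mu_def algebra_simps)
      also have "\<dots> \<le> mu a j * exp (K0 * tail (real j * a))"
        by (intro mult_left_mono mu_nonneg exp_ge_add_one_self)
      also have "\<dots> \<le> (mu a n * exp (K0 * (\<Sum>i\<in>{n..<j}. tail (real i * a)))) * exp (K0 * tail (real j * a))"
        by (intro mult_right_mono step.IH) auto
      also have "\<dots> = mu a n * exp (K0 * (\<Sum>i\<in>{n..<Suc j}. tail (real i * a)))"
        using step by (simp add: exp_add distrib_left)
      finally show ?case .
    qed simp
    also have "\<dots> \<le> mu a n * exp (K0 * (c * (real n * tail (real n * a))))"
      using K0 a n y by (intro mult_left_mono mu_nonneg) (auto intro!: mult_left_mono sum_tail_le)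
    finally show "mu a j \<le> mu a n * exp (K0 * c * (real n * tail (real n * a)))" by (simp add: mult_ac)
  qed
qed auto

section \<open>The exit time and its expectation\<close>

lemma walk_eq_block: "walk \<xi> a k \<omega> = block 0 k \<omega> - real k * a"
proof -
  have "(\<Sum>i=1..k. \<xi> i \<omega>) = block 0 k \<omega>"
    unfolding block_def step_def
    by (rule sum.reindex_bij_witness[of _ Suc "\<lambda>i. i - 1"]) auto
  then show ?thesis by (simp add: walk_def sum_subtractf)
qed

lemma exit_time_gt_iff: "enat n < exit_time \<xi> a \<omega> \<longleftrightarrow> (\<forall>k\<in>{1..n}. 0 \<le> walk \<xi> a k \<omega>)"
proof
  assume *: "enat n < exit_time \<xi> a \<omega>"
  show "\<forall>k\<in>{1..n}. 0 \<le> walk \<xi> a k \<omega>"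
  proof (rule ballI, rule ccontr)
    fix k assume k: "k \<in> {1..n}" "\<not> 0 \<le> walk \<xi> a k \<omega>"
    then have "exit_time \<xi> a \<omega> \<le> enat k" unfolding exit_time_def by (intro Inf_lower) auto
    also have "\<dots> \<le> enat n" using k by simp
    finally show False using * by simp
  qed
next
  assume *: "\<forall>k\<in>{1..n}. 0 \<le> walk \<xi> a k \<omega>"
  have "enat (Suc n) \<le> exit_time \<xi> a \<omega>"
    unfolding exit_time_def
  proof (rule Inf_greatest)
    fix y assume "y \<in> enat ` {k. k \<ge> 1 \<and> walk \<xi> a k \<omega> < 0}"
    then obtain k where k: "y = enat k" "k \<ge> 1" "walk \<xi> a k \<omega> < 0" by auto
    then have "\<not> k \<le> n" using * by force
    then show "enat (Suc n) \<le> y" using k by simp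
  qed
  then show "enat n < exit_time \<xi> a \<omega>" by (meson enat_ord_simps(2) lessI less_le_trans)
qed

lemma surv_eq: "surv a n = {\<omega> \<in> space M. enat n < exit_time \<xi> a \<omega>}"
  by (auto simp: surv_def exit_time_gt_iff walk_eq_block)

lemma exit_time_measurable: "exit_time \<xi> a \<in> measurable M (count_space UNIV)"
proof -
  have "exit_time \<xi> a -` {y} \<inter> space M \<in> events" for y
  proof (cases y)
    case (enat m)
    \<comment> \<open>The intersection with \<open>space M\<close> matters for \<open>m = 0\<close>,
      where the indexed intersection is \<open>UNIV\<close>.\<close>
    have "exit_time \<xi> a -` {y} \<inter> space M = (\<Inter>k\<in>{..<m}. surv a k) \<inter> space M - surv a m"
    proof (intro set_eqI iffI)
      fix \<omega> assume *: "\<omega> \<in> (\<Inter>k\<in>{..<m}. surv a k) \<inter> space M - surv a m"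
      have "\<not> exit_time \<xi> a \<omega> < enat m"
      proof
        assume l: "exit_time \<xi> a \<omega> < enat m"
        then obtain k where "exit_time \<xi> a \<omega> = enat k" by (cases "exit_time \<xi> a \<omega>") auto
        with l * show False by (auto simp: surv_eq)
      qed
      then show "\<omega> \<in> exit_time \<xi> a -` {y} \<inter> space M" using * enat by (auto simp: surv_eq)
    qed (auto simp: surv_eq enat)
    then show ?thesis by (cases "m = 0") auto
  next
    case infinity
    have "exit_time \<xi> a -` {y} \<inter> space M = (\<Inter>k. surv a k)"
    proof (intro set_eqI iffI)
      fix \<omega> assume *: "\<omega> \<in> (\<Inter>k. surv a k)"
      have "exit_time \<xi> a \<omega> = y"
      proof (cases "exit_time \<xi> a \<omega>")
        case (enat k)
        have "\<omega> \<in> surv a k" using * by blast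
        then show ?thesis using enat by (simp add: surv_eq)
      qed (use infinity in simp)
      moreover have "\<omega> \<in> space M" using * by (auto simp: surv_eq)
      ultimately show "\<omega> \<in> exit_time \<xi> a -` {y} \<inter> space M" by simp
    qed (auto simp: surv_eq infinity)
    then show ?thesis by auto
  qed
  then show ?thesis by (subst measurable_count_space_eq2_countable) auto
qed

text \<open>The mean is the sum of the probabilities of \<open>\<tau> > k\<close>. The bound
  \<open>B\<close> makes this series summable, so \<open>enn2real\<close> returns its true value and
  not the default 0 for infinity.\<close>

lemma mean_exit_time_bounds:
  assumes "\<And>j. j \<ge> n \<Longrightarrow> mu a j \<le> B"
  shows "mu a n \<le> mean_exit_time M \<xi> a" and "mean_exit_time M \<xi> a \<le> B"
proof -
  let ?p = "\<lambda>k. prob (surv a k)"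
  have le: "(\<Sum>k<j. ?p k) \<le> B" for j
    using assms[of "max n j"] mu_mono[of j "max n j" a] unfolding mu_def by simp
  then have s: "summable ?p" by (intro summableI_nonneg_bounded) auto
  have "(\<integral>\<^sup>+ \<omega>. ennreal_of_enat (exit_time \<xi> a \<omega>) \<partial>M) = (\<Sum>k. emeasure M (surv a k))"
    by (simp add: nn_integral_enat_function[OF exit_time_measurable] surv_eq)
  also have "\<dots> = (\<Sum>k. ennreal (?p k))" by (simp add: emeasure_eq_measure)
  also have "\<dots> = ennreal (\<Sum>k. ?p k)" by (rule suminf_ennreal2) (use s in auto)
  finally have eq: "mean_exit_time M \<xi> a = (\<Sum>k. ?p k)"
    unfolding mean_exit_time_def by (simp add: suminf_nonneg s)
  show "mu a n \<le> mean_exit_time M \<xi> a"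
    unfolding eq mu_def using s by (intro sum_le_suminf) auto
  show "mean_exit_time M \<xi> a \<le> B"
    unfolding eq using s le by (intro suminf_le_const) auto
qed

section \<open>Norming constants compared with the tail\<close>

lemma trunc_moment_eq: "trunc_moment M X u = (\<integral>\<omega>. indicator {\<omega> \<in> space M. \<bar>X \<omega>\<bar> \<le> u} \<omega> * (X \<omega>)\<^sup>2 \<partial>M)"
  by (simp add: trunc_moment_def set_lebesgue_integral_def)

text \<open>The values of \<open>X\<close> between \<open>u / 2\<close> and \<open>u\<close> alone
  contribute \<open>(u / 2)^2 * (tail (u / 2) - tail u)\<close>, and halving keeps this difference
  comparable to \<open>tail u\<close>.\<close>

lemma trunc_moment_ge:
  assumes u: "u > 0" and half: "tail u \<le> 1 / 2 * tail (u / 2)"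
  shows "u\<^sup>2 / 8 * tail u \<le> trunc_moment M X u"
proof -
  let ?I = "\<lambda>r \<omega>. indicator {\<omega> \<in> space M. r \<le> X \<omega>} \<omega> :: real"
  have i: "integrable M (?I r)" for r by (intro integrable_real_indicator) (auto simp: less_top[symmetric])
  have "u\<^sup>2 / 8 * tail u \<le> (u / 2)\<^sup>2 * (tail (u / 2) - tail u)"
  proof -
    have "1 / 2 * tail u \<le> tail (u / 2) - tail u" using half tail_nonneg[of u] by linarith
    then have "(u / 2)\<^sup>2 * (1 / 2 * tail u) \<le> (u / 2)\<^sup>2 * (tail (u / 2) - tail u)" by (intro mult_left_mono) auto
    then show ?thesis by (simp add: power2_eq_square)
  qed
  also have "\<dots> = (\<integral>\<omega>. (u / 2)\<^sup>2 * (?I (u / 2) \<omega> - ?I u \<omega>) \<partial>M)"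
    by (simp only: integral_mult_right_zero Bochner_Integration.integral_diff[OF i i] tail_eq_integral)
  also have "\<dots> \<le> trunc_moment M X u"
    unfolding trunc_moment_eq
  proof (rule integral_mono)
    show "integrable M (\<lambda>\<omega>. (u / 2)\<^sup>2 * (?I (u / 2) \<omega> - ?I u \<omega>))"
      by (intro integrable_mult_right Bochner_Integration.integrable_diff i)
    show "integrable M (\<lambda>\<omega>. indicator {\<omega> \<in> space M. \<bar>X \<omega>\<bar> \<le> u} \<omega> * (X \<omega>)\<^sup>2)"
      by (rule integrable_const_bound[where B = "u\<^sup>2"]) (auto simp: indicator_def abs_le_square_iff[symmetric])
    fix \<omega> assume sp: "\<omega> \<in> space M"
    have "(u / 2)\<^sup>2 \<le> (X \<omega>)\<^sup>2" if "u / 2 \<le> X \<omega>" using that u by (intro power_mono) auto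
    then show "(u / 2)\<^sup>2 * (?I (u / 2) \<omega> - ?I u \<omega>) \<le> indicator {\<omega> \<in> space M. \<bar>X \<omega>\<bar> \<le> u} \<omega> * (X \<omega>)\<^sup>2"
      using sp u by (auto simp: indicator_def)
  qed
  finally show ?thesis .
qed

context
  fixes w :: real
  assumes w: "w > 0" and half: "\<And>x. x \<ge> w \<Longrightarrow> tail (2 * x) \<le> 1 / 2 * tail x" and tail_pos: "\<And>x. tail x > 0"
begin

lemma tail_dyadic: "x \<ge> w \<Longrightarrow> tail (2 ^ k * x) \<le> (1 / 2) ^ k * tail x"
proof (induction k)
  case (Suc k)
  have "1 * x \<le> 2 ^ k * x" using Suc.prems w by (intro mult_right_mono) auto
  then have "tail (2 * (2 ^ k * x)) \<le> 1 / 2 * tail (2 ^ k * x)" using Suc.prems by (intro half) auto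
  also have "\<dots> \<le> 1 / 2 * ((1 / 2) ^ k * tail x)" using Suc by (intro mult_left_mono) auto
  finally show ?case by (simp add: mult_ac)
qed simp

lemma tail_tendsto_0: "(tail \<longlongrightarrow> 0) at_top"
proof (rule order_tendstoI)
  fix e :: real assume e: "0 < e"
  have "(\<lambda>k. (1 / 2) ^ k * tail w) \<longlonglongrightarrow> 0 * tail w" by (intro tendsto_mult LIMSEQ_power_zero tendsto_const) auto
  then have "\<forall>\<^sub>F k in sequentially. (1 / 2) ^ k * tail w < e" using e by (auto dest: order_tendstoD(2))
  then obtain k where k: "(1 / 2) ^ k * tail w < e" by (auto simp: eventually_sequentially)
  show "\<forall>\<^sub>F x in at_top. tail x < e"
    using eventually_ge_at_top[of "2 ^ k * w"]
  proof eventually_elim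
    case (elim x)
    then show ?case using tail_antimono[of "2 ^ k * w" x] tail_dyadic[of w k] k by simp
  qed
next
  fix e :: real assume "e < 0"
  then show "\<forall>\<^sub>F x in at_top. e < tail x" by (auto intro!: always_eventually less_le_trans[OF _ tail_nonneg])
qed

text \<open>By \<open>second\<close> the quotient is at most \<open>c * tail u\<close> for large
  \<open>u\<close>, which tends to 0. Boundedness makes the \<open>Sup\<close> in
  \<open>norming\<close> a genuine upper bound.\<close>

lemma bdd_above_norming_set:
  assumes n: "n \<ge> 1"
  shows "bdd_above {u. u > 0 \<and> trunc_moment M X u / u\<^sup>2 > 1 / real n}"
proof -
  have "\<forall>\<^sub>F u in at_top. tail u < 1 / real n / c"
    using n c by (intro order_tendstoD(2)[OF tail_tendsto_0]) auto
  then obtain B where B: "\<And>u. u \<ge> B \<Longrightarrow> tail u < 1 / real n / c" by (auto simp: eventually_at_top_linorder)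
  have "u \<le> max B x0" if "u > 0" "trunc_moment M X u / u\<^sup>2 > 1 / real n" for u
  proof (rule ccontr)
    assume "\<not> ?thesis"
    then have u: "u \<ge> B" "u \<ge> x0" by auto
    have "trunc_moment M X u \<le> c * u\<^sup>2 * tail u" using second[OF u(2)] by (simp add: trunc_moment_eq tail_def)
    then have "trunc_moment M X u / u\<^sup>2 \<le> c * tail u" using that by (simp add: field_simps)
    also have "\<dots> < 1 / real n"
      using B[OF u(1)] pos_less_divide_eq[OF c, of "tail u" "1 / real n"] by (simp only: mult.commute)
    finally show False using that by simp
  qed
  then show ?thesis by (intro bdd_aboveI[of _ "max B x0"]) auto
qed

text \<open>Above the supremum the quotient of truncated moment and \<open>u^2\<close> is at most
  \<open>1 / n\<close>, and it is at least \<open>tail u / 8\<close>.\<close>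

lemma mult_tail_above_norming:
  assumes n: "n \<ge> 1" and u: "u > norming M X n" "u \<ge> 2 * w"
  shows "real n * tail u \<le> 8"
proof -
  have up: "u > 0" using u w by linarith
  have "u \<notin> {u. u > 0 \<and> trunc_moment M X u / u\<^sup>2 > 1 / real n}"
    using cSup_upper[OF _ bdd_above_norming_set[OF n]] u(1) unfolding norming_def by force
  then have "trunc_moment M X u / u\<^sup>2 \<le> 1 / real n" using up by simp
  moreover have "u\<^sup>2 / 8 * tail u \<le> trunc_moment M X u"
    using half[of "u / 2"] u up by (intro trunc_moment_ge) auto
  then have "tail u / 8 \<le> trunc_moment M X u / u\<^sup>2" using up by (simp add: field_simps)
  ultimately have "tail u / 8 \<le> 1 / real n" by linarith
  then show ?thesis using n by (simp add: field_simps)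
qed

lemma norming_at_top: "filterlim (norming M X) at_top sequentially"
  unfolding filterlim_at_top
proof
  fix Z :: real
  define u where "u = max Z (2 * w)"
  have u: "u > 0" "u \<ge> Z" "u \<ge> 2 * w" using w by (auto simp: u_def)
  have V: "trunc_moment M X u > 0"
  proof -
    have "0 < u\<^sup>2 / 8 * tail u" using u tail_pos[of u] by simp
    also have "\<dots> \<le> trunc_moment M X u" using half[of "u / 2"] u by (intro trunc_moment_ge) auto
    finally show ?thesis .
  qed
  have "(\<lambda>n. 1 / real n) \<longlonglongrightarrow> 0" by (rule lim_1_over_n)
  then have "\<forall>\<^sub>F n in sequentially. 1 / real n < trunc_moment M X u / u\<^sup>2"
    using V u by (intro order_tendstoD(2)) auto
  then show "\<forall>\<^sub>F n in sequentially. Z \<le> norming M X n"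
    using eventually_ge_at_top[of 1]
  proof eventually_elim
    case (elim n)
    have "u \<le> norming M X n"
      unfolding norming_def using elim u by (intro cSup_upper bdd_above_norming_set) auto
    then show ?case using u by simp
  qed
qed

text \<open>\<open>n * tail\<close> is at most 8 at twice the norming constant and at least halves
  with each further doubling, so \<open>K\<close> can be taken as a power of 2.\<close>

lemma norming_tail:
  assumes e: "e > 0"
  shows "\<exists>K>0. \<forall>\<^sub>F n in sequentially. \<forall>x\<ge>K * norming M X n. real n * tail x \<le> e"
proof -
  have "(\<lambda>k. (1 / 2) ^ k * (8::real)) \<longlonglongrightarrow> 0 * 8" by (intro tendsto_mult LIMSEQ_power_zero tendsto_const) auto
  from order_tendstoD(2)[OF this, of e] e have "\<forall>\<^sub>F k in sequentially. (1 / 2) ^ k * 8 < e" by simp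
  then obtain k where k: "(1 / 2) ^ k * 8 < e" by (auto simp: eventually_sequentially)
  have "\<forall>\<^sub>F n in sequentially. norming M X n \<ge> 2 * w" using norming_at_top by (simp add: filterlim_at_top)
  then have "\<forall>\<^sub>F n in sequentially. \<forall>x\<ge>2 ^ k * 2 * norming M X n. real n * tail x \<le> e"
    using eventually_ge_at_top[of 1]
  proof (eventually_elim, intro allI impI)
    fix n :: nat and x assume nw: "norming M X n \<ge> 2 * w" and n: "n \<ge> 1" and x: "x \<ge> 2 ^ k * 2 * norming M X n"
    \<comment> \<open>The factor 2 puts \<open>u\<close> strictly above the supremum, hence outside
      the set that defines it.\<close>
    define u where "u = 2 * norming M X n"
    have u: "u > norming M X n" "u \<ge> 2 * w" "u \<ge> w" using nw w by (auto simp: u_def)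
    have "real n * tail x \<le> real n * tail (2 ^ k * u)"
      using x by (intro mult_left_mono tail_antimono) (auto simp: u_def)
    also have "\<dots> \<le> real n * ((1 / 2) ^ k * tail u)" using u by (intro mult_left_mono tail_dyadic) auto
    also have "\<dots> = (1 / 2) ^ k * (real n * tail u)" by simp
    also have "\<dots> \<le> (1 / 2) ^ k * 8" using mult_tail_above_norming[OF n u(1,2)] by (intro mult_left_mono) auto
    finally show "real n * tail x \<le> e" using k by linarith
  qed
  then show ?thesis by (intro exI[of _ "2 ^ k * 2"]) auto
qed

end

end

section \<open>From the domain of attraction to the asymptotics\<close>

text \<open>The Karamata bounds are expressed with the two-sided tail \<open>H\<close>. As
  \<open>H / F\<close> has a finite limit, \<open>H\<close> is eventually at most
  \<open>C1 * F\<close>, and all bounds can be restated with the right tail and one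
  constant.\<close>

lemma (in prob_space) attracted_heavy_walk:
  assumes iid: "iid_copies M X \<xi>" and \<alpha>: "1 < \<alpha>" "\<alpha> < 2" and \<beta>: "-1 < \<beta>" "\<beta> \<le> 1"
    and X: "integrable M X" "(\<integral>\<omega>. X \<omega> \<partial>M) = 0" and attr: "attracted_to_stable M \<xi> \<alpha> \<beta>"
  obtains c x0 where "heavy_walk M X \<xi> c x0"
proof -
  define F where "F x = prob {\<omega> \<in> space M. x \<le> X \<omega>}" for x
  define H where "H x = prob {\<omega> \<in> space M. x \<le> \<bar>X \<omega>\<bar>}" for x
  have [measurable]: "X \<in> borel_measurable M" using X by auto
  note t = attracted_tails[OF iid \<alpha> \<beta> attr, folded F_def H_def]
  have Fpos: "F x > 0" for x by (rule t(4))
  have FH: "F x \<le> H x" for x unfolding F_def H_def by (intro finite_measure_mono) auto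
  have Hpos: "H x > 0" for x using Fpos FH by (rule less_le_trans)
  obtain C0 where "((\<lambda>x. H x / F x) \<longlongrightarrow> C0) at_top" using t(3) by blast
  then have "\<forall>\<^sub>F x in at_top. H x / F x < C0 + 1" by (rule order_tendstoD) simp
  then obtain z0 where z0: "\<And>x. x \<ge> z0 \<Longrightarrow> H x / F x < C0 + 1" by (auto simp: eventually_at_top_linorder)
  define C1 where "C1 = max 1 (C0 + 1)"
  have HF: "H x \<le> C1 * F x" if "x \<ge> z0" for x
  proof -
    have "H x \<le> (C0 + 1) * F x" using z0[OF that] Fpos[of x] by (simp add: pos_divide_less_eq)
    also have "\<dots> \<le> C1 * F x" using Fpos[of x] by (intro mult_right_mono) (auto simp: C1_def)
    finally show ?thesis .
  qed
  obtain C2 z2 where C2: "C2 > 0" "z2 > 0" "\<And>x. x \<ge> z2 \<Longrightarrow> (\<integral>\<omega>. indicator {\<omega> \<in> space M. \<bar>X \<omega>\<bar> \<le> x} \<omega> * (X \<omega>)\<^sup>2 \<partial>M) \<le> C2 * x\<^sup>2 * H x"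
    using truncated_second_moment_bound[of X \<alpha>, folded H_def] t(2) Hpos \<alpha> by auto
  obtain C3 z3 where C3: "C3 > 0" "z3 > 0" "\<And>x. x \<ge> z3 \<Longrightarrow> (\<integral>\<omega>. indicator {\<omega> \<in> space M. x \<le> \<bar>X \<omega>\<bar>} \<omega> * \<bar>X \<omega>\<bar> \<partial>M) \<le> C3 * x * H x"
    using tail_expectation_bound[of X \<alpha>, folded H_def] X t(2) Hpos \<alpha> by auto
  define c where "c = C1 * max 1 (max C2 C3)"
  define x0 where "x0 = max z0 (max z2 z3)"
  have C1: "C1 \<ge> 1" by (simp add: C1_def)
  have c: "c > 0" unfolding c_def using C1 by (intro mult_pos_pos) auto
  have x0: "x0 > 0" "x0 \<ge> z0" "x0 \<ge> z2" "x0 \<ge> z3" using C2 C3 by (auto simp: x0_def)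
  have CH: "B * H x \<le> c * F x" if "B \<le> max 1 (max C2 C3)" "x \<ge> x0" for B x
  proof -
    have "B * H x \<le> max 1 (max C2 C3) * H x" using that Hpos[of x] by (intro mult_right_mono) auto
    also have "\<dots> \<le> max 1 (max C2 C3) * (C1 * F x)" using HF[of x] that x0 by (intro mult_left_mono) auto
    finally show ?thesis by (simp add: c_def mult_ac)
  qed
  have "heavy_walk M X \<xi> c x0"
  proof unfold_locales
    fix x assume x: "x0 \<le> x"
    show "prob {\<omega> \<in> space M. x \<le> \<bar>X \<omega>\<bar>} \<le> c * prob {\<omega> \<in> space M. x \<le> X \<omega>}"
      using CH[of 1 x] x by (simp add: F_def H_def)
    have "C2 * x\<^sup>2 * H x \<le> x\<^sup>2 * (c * F x)"
      using mult_left_mono[OF CH[of C2 x], of "x\<^sup>2"] x by (simp add: mult_ac)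
    also have "x\<^sup>2 * (c * F x) = c * x\<^sup>2 * F x" by simp
    finally have "C2 * x\<^sup>2 * H x \<le> c * x\<^sup>2 * F x" .
    then show "(\<integral>\<omega>. indicator {\<omega> \<in> space M. \<bar>X \<omega>\<bar> \<le> x} \<omega> * (X \<omega>)\<^sup>2 \<partial>M) \<le> c * x\<^sup>2 * prob {\<omega> \<in> space M. x \<le> X \<omega>}"
      unfolding F_def[symmetric] using C2(3)[OF order.trans[OF x0(3) x]] by (rule order.trans[rotated])
    have "C3 * x * H x \<le> x * (c * F x)"
      using mult_left_mono[OF CH[of C3 x], of "x"] x x0 by (simp add: mult_ac)
    also have "x * (c * F x) = c * x * F x" by simp
    finally have "C3 * x * H x \<le> c * x * F x" .
    then show "(\<integral>\<omega>. indicator {\<omega> \<in> space M. x \<le> \<bar>X \<omega>\<bar>} \<omega> * \<bar>X \<omega>\<bar> \<partial>M) \<le> c * x * prob {\<omega> \<in> space M. x \<le> X \<omega>}"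
      unfolding F_def[symmetric] using C3(3)[OF order.trans[OF x0(4) x]] by (rule order.trans[rotated])
  next
    fix l :: real assume l: "l > 0"
    define D where "D = l powr (- \<alpha>) + 1"
    have "D > 0" by (auto simp: D_def intro: add_nonneg_pos)
    have "\<forall>\<^sub>F x in at_top. F (l * x) / F x < D"
      by (rule order_tendstoD(2)[OF t(1)[OF l]]) (simp add: D_def)
    then obtain y where y: "\<And>x. x \<ge> y \<Longrightarrow> F (l * x) / F x < D" by (auto simp: eventually_at_top_linorder)
    have "F (l * x) \<le> D * F x" if "x \<ge> max 1 y" for x
      using y[of x] that Fpos[of x] by (simp add: pos_divide_less_eq)
    then show "\<exists>D y. D > 0 \<and> y > 0 \<and> (\<forall>x\<ge>y. prob {\<omega> \<in> space M. l * x \<le> X \<omega>} \<le> D * prob {\<omega> \<in> space M. x \<le> X \<omega>})"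
      using \<open>D > 0\<close> unfolding F_def by (intro exI[of _ D] exI[of _ "max 1 y"]) auto
  qed (use c x0 X iid in auto)
  then show thesis by (rule that)
qed

theorem theorem4:
  fixes M :: "'a measure" and X :: "'a \<Rightarrow> real" and \<xi> :: "nat \<Rightarrow> 'a \<Rightarrow> real"
    and \<alpha> \<beta> a\<^sub>0 :: real and n :: "real \<Rightarrow> nat"
  assumes "prob_space M"
    and "iid_copies M X \<xi>"
    and "1 < \<alpha>" and "\<alpha> < 2" and "-1 < \<beta>" and "\<beta> \<le> 1"
    and "integrable M X" and "(LINT \<omega>|M. X \<omega>) = 0"
    and "attracted_to_stable M \<xi> \<alpha> \<beta>"
    and "a\<^sub>0 > 0"
    and "\<And>a. 0 < a \<Longrightarrow> a \<le> a\<^sub>0 \<Longrightarrow> n a \<ge> 1"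
    and "filterlim n at_top (at_right 0)"
    and "filterlim (\<lambda>a. real (n a) * a / norming M X (n a)) at_top (at_right 0)"
  shows "((\<lambda>a. measure M {\<omega> \<in> space M. exit_time \<xi> a \<omega> > enat (n a)} /
               (mean_exit_time M \<xi> a * measure M {\<omega> \<in> space M. X \<omega> \<ge> real (n a) * a}))
          \<longlongrightarrow> 1) (at_right 0)"
proof -
  interpret prob_space M by fact
  obtain c x0 where "heavy_walk M X \<xi> c x0"
    using attracted_heavy_walk[OF assms(2-9)] by blast
  then interpret heavy_walk M X \<xi> c x0 .
  have tl: "((\<lambda>x. tail (l * x) / tail x) \<longlongrightarrow> l powr (- \<alpha>)) at_top" if "l > 0" for l
    unfolding tail_def by (rule attracted_tails(1)[OF assms(2-6,9) that])
  have tp: "tail x > 0" for x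
    unfolding tail_def by (rule attracted_tails(4)[OF assms(2-6,9)])
  obtain w where w: "w > 0" "\<And>x. x \<ge> w \<Longrightarrow> tail (2 * x) \<le> 1 / 2 * tail x"
  proof -
    have "2 powr (- \<alpha>) < 2 powr (- 1)" using assms(3) by (intro powr_less_mono) auto
    also have "2 powr (- 1) = (1 / 2 :: real)" by (simp add: powr_minus)
    finally have "\<forall>\<^sub>F x in at_top. tail (2 * x) / tail x < 1 / 2"
      by (intro order_tendstoD(2)[OF tl]) auto
    then obtain y where y: "\<And>x. x \<ge> y \<Longrightarrow> tail (2 * x) / tail x < 1 / 2" by (auto simp: eventually_at_top_linorder)
    have "tail (2 * x) \<le> 1 / 2 * tail x" if "x \<ge> max 1 y" for x
      using y[of x] that tp[of x] by (simp add: pos_divide_less_eq)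
    then show thesis by (intro that[of "max 1 y"]) auto
  qed
  define L where "L = (at_right 0 :: real filter)"
  define x where "x a = real (n a) * a" for a
  define h where "h a = real (n a) * tail (x a)" for a
  have norm_top: "filterlim (\<lambda>a. norming M X (n a)) at_top L"
    unfolding L_def by (rule filterlim_compose[OF norming_at_top[OF w tp] assms(12)])
  have apos: "\<forall>\<^sub>F a in L. a > 0"
    unfolding L_def by (simp add: eventually_at_right_less)
  have n1: "\<forall>\<^sub>F a in L. n a \<ge> N" for N
    using assms(12) unfolding L_def filterlim_at_top by blast
  have np: "\<forall>\<^sub>F a in L. norming M X (n a) > 0"
    using norm_top by (simp add: filterlim_at_top_dense)
  have xeq: "\<forall>\<^sub>F a in L. real (n a) * a / norming M X (n a) * norming M X (n a) = x a"
    using np by eventually_elim (simp add: x_def)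
  have "filterlim (\<lambda>a. real (n a) * a / norming M X (n a) * norming M X (n a)) at_top L"
    using assms(13) norm_top unfolding L_def by (rule filterlim_at_top_mult_at_top)
  then have x_top: "filterlim x at_top L"
    using filterlim_cong[OF refl refl xeq] by blast
  have h0: "(h \<longlongrightarrow> 0) L"
  proof (rule order_tendstoI)
    fix e :: real assume e: "0 < e"
    obtain K where K: "K > 0" "\<forall>\<^sub>F m in sequentially. \<forall>x\<ge>K * norming M X m. real m * tail x \<le> e / 2"
      using norming_tail[OF w tp, of "e / 2"] e by auto
    have "\<forall>\<^sub>F a in L. \<forall>x\<ge>K * norming M X (n a). real (n a) * tail x \<le> e / 2"
      using filterlim_iff[THEN iffD1, OF assms(12), rule_format, OF K(2)] unfolding L_def .
    moreover have "\<forall>\<^sub>F a in L. K \<le> real (n a) * a / norming M X (n a)"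
      using assms(13) unfolding L_def filterlim_at_top by blast
    ultimately show "\<forall>\<^sub>F a in L. h a < e"
      using np
    proof eventually_elim
      case (elim a)
      then have "K * norming M X (n a) \<le> x a" by (simp add: x_def pos_le_divide_eq)
      then have "h a \<le> e / 2" using elim(1) by (simp add: h_def)
      then show ?case using e by linarith
    qed
  next
    fix e :: real assume e: "e < 0"
    have "e < h a" for a
      by (rule less_le_trans[OF e]) (simp add: h_def)
    then show "\<forall>\<^sub>F a in L. e < h a" by (intro always_eventually allI)
  qed
  have hle: "\<forall>\<^sub>F a in L. h a \<le> r" if "r > 0" for r
    using order_tendstoD(2)[OF h0 that] by eventually_elim simp
  have xge: "\<forall>\<^sub>F a in L. x a \<ge> r" for r
    using x_top by (simp add: filterlim_at_top)
  define p where "p a = prob (surv a (n a))" for a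
  define E where "E a = mean_exit_time M \<xi> a" for a
  \<comment> \<open>The constants of the growth bound are uniform in \<open>a\<close> and
    \<open>n\<close>, so they apply along \<open>n a\<close>. The factor
    \<open>exp (K * h a)\<close> tends to 1, which makes the mean exit time interchangeable with
    \<open>mu a (n a)\<close>.\<close>
  have "\<exists>K>0. \<forall>\<^sub>F a in L. mu a (n a) \<le> E a \<and> E a \<le> mu a (n a) * exp (K * h a) \<and> mu a (n a) \<ge> 1"
  proof (rule mu_growth_bound)
    fix K y0 k0 N0 assume K: "K > 0" "y0 > 0" "k0 > 0" and
      growth: "\<And>a n j. a > 0 \<Longrightarrow> n \<ge> N0 \<Longrightarrow> n \<ge> 1 \<Longrightarrow> real n * a \<ge> y0 \<Longrightarrow> real n * tail (real n * a) \<le> k0 \<Longrightarrow> j \<ge> n \<Longrightarrow>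
        mu a j \<le> mu a n * exp (K * (real n * tail (real n * a)))"
    have "\<forall>\<^sub>F a in L. mu a (n a) \<le> E a \<and> E a \<le> mu a (n a) * exp (K * h a) \<and> mu a (n a) \<ge> 1"
      using apos n1[of N0] n1[of 1] xge[of y0] hle[OF K(3)]
    proof eventually_elim
      case (elim a)
      have *: "mu a j \<le> mu a (n a) * exp (K * h a)" if "j \<ge> n a" for j
        unfolding h_def x_def by (rule growth) (use elim that in \<open>auto simp: x_def h_def\<close>)
      show ?case
        unfolding E_def using mean_exit_time_bounds[OF *] mu_ge_1[of "n a" a] elim by auto
    qed
    with K(1) show ?thesis by blast
  qed
  then obtain K where K: "K > 0" and
    Ebounds: "\<forall>\<^sub>F a in L. mu a (n a) \<le> E a \<and> E a \<le> mu a (n a) * exp (K * h a) \<and> mu a (n a) \<ge> 1"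
    by blast
  have ratio: "((\<lambda>a. p a / (E a * tail (x a))) \<longlongrightarrow> 1) L"
  proof (rule order_tendstoI)
    fix e :: real assume e: "1 < e"
    \<comment> \<open>\<open>d\<close> is fixed before \<open>a\<close> tends to 0, small enough
      that the limit \<open>(1 - d) powr (- \<alpha>)\<close> of the ratio of tails stays below
      \<open>e\<close>.\<close>
    have "((\<lambda>d. (1 - d) powr (- \<alpha>)) \<longlongrightarrow> (1 - 0) powr (- \<alpha>)) (at_right 0)"
      by (intro tendsto_intros) auto
    then have "\<forall>\<^sub>F d in at_right 0. (1 - d) powr (- \<alpha>) < e"
      using e by (intro order_tendstoD(2)) auto
    moreover have "\<forall>\<^sub>F d in at_right 0. d \<in> {0<..<1::real}"
      by (rule eventually_at_right_real) simp
    ultimately have "\<forall>\<^sub>F d in at_right 0. (1 - d) powr (- \<alpha>) < e \<and> d \<in> {0<..<1::real}"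
      by (rule eventually_conj)
    from eventually_happens[OF this] obtain d where d: "(1 - d) powr (- \<alpha>) < e" "0 < d" "d < 1" by auto
    show "\<forall>\<^sub>F a in L. p a / (E a * tail (x a)) < e"
    proof (rule upper_bound[OF d(2,3)])
      fix C y k N assume C: "C > 0" "y > 0" "k > 0" and
        ub: "\<And>a n. a > 0 \<Longrightarrow> n \<ge> N \<Longrightarrow> real n * a \<ge> y \<Longrightarrow> real n * tail (real n * a) \<le> k \<Longrightarrow>
         prob (surv a n) \<le> mu a n * (tail ((1 - d) * (real n * a)) + C * (real n * tail (real n * a)) * tail (real n * a))"
      have "((\<lambda>a. tail ((1 - d) * x a) / tail (x a) + C * h a) \<longlongrightarrow> (1 - d) powr (- \<alpha>) + C * 0) L"
        by (intro tendsto_add tendsto_mult tendsto_const h0 filterlim_compose[OF tl x_top]) (use d in auto)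
      then have "\<forall>\<^sub>F a in L. tail ((1 - d) * x a) / tail (x a) + C * h a < e"
        using d(1) by (intro order_tendstoD(2)) auto
      then show "\<forall>\<^sub>F a in L. p a / (E a * tail (x a)) < e"
        using apos n1[of N] xge[of y] hle[OF C(3)] Ebounds
      proof eventually_elim
        case (elim a)
        have "p a \<le> mu a (n a) * (tail ((1 - d) * x a) + C * h a * tail (x a))"
          unfolding p_def x_def h_def by (rule ub) (use elim in \<open>auto simp: x_def h_def\<close>)
        also have "\<dots> = mu a (n a) * ((tail ((1 - d) * x a) / tail (x a) + C * h a) * tail (x a))"
          using tp[of "x a"] by (simp add: field_simps)
        also have "\<dots> < mu a (n a) * (e * tail (x a))"
          using elim tp[of "x a"] by (intro mult_strict_left_mono mult_strict_right_mono) auto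
        also have "\<dots> \<le> E a * (e * tail (x a))"
          using elim e tp[of "x a"] by (intro mult_right_mono) auto
        finally have "p a < e * (E a * tail (x a))" by (simp add: mult_ac)
        then show ?case using elim tp[of "x a"] by (subst pos_divide_less_eq) auto
      qed
    qed
  next
    fix e :: real assume e: "e < 1"
    have "((\<lambda>d. (1 + d) powr (- \<alpha>)) \<longlongrightarrow> (1 + 0) powr (- \<alpha>)) (at_right 0)"
      by (intro tendsto_intros) auto
    then have "\<forall>\<^sub>F d in at_right 0. e < (1 + d) powr (- \<alpha>)"
      using e by (intro order_tendstoD(1)) auto
    moreover have "\<forall>\<^sub>F d in at_right 0. d \<in> {0<..<1::real}"
      by (rule eventually_at_right_real) simp
    ultimately have "\<forall>\<^sub>F d in at_right 0. e < (1 + d) powr (- \<alpha>) \<and> d \<in> {0<..<1::real}"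
      by (rule eventually_conj)
    from eventually_happens[OF this] obtain d where d: "e < (1 + d) powr (- \<alpha>)" "0 < d" by auto
    show "\<forall>\<^sub>F a in L. e < p a / (E a * tail (x a))"
    proof (rule lower_bound[OF d(2)])
      fix C y assume C: "C > 0" "y > 0" and
        lb: "\<And>a n. a > 0 \<Longrightarrow> n \<ge> 1 \<Longrightarrow> real n * a \<ge> y \<Longrightarrow> C * (real n * tail (real n * a)) \<le> 1 \<Longrightarrow>
         prob (surv a n) \<ge> mu a n * tail ((1 + d) * (real n * a)) * (1 - real n * tail (real n * a)) * (1 - C * (real n * tail (real n * a)))"
      have invC: "1 / C > 0" using C by simp
      \<comment> \<open>The factor \<open>exp (- (K * h a))\<close> pays for replacing
        \<open>mu a (n a)\<close> by the larger mean exit time.\<close>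
      let ?q = "\<lambda>a. tail ((1 + d) * x a) / tail (x a) * (1 - h a) * (1 - C * h a) * exp (- (K * h a))"
      have "(?q \<longlongrightarrow> (1 + d) powr (- \<alpha>) * (1 - 0) * (1 - C * 0) * exp (- (K * 0))) L"
        by (intro tendsto_intros h0 filterlim_compose[OF tl x_top]) (use d in auto)
      then have "\<forall>\<^sub>F a in L. e < ?q a"
        using d(1) by (intro order_tendstoD(1)) auto
      then show "\<forall>\<^sub>F a in L. e < p a / (E a * tail (x a))"
        using apos n1[of 1] xge[of y] hle[OF invC] hle[OF zero_less_one] Ebounds
      proof eventually_elim
        case (elim a)
        have hC: "C * h a \<le> 1" using elim(5) C(1) by (simp add: field_simps)
        \<comment> \<open>Raising \<open>E a\<close> to its upper bound preserves the inequality
          because \<open>?q a\<close> is nonnegative, which rests on \<open>h a \<le> 1\<close> and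
          \<open>C * h a \<le> 1\<close>.\<close>
        have "E a * tail (x a) * ?q a \<le> mu a (n a) * exp (K * h a) * tail (x a) * ?q a"
          using elim hC tp[of "x a"] by (intro mult_right_mono mult_nonneg_nonneg) auto
        also have "\<dots> = mu a (n a) * tail ((1 + d) * x a) * (1 - h a) * (1 - C * h a) * (exp (K * h a) * exp (- (K * h a)))"
          using tp[of "x a"] by (simp add: field_simps)
        also have "exp (K * h a) * exp (- (K * h a)) = 1" by (simp flip: exp_add)
        also have "mu a (n a) * tail ((1 + d) * x a) * (1 - h a) * (1 - C * h a) * 1 \<le> p a"
          unfolding p_def x_def h_def mult_1_right by (rule lb) (use elim hC in \<open>auto simp: x_def h_def\<close>)
        finally have "?q a * (E a * tail (x a)) \<le> p a" by (simp add: mult_ac)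
        moreover have "E a * tail (x a) > 0" using elim tp[of "x a"] by (intro mult_pos_pos) auto
        ultimately have "?q a \<le> p a / (E a * tail (x a))" by (simp only: pos_le_divide_eq)
        then show ?case using elim(1) by linarith
      qed
    qed
  qed
  show ?thesis
    using ratio unfolding p_def E_def L_def surv_eq tail_def x_def .
qed

end
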